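(* Let $Q$ be a Markov transition kernel on a metric space $\mathcal{X}$, let $\mu$ be an invariant measure for $Q$, and assume that $Q$ induces a self-adjoint compact operator on $L^2(\mu)$. Let $X=(X_u,u\in\mathbb{T}^\infty)$ be a branching Markov process on $\mathbb{T}^\infty$ with transition kernel $Q$ and initial distribution $\nu=\mu$. Let $f$ be a non-constant function in $L^2(\mu)$. For a finite non-empty subset $A\subset\mathbb{T}^\infty$, set $\bar M_A(f)=|A|^{-1}\sum_{u\in A}f(X_u)$. Then: (1) $\mathbb{E}[\bar M_A(f)]=\langle\mu,f\rangle$ for every finite non-empty subset $A\subset\mathbb{T}^\infty$. (2) For every integer $n\ge 1$, the minimum of the map $A\mapsto \mathrm{Var}(\bar M_A(f))$ among subtrees $A$ of $\mathbb{T}^\infty$ with cardinality $n$ is achieved by the line graph tree with $n$ vertices. (3) When $n\ge 5$, the line graph is the only subtree of size $n$ (up to isomorphism of unrooted trees) achieving this minimum if and only if $f\notin \mathrm{Ker}(Q)\oplus\mathrm{Ker}(Q-I)\oplus\mathrm{Ker}(Q+I)$, where the kernels are those of operators on $L^2(\mu)$ and $I$ is the identity.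
   Context: $\mathbb{T}^\infty=\bigcup_{n\in\mathbb{N}}(\mathbb{N}^* )^n$ is the Ulam-Harris-Neveu tree, with root $\partial$ the empty word; the parent $\mathrm{p}(u)$ of a non-root vertex $u$ is obtained by deleting its last letter. A subtree of $\mathbb{T}^\infty$ is a connected subset of vertices with the induced tree structure. The line graph tree with $n$ vertices is the path on $n$ vertices. $|A|$ denotes the cardinality of $A$. A stochastic process $X=(X_u,u\in\mathbb{T}^\infty)$ with values in a metric space $\mathcal{X}$ (with its Borel $\sigma$-field) is a branching Markov process with transition kernel $Q$ and initial distribution $\nu$ (a probability measure on $\mathcal{X}$) if for every finite subtree $T\subset\mathbb{T}^\infty$ with $\partial\in T$, $$\mathbb{P}\Bigl(\bigcap_{u\in T}\{X_u\in \mathrm{d}x_u\}\Bigr)=\nu(\mathrm{d}x_\partial)\prod_{u\in T\setminus\{\partial\}}Q(x_{\mathrm{p}(u)};\mathrm{d}x_u).$$ $Qf(x)=\int f(y)\,Q(x;\mathrm{d}y)$ and $\langle\mu,f\rangle=\int f\,\mathrm{d}\mu$. Invariant measures are understood to be probability measures; $L^2(\mu)$ consists of real-valued functions modulo $\mu$-a.e. equality, and non-constant means not $\mu$-a.e. equal to a constant. *)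

theory Defs
  imports "HOL-Probability.Probability"
begin

text \<open>Vertices are words, i.e. lists of positive integers; the root is the empty word, and
  the parent of a non-root word \<open>u\<close> is \<open>butlast u\<close>.\<close>

definition UHN :: "nat list set" where
  "UHN = lists {1..}"

definition uhn_adj :: "nat list \<Rightarrow> nat list \<Rightarrow> bool" where
  "uhn_adj u v \<longleftrightarrow> (u \<noteq> [] \<and> butlast u = v) \<or> (v \<noteq> [] \<and> butlast v = u)"

text \<open>A subtree is identified with its vertex set.  Connectedness refers to the induced graph:
  the connecting paths have to stay inside \<open>A\<close>.\<close>

definition subtree :: "nat list set \<Rightarrow> bool" where
  "subtree A \<longleftrightarrow> A \<subseteq> UHN \<and> A \<noteq> {} \<and>
     (\<forall>u\<in>A. \<forall>v\<in>A. (u, v) \<in> {(x, y). x \<in> A \<and> y \<in> A \<and> uhn_adj x y}\<^sup>*)"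

definition subtree_of_size :: "nat \<Rightarrow> nat list set \<Rightarrow> bool" where
  "subtree_of_size n A \<longleftrightarrow> subtree A \<and> finite A \<and> card A = n"

definition graph_isomorphic ::
  "'v set \<Rightarrow> ('v \<Rightarrow> 'v \<Rightarrow> bool) \<Rightarrow> 'w set \<Rightarrow> ('w \<Rightarrow> 'w \<Rightarrow> bool) \<Rightarrow> bool" where
  "graph_isomorphic V E W F \<longleftrightarrow>
     (\<exists>\<phi>. bij_betw \<phi> V W \<and> (\<forall>x\<in>V. \<forall>y\<in>V. E x y \<longleftrightarrow> F (\<phi> x) (\<phi> y)))"

text \<open>Isomorphism with the path on \<open>{0, \<dots>, n - 1}\<close>, as unrooted graphs: the path may be placed
  in the tree in any way, in particular its end points need not be closest to the root.\<close>

definition is_line_graph :: "nat \<Rightarrow> nat list set \<Rightarrow> bool" where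
  "is_line_graph n A \<longleftrightarrow>
     graph_isomorphic {..<n} (\<lambda>i j. j = Suc i \<or> i = Suc j) A uhn_adj"

definition markov_kernel :: "('a::metric_space \<Rightarrow> 'a measure) \<Rightarrow> bool" where
  "markov_kernel Q \<longleftrightarrow> Q \<in> borel \<rightarrow>\<^sub>M prob_algebra borel"

definition borel_prob :: "'a::metric_space measure \<Rightarrow> bool" where
  "borel_prob \<mu> \<longleftrightarrow> prob_space \<mu> \<and> sets \<mu> = sets borel"

definition invariant_measure :: "('a::metric_space \<Rightarrow> 'a measure) \<Rightarrow> 'a measure \<Rightarrow> bool" where
  "invariant_measure Q \<mu> \<longleftrightarrow> borel_prob \<mu> \<and> \<mu> \<bind> Q = \<mu>"

text \<open>\<open>us\<close> lists \<open>T\<close> without its root, every vertex coming after its parent.\<close>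

definition parent_first_enum :: "nat list set \<Rightarrow> nat list list \<Rightarrow> bool" where
  "parent_first_enum T us \<longleftrightarrow> distinct us \<and> set us = T - {[]} \<and>
     (\<forall>i<length us. butlast (us ! i) \<in> insert [] (set (take i us)))"

text \<open>The product measure \<open>\<nu>(dx\<^sub>\<partial>) \<Prod>\<^sub>u Q(x\<^bsub>p(u)\<^esub>; dx\<^sub>u)\<close>, over \<open>u\<close> in \<open>T\<close> minus the root, is the
  iterated integral in which the coordinates are drawn one after the other along a
  parent-first enumeration of \<open>T\<close>; \<open>x\<close> holds the coordinates drawn so far.\<close>

primrec draw_vertices ::
  "('a::metric_space \<Rightarrow> 'a measure) \<Rightarrow> nat list set \<Rightarrow> nat list list \<Rightarrow>
   (nat list \<Rightarrow> 'a) \<Rightarrow> (nat list \<Rightarrow> 'a) measure" where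
  "draw_vertices Q T [] x = return (Pi\<^sub>M T (\<lambda>_. borel)) x"
| "draw_vertices Q T (u # us) x =
     Q (x (butlast u)) \<bind> (\<lambda>y. draw_vertices Q T us (x(u := y)))"

definition tree_law ::
  "('a::metric_space \<Rightarrow> 'a measure) \<Rightarrow> 'a measure \<Rightarrow> nat list set \<Rightarrow> nat list list \<Rightarrow>
   (nat list \<Rightarrow> 'a) measure" where
  "tree_law Q \<nu> T us =
     \<nu> \<bind> (\<lambda>y. draw_vertices Q T us ((\<lambda>_. undefined)([] := y)))"

text \<open>By Fubini the law does not depend on the enumeration, and every finite subtree containing
  the root has one (sort by length), so the quantification over \<open>us\<close> is harmless.\<close>

definition branching_markov_process ::
  "'w measure \<Rightarrow> (nat list \<Rightarrow> 'w \<Rightarrow> 'a::metric_space) \<Rightarrow> ('a \<Rightarrow> 'a measure) \<Rightarrow> 'a measure \<Rightarrow> bool"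
where
  "branching_markov_process M X Q \<nu> \<longleftrightarrow>
     prob_space M \<and> (\<forall>u\<in>UHN. X u \<in> M \<rightarrow>\<^sub>M borel) \<and>
     (\<forall>T us. subtree T \<and> finite T \<and> [] \<in> T \<and> parent_first_enum T us \<longrightarrow>
        distr M (Pi\<^sub>M T (\<lambda>_. borel)) (\<lambda>\<omega>. \<lambda>u\<in>T. X u \<omega>) = tree_law Q \<nu> T us)"

definition empirical_mean ::
  "(nat list \<Rightarrow> 'w \<Rightarrow> 'a) \<Rightarrow> ('a \<Rightarrow> real) \<Rightarrow> nat list set \<Rightarrow> 'w \<Rightarrow> real" where
  "empirical_mean X f A \<omega> = (\<Sum>u\<in>A. f (X u \<omega>)) / real (card A)"

definition variance_of_mean ::
  "'w measure \<Rightarrow> (nat list \<Rightarrow> 'w \<Rightarrow> 'a) \<Rightarrow> ('a \<Rightarrow> real) \<Rightarrow> nat list set \<Rightarrow> real" where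
  "variance_of_mean M X f A = prob_space.variance M (empirical_mean X f A)"

text \<open>Elements of \<open>L\<^sup>2(\<mu>)\<close> are handled through representatives, and equality is equality
  \<open>\<mu>\<close>-almost everywhere.\<close>

definition L2 :: "'a measure \<Rightarrow> ('a \<Rightarrow> real) set" where
  "L2 \<mu> = {f \<in> borel_measurable \<mu>. integrable \<mu> (\<lambda>x. (f x)\<^sup>2)}"

definition L2_norm :: "'a measure \<Rightarrow> ('a \<Rightarrow> real) \<Rightarrow> real" where
  "L2_norm \<mu> f = sqrt (\<integral>x. (f x)\<^sup>2 \<partial>\<mu>)"

definition L2_inner :: "'a measure \<Rightarrow> ('a \<Rightarrow> real) \<Rightarrow> ('a \<Rightarrow> real) \<Rightarrow> real" where
  "L2_inner \<mu> f g = (\<integral>x. f x * g x \<partial>\<mu>)"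

definition kernel_op :: "('a \<Rightarrow> 'a measure) \<Rightarrow> ('a \<Rightarrow> real) \<Rightarrow> 'a \<Rightarrow> real" where
  "kernel_op Q f x = (\<integral>y. f y \<partial>(Q x))"

text \<open>\<open>T\<close> passes to a linear map on the quotient of \<open>L2 \<mu>\<close> by almost everywhere equality.\<close>

definition L2_operator :: "'a measure \<Rightarrow> (('a \<Rightarrow> real) \<Rightarrow> 'a \<Rightarrow> real) \<Rightarrow> bool" where
  "L2_operator \<mu> T \<longleftrightarrow>
     (\<forall>f\<in>L2 \<mu>. T f \<in> L2 \<mu>) \<and>
     (\<forall>f\<in>L2 \<mu>. \<forall>g\<in>L2 \<mu>. (AE x in \<mu>. f x = g x) \<longrightarrow> (AE x in \<mu>. T f x = T g x)) \<and>
     (\<forall>f\<in>L2 \<mu>. \<forall>g\<in>L2 \<mu>. AE x in \<mu>. T (\<lambda>y. f y + g y) x = T f x + T g x) \<and>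
     (\<forall>f\<in>L2 \<mu>. \<forall>c. AE x in \<mu>. T (\<lambda>y. c * f y) x = c * T f x)"

definition L2_self_adjoint :: "'a measure \<Rightarrow> (('a \<Rightarrow> real) \<Rightarrow> 'a \<Rightarrow> real) \<Rightarrow> bool" where
  "L2_self_adjoint \<mu> T \<longleftrightarrow> (\<forall>f\<in>L2 \<mu>. \<forall>g\<in>L2 \<mu>. L2_inner \<mu> (T f) g = L2_inner \<mu> f (T g))"

definition L2_compact :: "'a measure \<Rightarrow> (('a \<Rightarrow> real) \<Rightarrow> 'a \<Rightarrow> real) \<Rightarrow> bool" where
  "L2_compact \<mu> T \<longleftrightarrow>
     (\<forall>g :: nat \<Rightarrow> 'a \<Rightarrow> real. (\<forall>n. g n \<in> L2 \<mu>) \<and> (\<exists>B. \<forall>n. L2_norm \<mu> (g n) \<le> B) \<longrightarrow>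
        (\<exists>h\<in>L2 \<mu>. \<exists>r. strict_mono r \<and>
           (\<lambda>n. L2_norm \<mu> (\<lambda>x. T (g (r n)) x - h x)) \<longlonglongrightarrow> 0))"

definition L2_ker :: "'a measure \<Rightarrow> (('a \<Rightarrow> real) \<Rightarrow> 'a \<Rightarrow> real) \<Rightarrow> ('a \<Rightarrow> real) set" where
  "L2_ker \<mu> T = {f \<in> L2 \<mu>. AE x in \<mu>. T f x = 0}"

text \<open>The sum of subspaces \<open>U\<close> and \<open>V\<close>.  It is applied to eigenspaces of one operator for
  different eigenvalues, so it is automatically direct.\<close>

definition L2_sum :: "'a measure \<Rightarrow> ('a \<Rightarrow> real) set \<Rightarrow> ('a \<Rightarrow> real) set \<Rightarrow> ('a \<Rightarrow> real) set" where
  "L2_sum \<mu> U V = {f \<in> L2 \<mu>. \<exists>g\<in>U. \<exists>h\<in>V. AE x in \<mu>. f x = g x + h x}"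

end

theory Submission
  imports Defs "HOL-Library.Sublist" "HOL-Computational_Algebra.Polynomial"
begin

text \<open>The covariance of \<open>f (X\<^sub>u)\<close> and \<open>f (X\<^sub>v)\<close> is \<open>c (d (u, v))\<close>, where \<open>d\<close> is the tree
  distance and \<open>c k = \<langle>f\<^sub>0, Q\<^sup>k f\<^sub>0\<rangle>\<close> for the centered function \<open>f\<^sub>0\<close>.  As \<open>Q\<close> is a
  self-adjoint contraction, \<open>c\<close> behaves like a moment sequence on \<open>[-1, 1]\<close>: the linear functional
  sending \<open>\<lambda>\<^sup>k\<close> to \<open>c k\<close> is nonnegative on polynomials that are nonnegative on
  \<open>[-1, 1]\<close>.  This replaces the spectral theorem, so the variance problem reduces to comparing the
  polynomials \<open>\<Sum>u v. \<lambda>\<^bsup>d (u, v)\<^esup>\<close> of a tree and of the path.  For \<open>\<lambda> \<ge> 0\<close> a direct induction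
  works.  For \<open>\<lambda> = -t \<le> 0\<close>, let every edge be kept with probability \<open>t\<close>: the polynomial is the
  expected sum, over the clusters, of the squared difference of the sizes of the two colour classes.
  This is at least the expected number of odd clusters, with equality for paths, and that number does
  not increase under tree shifts, which turn any tree into a path.  The comparison is strict on
  \<open>(-1, 1) - {0}\<close> for every other tree, so a tie forces \<open>Q\<^sup>3 f\<^sub>0 = Q f\<^sub>0\<close>.  Conversely, if
  \<open>Q\<^sup>3 f\<^sub>0 = Q f\<^sub>0\<close> then the variance depends only on the sizes of the two colour classes, and for
  \<open>n \<ge> 5\<close> some non-path has the same ones as the path.\<close>

section \<open>Rooted trees\<close>

text \<open>The obstacle is negative \<open>l\<close>: root sums then have no fixed sign and need
  not be smallest for a path, so the induction over edges that settles \<open>l \<ge> 0\<close>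
  breaks down. Percolation fits because two vertices at distance \<open>d\<close> share a cluster
  with probability \<open>t ^ d\<close>, while \<open>(-1) ^ d\<close> tells whether they have the
  same colour; the signed sum over pairs becomes an expected sum of squared imbalances. The square
  of an integer is at least the indicator that it is odd, with equality at -1, 0 and 1, the only
  imbalances of a path. As soon as some vertex has three neighbours, a cluster of imbalance 2 or -2
  has positive probability, whence strictness. At -1, 0 and 1 the difference of the two polynomials
  may vanish, but it still dominates a positive multiple of an even power of
  \<open>x - x ^ 3\<close>, and \<open>x - x ^ 3\<close> corresponds to
  \<open>Q f\<^sub>0 - Q\<^sup>3 f\<^sub>0\<close>.\<close>

text \<open>\<open>Graft T c\<close> makes the root of \<open>c\<close> a further child of the root of \<open>T\<close>.\<close>

datatype rtree = Single | Graft rtree rtree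

primrec rsize :: "rtree \<Rightarrow> nat" where
  "rsize Single = 1"
| "rsize (Graft T c) = rsize T + rsize c"

text \<open>The depth polynomial: a vertex at depth \<open>d\<close> contributes
  \<open>l ^ d\<close>. In \<open>pair_sum\<close> an ordered pair contributes \<open>l\<close> to
  the power of its distance; the cross pairs created by grafting are those whose path uses the new
  edge.\<close>

primrec root_sum :: "real \<Rightarrow> rtree \<Rightarrow> real" where
  "root_sum l Single = 1"
| "root_sum l (Graft T c) = root_sum l T + l * root_sum l c"

primrec pair_sum :: "real \<Rightarrow> rtree \<Rightarrow> real" where
  "pair_sum l Single = 1"
| "pair_sum l (Graft T c) = pair_sum l T + pair_sum l c + 2 * l * root_sum l T * root_sum l c"

primrec rpath :: "rtree \<Rightarrow> bool" where
  "rpath Single \<longleftrightarrow> True"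
| "rpath (Graft T c) \<longleftrightarrow> T = Single \<and> rpath c"

text \<open>Unlike in \<open>rpath\<close>, the root may be an inner vertex: one arm is
  \<open>T\<close>, the other runs through the new edge into \<open>c\<close>.\<close>

primrec upath :: "rtree \<Rightarrow> bool" where
  "upath Single \<longleftrightarrow> True"
| "upath (Graft T c) \<longleftrightarrow> rpath T \<and> rpath c"

abbreviation stem :: "rtree \<Rightarrow> rtree" where
  "stem \<equiv> Graft Single"

definition end_path :: "nat \<Rightarrow> rtree" where
  "end_path n = (stem ^^ (n - 1)) Single"

lemma rsize_pos: "rsize T > 0"
  by (induction T) auto

lemma rsize_eq_1 [simp]: "rsize T = Suc 0 \<longleftrightarrow> T = Single"
proof (cases T)
  case (Graft U c)
  then show ?thesis
    using rsize_pos[of U] rsize_pos[of c] by simp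
qed simp

lemma end_path_1 [simp]: "end_path (Suc 0) = Single"
  by (simp add: end_path_def)

lemma end_path_Suc: "n > 0 \<Longrightarrow> end_path (Suc n) = stem (end_path n)"
  by (cases n) (simp_all add: end_path_def)

lemma rsize_end_path: "n > 0 \<Longrightarrow> rsize (end_path n) = n"
  by (induction n rule: nat_induct_non_zero) (simp_all add: end_path_Suc)

lemma rpath_imp_end_path: "rpath T \<Longrightarrow> T = end_path (rsize T)"
  by (induction T) (use rsize_pos in \<open>auto simp: end_path_Suc\<close>)

section \<open>Depth and pair polynomials of paths; minimality for nonnegative
  \<open>l\<close>\<close>

lemma root_sum_end_path: "n > 0 \<Longrightarrow> root_sum l (end_path n) = (\<Sum>i<n. l ^ i)"
  by (induction n rule: nat_induct_non_zero)
    (simp_all add: end_path_Suc sum.lessThan_Suc_shift sum_distrib_left del: sum.lessThan_Suc)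

lemma geometric_split: "(\<Sum>i<m + n. l ^ i) = (\<Sum>i<m. l ^ i) + l ^ m * (\<Sum>i<n. (l::real) ^ i)"
  by (induction n) (simp_all add: power_add algebra_simps)

text \<open>Cutting a path at an edge leaves two paths that meet the cut at their end points, so the
  cross pairs give a product of two depth polynomials.\<close>

lemma pair_sum_end_path_add:
  assumes "m > 0" "n > 0"
  shows "pair_sum l (end_path (m + n)) = pair_sum l (end_path m) + pair_sum l (end_path n)
    + 2 * l * root_sum l (end_path m) * root_sum l (end_path n)"
  using assms
proof (induction m rule: nat_induct_non_zero)
  case (Suc m)
  have "root_sum l (end_path (m + n)) = root_sum l (end_path m) + l ^ m * root_sum l (end_path n)"
    using Suc by (simp add: root_sum_end_path geometric_split)
  moreover have "root_sum l (end_path (Suc m)) = root_sum l (end_path m) + l ^ m"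
    using Suc by (simp add: root_sum_end_path)
  moreover have "root_sum l (end_path (Suc m)) = 1 + l * root_sum l (end_path m)"
    using Suc by (simp add: end_path_Suc)
  \<comment> \<open>Comparing the two preceding formulas gives \<open>l ^ m = 1 + l * R - R\<close>
    with \<open>R = root_sum l (end_path m)\<close>, which eliminates the power.\<close>
  moreover have "l * (l ^ m * root_sum l (end_path n))
      = l * root_sum l (end_path n) * (1 + l * root_sum l (end_path m) - root_sum l (end_path m))"
    using calculation(2,3) by (simp add: algebra_simps)
  ultimately show ?case
    using Suc by (simp add: end_path_Suc algebra_simps)
qed (simp add: end_path_Suc)

lemma pair_sum_upath: "upath T \<Longrightarrow> pair_sum l T = pair_sum l (end_path (rsize T))"
  by (cases T) (auto simp: pair_sum_end_path_add rsize_pos dest!: rpath_imp_end_path)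

text \<open>A path pushes vertices as deep as possible: in it the branch starts at depth
  \<open>rsize T\<close> instead of 1, and powers of \<open>l\<close> decrease.\<close>

lemma root_sum_ge:
  assumes "0 \<le> l" "l \<le> 1"
  shows "root_sum l (end_path (rsize T)) \<le> root_sum l T"
proof (induction T)
  case (Graft T c)
  let ?s = "\<lambda>T. root_sum l (end_path (rsize T))"
  have "l ^ rsize T * ?s c \<le> l * ?s c"
    using assms power_decreasing[of 1 "rsize T" l] rsize_pos[of T]
    by (intro mult_right_mono) (auto simp: root_sum_end_path rsize_pos intro!: sum_nonneg)
  also have "\<dots> \<le> l * root_sum l c"
    using assms Graft by (intro mult_left_mono) auto
  finally show ?case
    using Graft by (simp add: root_sum_end_path rsize_pos geometric_split)
qed (simp add: root_sum_end_path)

lemma root_sum_gt: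
  assumes "0 < l" "l < 1" "\<not> rpath T"
  shows "root_sum l (end_path (rsize T)) < root_sum l T"
  using assms(3)
proof (induction T)
  case (Graft T c)
  let ?s = "\<lambda>T. root_sum l (end_path (rsize T))"
  have pos: "?s c > 0"
    using assms rsize_pos[of c] by (auto simp: root_sum_end_path intro!: sum_pos)
  have le: "l ^ rsize T * ?s c \<le> l * ?s c"
    using assms power_decreasing[of 1 "rsize T" l] rsize_pos[of T] pos
    by (intro mult_right_mono) auto
  have ge: "?s T \<le> root_sum l T" "l * ?s c \<le> l * root_sum l c"
    using assms by (simp_all add: root_sum_ge)
  \<comment> \<open>Two sources of strictness: if \<open>T\<close> is a single vertex, the branch is
    not a path; otherwise \<open>rsize T > 1\<close> and the depth really grows.\<close>
  have "l ^ rsize T * ?s c < l * root_sum l c"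
  proof (cases "T = Single")
    case True
    then show ?thesis
      using Graft assms by simp
  next
    case False
    then have "1 < rsize T"
      using rsize_pos[of T] rsize_eq_1[of T] by linarith
    then have "l ^ rsize T < l ^ 1"
      using assms by (intro power_strict_decreasing) auto
    then have "l ^ rsize T * ?s c < l * ?s c"
      using pos by simp
    then show ?thesis
      using ge by linarith
  qed
  then show ?case
    using ge by (simp add: root_sum_end_path rsize_pos geometric_split)
qed simp

lemma root_sum_end_path_pos: "0 \<le> l \<Longrightarrow> n > 0 \<Longrightarrow> root_sum l (end_path n) > 0"
  by (auto simp: root_sum_end_path gr0_conv_Suc sum.lessThan_Suc_shift simp del: sum.lessThan_Suc
      intro!: add_pos_nonneg sum_nonneg)

text \<open>Both factors of the cross term are smallest for paths and positive there, and two paths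
  joined at their ends form a path again.\<close>

lemma pair_sum_ge_nonneg:
  assumes "0 \<le> l" "l \<le> 1"
  shows "pair_sum l (end_path (rsize T)) \<le> pair_sum l T"
proof (induction T)
  case (Graft T c)
  have "root_sum l (end_path (rsize T)) * root_sum l (end_path (rsize c))
      \<le> root_sum l T * root_sum l c"
    using assms root_sum_end_path_pos[of l "rsize T"] root_sum_end_path_pos[of l "rsize c"]
      root_sum_ge[of l T] root_sum_ge[of l c]
    by (intro mult_mono) (auto simp: rsize_pos)
  then have "2 * l * (root_sum l (end_path (rsize T)) * root_sum l (end_path (rsize c)))
      \<le> 2 * l * (root_sum l T * root_sum l c)"
    using assms by (intro mult_left_mono) auto
  then show ?case
    using Graft by (simp add: pair_sum_end_path_add rsize_pos mult.assoc)
qed simp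

lemma pair_sum_gt_pos:
  assumes "0 < l" "l < 1" "\<not> upath T"
  shows "pair_sum l (end_path (rsize T)) < pair_sum l T"
proof (cases T)
  case Single
  then show ?thesis using assms by simp
next
  case (Graft U c)
  let ?s = "\<lambda>T. root_sum l (end_path (rsize T))"
  have pos: "0 < ?s U" "0 < ?s c"
    using assms by (simp_all add: root_sum_end_path_pos rsize_pos)
  have ge: "?s U \<le> root_sum l U" "?s c \<le> root_sum l c"
    using assms by (simp_all add: root_sum_ge)
  have "?s U < root_sum l U \<or> ?s c < root_sum l c"
    using assms root_sum_gt[of l] by (auto simp: Graft)
  then have "?s U * ?s c < root_sum l U * root_sum l c"
    using pos ge by (auto intro: mult_less_le_imp_less mult_le_less_imp_less)
  then have "l * (?s U * ?s c) < l * (root_sum l U * root_sum l c)"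
    using assms by simp
  moreover have "pair_sum l (end_path (rsize U)) \<le> pair_sum l U"
    "pair_sum l (end_path (rsize c)) \<le> pair_sum l c"
    using assms by (simp_all add: pair_sum_ge_nonneg)
  ultimately show ?thesis
    by (simp add: Graft pair_sum_end_path_add rsize_pos mult.assoc)
qed

section \<open>Trees as vertex sets\<close>

text \<open>Once the common prefix is stripped, the two remainders are the ways to the last common
  ancestor.\<close>

fun tree_dist :: "'b list \<Rightarrow> 'b list \<Rightarrow> nat" where
  "tree_dist (x # xs) (y # ys) =
    (if x = y then tree_dist xs ys else length (x # xs) + length (y # ys))"
| "tree_dist xs ys = length xs + length ys"

lemma tree_dist_Nil [simp]: "tree_dist [] ys = length ys" "tree_dist xs [] = length xs"
  by (cases xs; simp)+

lemma tree_dist_append [simp]: "tree_dist (r @ xs) (r @ ys) = tree_dist xs ys"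
  by (induction r) auto

lemma tree_dist_self [simp]: "tree_dist xs xs = 0"
  by (induction xs) auto

lemma tree_dist_sym: "tree_dist xs ys = tree_dist ys xs"
  by (induction xs ys rule: tree_dist.induct) auto

lemma even_tree_dist: "even (tree_dist xs ys) \<longleftrightarrow> even (length xs + length ys)"
  by (induction xs ys rule: tree_dist.induct) auto

lemma tree_dist_butlast:
  "ys \<noteq> [] \<Longrightarrow> \<not> prefix ys xs \<Longrightarrow> tree_dist xs ys = Suc (tree_dist xs (butlast ys))"
proof (induction xs ys rule: tree_dist.induct)
  case (1 x xs y ys)
  then show ?case
    by (cases "ys = []") auto
qed auto

text \<open>Connectedness expressed without connecting paths, through closure under parents down
  from a top vertex.\<close>

definition rooted_at :: "nat list \<Rightarrow> nat list set \<Rightarrow> bool" where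
  "rooted_at r A \<longleftrightarrow>
     finite A \<and> r \<in> A \<and> (\<forall>u\<in>A. prefix r u \<and> (u \<noteq> r \<longrightarrow> butlast u \<in> A))"

lemma rooted_at_between:
  assumes "rooted_at r A" "u \<in> A" "prefix r p" "prefix p u"
  shows "p \<in> A"
proof -
  have "p @ w \<in> A \<Longrightarrow> p \<in> A" for w
  proof (induction w rule: rev_induct)
    case (snoc y w)
    have "p @ w @ [y] \<noteq> r"
      using assms(3) by (auto simp: prefix_def)
    then have "butlast (p @ w @ [y]) \<in> A"
      using snoc.prems assms(1) unfolding rooted_at_def by blast
    then show ?case
      using snoc.IH by (simp add: butlast_append)
  qed simp
  then show ?thesis
    using assms(2,4) by (auto simp: prefix_def)
qed

text \<open>A relation, since the branches at a vertex can be grafted in any order, so that one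
  vertex set realizes several terms. The premise on \<open>r @ [x]\<close> keeps the new branch away
  from the old ones.\<close>

inductive realizes :: "nat list \<Rightarrow> nat list set \<Rightarrow> rtree \<Rightarrow> bool" where
  single: "realizes r {r} Single"
| graft: "realizes r A T \<Longrightarrow> realizes (r @ [x]) B c \<Longrightarrow> r @ [x] \<notin> A
    \<Longrightarrow> realizes r (A \<union> B) (Graft T c)"

lemma realizes_rooted_at: "realizes r A T \<Longrightarrow> rooted_at r A"
proof (induction rule: realizes.induct)
  case (graft r A T x B c)
  have "prefix r u" if "prefix (r @ [x]) u" for u
    using that by (auto elim!: prefixE)
  then show ?case
    using graft by (auto simp: rooted_at_def butlast_append)
qed (simp add: rooted_at_def)

lemma realizes_exists:
  assumes "rooted_at r A"
  shows "\<exists>T. realizes r A T"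
  using assms
proof (induction "card A" arbitrary: r A rule: less_induct)
  case less
  show ?case
  proof (cases "A = {r}")
    case True
    then show ?thesis using realizes.single by blast
  next
    case False
    then obtain u where "u \<in> A" "u \<noteq> r"
      using less.prems by (auto simp: rooted_at_def)
    then obtain w where "u = r @ w" "w \<noteq> []"
      using less.prems by (auto simp: rooted_at_def prefix_def)
    then obtain x us where u: "u = r @ x # us"
      by (cases w) auto
    define B where "B = {v \<in> A. prefix (r @ [x]) v}"
    have c: "r @ [x] \<in> A"
      using rooted_at_between[OF less.prems \<open>u \<in> A\<close>] u by auto
    have fin: "finite A"
      using less.prems by (simp add: rooted_at_def)
    have "rooted_at (r @ [x]) B"
      unfolding rooted_at_def
    proof (intro conjI ballI impI)
      fix v assume v: "v \<in> B" "v \<noteq> r @ [x]"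
      then have "prefix (r @ [x]) (butlast v)"
        unfolding B_def by (auto simp: prefix_def butlast_append)
      moreover have "v \<noteq> r"
        using v by (auto simp: B_def)
      ultimately show "butlast v \<in> B"
        using v less.prems by (auto simp: B_def rooted_at_def)
    qed (use fin c in \<open>auto simp: B_def\<close>)
    moreover have "rooted_at r (A - B)"
      unfolding rooted_at_def
    proof (intro conjI ballI impI)
      fix v assume v: "v \<in> A - B" "v \<noteq> r"
      have "prefix (r @ [x]) v" if "prefix (r @ [x]) (butlast v)"
        using that by (meson prefix_order.trans prefixeq_butlast)
      then show "butlast v \<in> A - B"
        using v less.prems by (auto simp: B_def rooted_at_def)
    qed (use less.prems in \<open>auto simp: B_def rooted_at_def\<close>)
    moreover have "card B < card A" "card (A - B) < card A"
    proof -
      have "r \<in> A - B" "r @ [x] \<in> B"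
        using less.prems c by (auto simp: B_def rooted_at_def)
      moreover have "B \<subseteq> A"
        by (auto simp: B_def)
      ultimately show "card B < card A" "card (A - B) < card A"
        using fin by (auto intro!: psubset_card_mono)
    qed
    ultimately obtain T c where "realizes (r @ [x]) B c" "realizes r (A - B) T"
      using less.hyps by meson
    moreover have "r @ [x] \<notin> A - B" "A - B \<union> B = A"
      using c by (auto simp: B_def)
    ultimately show ?thesis
      using realizes.graft by metis
  qed
qed

text \<open>The edge from \<open>r\<close> to \<open>r @ [x]\<close> is the only way from
  \<open>A\<close> to \<open>B\<close>: with each vertex \<open>A\<close> contains its ancestors
  down from \<open>r\<close>, so nothing in \<open>A\<close> lies below the missing
  \<open>r @ [x]\<close>.\<close>

lemma graft_decompose:
  assumes "realizes r A T" "realizes (r @ [x]) B c" "r @ [x] \<notin> A" "u \<in> A" "v \<in> B"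
  shows "tree_dist u v = tree_dist r u + Suc (tree_dist (r @ [x]) v)"
    and "tree_dist r v = Suc (tree_dist (r @ [x]) v)"
    and "\<not> prefix (r @ [x]) u"
proof -
  note rA = realizes_rooted_at[OF assms(1)] and rB = realizes_rooted_at[OF assms(2)]
  obtain u' where u: "u = r @ u'"
    using rA assms(4) by (auto simp: rooted_at_def prefix_def)
  obtain v' where v: "v = r @ x # v'"
    using rB assms(5) by (auto simp: rooted_at_def prefix_def)
  show np: "\<not> prefix (r @ [x]) u"
    using rooted_at_between[OF rA assms(4), of "r @ [x]"] assms(3) by auto
  have "tree_dist u' (x # v') = length u' + Suc (length v')"
    using np by (cases u') (auto simp: u)
  moreover have "tree_dist r v = Suc (length v')"
    using tree_dist_append[of r "[]" "x # v'"] by (simp add: v)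
  moreover have "tree_dist (r @ [x]) v = length v'"
    using tree_dist_append[of "r @ [x]" "[]" v'] by (simp add: v)
  moreover have "tree_dist r u = length u'"
    using tree_dist_append[of r "[]" u'] by (simp add: u)
  ultimately show "tree_dist u v = tree_dist r u + Suc (tree_dist (r @ [x]) v)"
    "tree_dist r v = Suc (tree_dist (r @ [x]) v)"
    by (simp_all add: u v)
qed

lemma graft_disjoint:
  assumes "realizes r A T" "realizes (r @ [x]) B c" "r @ [x] \<notin> A"
  shows "A \<inter> B = {}"
  using graft_decompose(3)[OF assms] realizes_rooted_at[OF assms(2)]
  by (fastforce simp: rooted_at_def)

lemma realizes_finite: "realizes r A T \<Longrightarrow> finite A"
  using realizes_rooted_at by (auto simp: rooted_at_def)

lemma realizes_card: "realizes r A T \<Longrightarrow> card A = rsize T"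
  by (induction rule: realizes.induct)
    (simp_all add: card_Un_disjoint realizes_finite graft_disjoint)

lemma realizes_root_sum: "realizes r A T \<Longrightarrow> (\<Sum>u\<in>A. l ^ tree_dist r u) = root_sum l T"
proof (induction rule: realizes.induct)
  case (graft r A T x B c)
  have "r \<in> A"
    using realizes_rooted_at[OF graft(1)] by (simp add: rooted_at_def)
  then have "(\<Sum>v\<in>B. l ^ tree_dist r v) = l * root_sum l c"
    unfolding graft(5)[symmetric] sum_distrib_left
    by (intro sum.cong) (auto simp: graft_decompose(2)[OF graft(1-3)])
  then show ?case
    using graft by (simp add: sum.union_disjoint realizes_finite graft_disjoint)
qed simp

lemma realizes_pair_sum:
  "realizes r A T \<Longrightarrow> (\<Sum>u\<in>A. \<Sum>v\<in>A. l ^ tree_dist u v) = pair_sum l T"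
proof (induction rule: realizes.induct)
  case (graft r A T x B c)
  have cross: "(\<Sum>u\<in>A. \<Sum>v\<in>B. l ^ tree_dist u v) = root_sum l T * (l * root_sum l c)"
    unfolding realizes_root_sum[OF graft(1), symmetric] realizes_root_sum[OF graft(2), symmetric]
      sum_distrib_left[of l] sum_product
    by (intro sum.cong refl) (simp add: graft_decompose(1)[OF graft(1-3)] power_add)
  moreover have "(\<Sum>v\<in>B. \<Sum>u\<in>A. l ^ tree_dist v u) = (\<Sum>u\<in>A. \<Sum>v\<in>B. l ^ tree_dist u v)"
    by (subst sum.swap) (simp add: tree_dist_sym)
  ultimately show ?case
    using graft by (simp add: sum.union_disjoint realizes_finite graft_disjoint sum.distrib)
qed simp

section \<open>Recognizing paths: enumerations and forks\<close>

definition path_enum :: "nat list list \<Rightarrow> bool" where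
  "path_enum xs \<longleftrightarrow> distinct xs \<and> (\<forall>i<length xs. \<forall>j<length xs.
     uhn_adj (xs ! i) (xs ! j) \<longleftrightarrow> j = Suc i \<or> i = Suc j)"

lemma path_enum_is_line_graph:
  assumes "path_enum xs"
  shows "is_line_graph (length xs) (set xs)"
  unfolding is_line_graph_def graph_isomorphic_def
  using assms
  by (intro exI[of _ "\<lambda>i. xs ! i"])
    (auto simp: path_enum_def intro!: bij_betw_nth)

lemma graft_adj:
  assumes "realizes r A T" "realizes (r @ [x]) B c" "r @ [x] \<notin> A" "u \<in> A" "v \<in> B"
  shows "uhn_adj u v \<longleftrightarrow> u = r \<and> v = r @ [x]"
proof -
  have np: "\<not> prefix (r @ [x]) u"
    by (rule graft_decompose(3)[OF assms])
  obtain w where v: "v = r @ [x] @ w"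
    using realizes_rooted_at[OF assms(2)] assms(5) by (auto simp: rooted_at_def prefix_def)
  have *: "butlast v = u \<longleftrightarrow> u = r \<and> v = r @ [x]"
    using np by (cases w rule: rev_cases) (auto simp: v butlast_append simp flip: append_assoc)
  moreover have "butlast u \<noteq> v"
  proof
    assume "butlast u = v"
    then have "prefix v u" by (auto simp: prefixeq_butlast)
    then show False using np by (auto simp: v prefix_def)
  qed
  ultimately show ?thesis
    by (auto simp: uhn_adj_def v)
qed

lemma uhn_adj_sym: "uhn_adj u v \<longleftrightarrow> uhn_adj v u"
  by (auto simp: uhn_adj_def)

lemma path_enum_rev:
  assumes "path_enum xs"
  shows "path_enum (rev xs)"
  unfolding path_enum_def
proof (intro conjI allI impI)
  fix i j assume ij: "i < length (rev xs)" "j < length (rev xs)"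
  let ?i = "length xs - Suc i" and ?j = "length xs - Suc j"
  have "uhn_adj (xs ! ?i) (xs ! ?j) \<longleftrightarrow> ?j = Suc ?i \<or> ?i = Suc ?j"
    using assms ij unfolding path_enum_def by simp
  also have "\<dots> \<longleftrightarrow> j = Suc i \<or> i = Suc j"
    using ij by simp linarith
  finally show "uhn_adj (rev xs ! i) (rev xs ! j) \<longleftrightarrow> j = Suc i \<or> i = Suc j"
    using ij by (simp add: rev_nth)
qed (use assms in \<open>simp add: path_enum_def\<close>)

lemma path_enum_append:
  assumes xs: "path_enum xs" and ys: "path_enum ys" and ne: "xs \<noteq> []" "ys \<noteq> []"
    and dis: "set xs \<inter> set ys = {}"
    and adj: "\<And>u v. u \<in> set xs \<Longrightarrow> v \<in> set ys \<Longrightarrow> uhn_adj u v \<longleftrightarrow> u = last xs \<and> v = hd ys"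
  shows "path_enum (xs @ ys)"
proof -
  have "uhn_adj (xs ! i) (ys ! j) \<longleftrightarrow> i = length xs - 1 \<and> j = 0"
    if "i < length xs" "j < length ys" for i j
    using that adj[of "xs ! i" "ys ! j"] xs ys ne
    by (auto simp: last_conv_nth hd_conv_nth path_enum_def nth_eq_iff_index_eq)
  then have 1: "uhn_adj (xs ! i) (ys ! j) \<longleftrightarrow> i = length xs - 1 \<and> j = 0"
     "uhn_adj (ys ! j) (xs ! i) \<longleftrightarrow> i = length xs - 1 \<and> j = 0"
    if "i < length xs" "j < length ys" for i j
    using that uhn_adj_sym by blast+
  let ?n = "length xs"
  have "uhn_adj ((xs @ ys) ! i) ((xs @ ys) ! j) \<longleftrightarrow> j = Suc i \<or> i = Suc j"
    if ij: "i < ?n + length ys" "j < ?n + length ys" for i j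
  proof -
    consider "i < ?n" "j < ?n" | "i < ?n" "?n \<le> j" | "?n \<le> i" "j < ?n" | "?n \<le> i" "?n \<le> j"
      by linarith
    then show ?thesis
    proof cases
      case 1
      then show ?thesis using xs by (simp add: nth_append path_enum_def)
    next
      case 2
      then have "j - ?n < length ys" using ij by linarith
      then have "uhn_adj (xs ! i) (ys ! (j - ?n)) \<longleftrightarrow> i = ?n - 1 \<and> j - ?n = 0"
        using 1(1)[of i "j - ?n"] 2 by simp
      moreover have "i = ?n - 1 \<and> j - ?n = 0 \<longleftrightarrow> j = Suc i \<or> i = Suc j"
        using 2 by linarith
      ultimately show ?thesis using 2 by (simp add: nth_append)
    next
      case 3
      then have "i - ?n < length ys" using ij by linarith
      then have "uhn_adj (ys ! (i - ?n)) (xs ! j) \<longleftrightarrow> j = ?n - 1 \<and> i - ?n = 0"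
        using 1(2)[of j "i - ?n"] 3 by simp
      moreover have "j = ?n - 1 \<and> i - ?n = 0 \<longleftrightarrow> j = Suc i \<or> i = Suc j"
        using 3 by linarith
      ultimately show ?thesis using 3 by (simp add: nth_append)
    next
      case 4
      then have "i - ?n < length ys" "j - ?n < length ys" using ij by linarith+
      then have "uhn_adj (ys ! (i - ?n)) (ys ! (j - ?n))
          \<longleftrightarrow> j - ?n = Suc (i - ?n) \<or> i - ?n = Suc (j - ?n)"
        using ys by (simp add: path_enum_def)
      also have "\<dots> \<longleftrightarrow> j = Suc i \<or> i = Suc j"
        using 4 by linarith
      finally show ?thesis using 4 by (simp add: nth_append)
    qed
  qed
  then show ?thesis
    using xs ys dis by (simp add: path_enum_def)
qed

lemma path_enum_singleton: "path_enum [r]"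
proof -
  have "butlast r \<noteq> r" if "r \<noteq> []"
    using that by (metis append_butlast_last_id append_self_conv not_Cons_self2)
  then show ?thesis
    by (auto simp: path_enum_def uhn_adj_def)
qed

lemma realizes_rpath:
  "realizes r A T \<Longrightarrow> rpath T \<Longrightarrow> \<exists>xs. path_enum xs \<and> set xs = A \<and> xs \<noteq> [] \<and> hd xs = r"
proof (induction rule: realizes.induct)
  case (single r)
  then show ?case
    by (intro exI[of _ "[r]"]) (simp add: path_enum_singleton)
next
  case (graft r A T x B c)
  then obtain ys where ys: "path_enum ys" "set ys = B" "ys \<noteq> []" "hd ys = r @ [x]"
    by auto
  have A: "A = {r}"
    using graft by (auto elim: realizes.cases)
  have "path_enum ([r] @ ys)"
    using ys graft A graft_disjoint[OF graft(1-3)] graft_adj[OF graft(1-3)]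
    by (intro path_enum_append path_enum_singleton) auto
  then show ?case
    using ys A by (intro exI[of _ "r # ys"]) auto
qed

lemma upath_is_line_graph:
  assumes "realizes r A T" "upath T"
  shows "is_line_graph (rsize T) A"
proof -
  have "\<exists>xs. path_enum xs \<and> set xs = A"
    using assms
  proof (cases rule: realizes.cases)
    case single
    then show ?thesis using path_enum_singleton[of r] by (intro exI[of _ "[r]"]) auto
  next
    case (graft A' T' x B c)
    with assms obtain xs ys where
      xs: "path_enum xs" "set xs = A'" "xs \<noteq> []" "hd xs = r" and
      ys: "path_enum ys" "set ys = B" "ys \<noteq> []" "hd ys = r @ [x]"
      using realizes_rpath[of r A' T'] realizes_rpath[of "r @ [x]" B c] by auto
    \<comment> \<open>\<open>xs\<close> starts at the root, so its reversal ends there, next to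
      \<open>r @ [x]\<close>, the head of \<open>ys\<close>.\<close>
    have "path_enum (rev xs @ ys)"
      using xs ys graft_disjoint[OF graft(3-5)] graft_adj[OF graft(3-5)]
      by (intro path_enum_append path_enum_rev) (auto simp: last_rev)
    then show ?thesis
      using xs ys graft by (intro exI[of _ "rev xs @ ys"]) auto
  qed
  then obtain xs where xs: "path_enum xs" "set xs = A" by blast
  moreover have "length xs = rsize T"
    using xs realizes_card[OF assms(1)] distinct_card[of xs] by (simp add: path_enum_def)
  ultimately show ?thesis
    using path_enum_is_line_graph by metis
qed

text \<open>A vertex of degree at least 3, the obstruction to being a path.\<close>

definition has_fork :: "nat list set \<Rightarrow> bool" where
  "has_fork A \<longleftrightarrow> (\<exists>u\<in>A. 3 \<le> card {v \<in> A. uhn_adj u v})"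

lemma line_graph_no_fork:
  assumes "is_line_graph n A"
  shows "\<not> has_fork A"
proof
  assume "has_fork A"
  then obtain u where u: "u \<in> A" "3 \<le> card {v \<in> A. uhn_adj u v}"
    by (auto simp: has_fork_def)
  from assms obtain \<phi> where \<phi>: "bij_betw \<phi> {..<n} A"
    "\<And>i j. i < n \<Longrightarrow> j < n \<Longrightarrow> (j = Suc i \<or> i = Suc j) \<longleftrightarrow> uhn_adj (\<phi> i) (\<phi> j)"
    unfolding is_line_graph_def graph_isomorphic_def by auto
  obtain i where i: "i < n" "u = \<phi> i"
    using \<phi>(1) u by (auto simp: bij_betw_def)
  \<comment> \<open>At \<open>i = 0\<close> the truncated \<open>i - 1\<close> is 0 again; this is
    harmless, as only an upper bound for the number of neighbours is wanted.\<close>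
  have "{v \<in> A. uhn_adj u v} \<subseteq> \<phi> ` {Suc i, i - 1}"
  proof
    fix v assume v: "v \<in> {v \<in> A. uhn_adj u v}"
    then obtain j where "j < n" "v = \<phi> j"
      using \<phi>(1) by (auto simp: bij_betw_def)
    then show "v \<in> \<phi> ` {Suc i, i - 1}"
      using \<phi>(2)[of i j] v i by auto
  qed
  then have "card {v \<in> A. uhn_adj u v} \<le> card {Suc i, i - 1}"
    by (rule surj_card_le[rotated]) simp
  also have "\<dots> \<le> 2"
    by (simp add: card_insert_if)
  finally show False using u by simp
qed

lemma has_forkI:
  assumes "finite A" "u \<in> A" "{a, b, c} \<subseteq> A" "a \<noteq> b" "a \<noteq> c" "b \<noteq> c"
    "uhn_adj u a" "uhn_adj u b" "uhn_adj u c"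
  shows "has_fork A"
proof -
  have "card {a, b, c} \<le> card {v \<in> A. uhn_adj u v}"
    using assms by (intro card_mono) auto
  then have "3 \<le> card {v \<in> A. uhn_adj u v}"
    using assms by simp
  then show ?thesis
    using assms(2) unfolding has_fork_def by blast
qed

lemma has_fork_mono:
  assumes "has_fork A" "A \<subseteq> B" "finite B"
  shows "has_fork B"
proof -
  obtain u where u: "u \<in> A" "3 \<le> card {v \<in> A. uhn_adj u v}"
    using assms by (auto simp: has_fork_def)
  have "card {v \<in> A. uhn_adj u v} \<le> card {v \<in> B. uhn_adj u v}"
    using assms by (intro card_mono) auto
  then show ?thesis
    using u assms by (force simp: has_fork_def)
qed

lemma uhn_adj_snoc: "uhn_adj r (r @ [x])" "uhn_adj (r @ [x]) r"
  by (auto simp: uhn_adj_def)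

lemma realizes_root_in: "realizes r A T \<Longrightarrow> r \<in> A"
  using realizes_rooted_at by (simp add: rooted_at_def)

lemma realizes_child:
  assumes "realizes r A T" "T \<noteq> Single"
  obtains x where "r @ [x] \<in> A"
  using assms(1)
proof (cases rule: realizes.cases)
  case (graft A' T' x B c)
  then show ?thesis
    using realizes_root_in[OF graft(4)] that[of x] by simp
qed (use assms in simp)

text \<open>The parent \<open>r\<close> serves as third neighbour, so below an edge two children
  already make a fork.\<close>

lemma not_rpath_has_fork:
  assumes "realizes (r @ [x]) B c" "\<not> rpath c" "r \<notin> B"
  shows "has_fork (insert r B)"
  using assms
proof (induction "r @ [x]" B c arbitrary: r x rule: realizes.induct)
  case (graft A T y B c)
  show ?case
  proof (cases "rpath c")
    case True
    then have "T \<noteq> Single"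
      using graft by simp
    then obtain z where "r @ [x, z] \<in> A"
      using realizes_child[OF graft(1)] by auto
    then have in1: "r @ [x, z] \<in> A" "r @ [x, y] \<in> B" "r @ [x] \<in> A"
      using realizes_root_in[OF graft(1)] realizes_root_in[OF graft(3)] by auto
    moreover have "y \<noteq> z"
      using in1 graft(5) by auto
    ultimately show ?thesis
      using realizes_finite[OF graft(1)] realizes_finite[OF graft(3)]
        uhn_adj_snoc[of "r @ [x]"] uhn_adj_snoc[of r]
      by (intro has_forkI[of _ "r @ [x]" r "r @ [x, y]" "r @ [x, z]"]) auto
  next
    case False
    have "r @ [x] \<notin> B"
      using graft_disjoint[OF graft(1,3,5)] realizes_root_in[OF graft(1)] by auto
    then have "has_fork (insert (r @ [x]) B)"
      using False graft(4)[of "r @ [x]" y] by simp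
    then show ?thesis
      by (rule has_fork_mono)
        (use realizes_finite[OF graft(1)] realizes_finite[OF graft(3)]
          realizes_root_in[OF graft(1)] in auto)
  qed
qed simp

lemma not_upath_has_fork:
  assumes "realizes r A T" "\<not> upath T"
  shows "has_fork A"
  using assms(1)
proof (cases rule: realizes.cases)
  case single
  then show ?thesis using assms by simp
next
  case (graft A' T' x B c)
  have fin: "finite A" and rA': "r \<in> A'"
    using realizes_finite[OF assms(1)] realizes_root_in[OF graft(3)] by auto
  have rB: "r \<notin> B"
    using rA' graft_disjoint[OF graft(3-5)] by auto
  consider "\<not> rpath c" | "\<not> rpath T'"
    using assms graft by auto
  then show ?thesis
  proof cases
    case 1
    then have "has_fork (insert r B)"
      using not_rpath_has_fork[OF graft(4)] rB by simp
    then show ?thesis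
      by (rule has_fork_mono) (use fin graft rA' in auto)
  next
    case 2
    \<comment> \<open>The root has no parent in \<open>A\<close>, so a fork at the root needs three
      children; this is why \<open>T'\<close> is taken apart once more.\<close>
    from graft(3) show ?thesis
    proof (cases rule: realizes.cases)
      case single
      then show ?thesis using 2 by simp
    next
      case g2: (graft A2 T2 x2 B2 c2)
      have r2: "r \<in> A2" "r \<notin> B2"
        using realizes_root_in[OF g2(3)] graft_disjoint[OF g2(3-5)] by auto
      show ?thesis
      proof (cases "rpath c2")
        case False
        then have "has_fork (insert r B2)"
          using not_rpath_has_fork[OF g2(4)] r2 by simp
        then show ?thesis
          by (rule has_fork_mono) (use fin graft g2 rA' in auto)
      next
        case True
        then have "T2 \<noteq> Single"
          using 2 g2 by simp
        then obtain x3 where "r @ [x3] \<in> A2"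
          using realizes_child[OF g2(3)] by auto
        then have "r @ [x3] \<in> A2" "r @ [x2] \<in> B2" "r @ [x] \<in> B"
          using realizes_root_in[OF g2(4)] realizes_root_in[OF graft(4)] by auto
        moreover from this have "x2 \<noteq> x3" "x \<noteq> x3" "x \<noteq> x2"
          using g2(5) graft(5) g2(1) by auto
        ultimately show ?thesis
          using fin rA' graft g2 uhn_adj_snoc[of r]
          by (intro has_forkI[of _ r "r @ [x]" "r @ [x2]" "r @ [x3]"]) auto
      qed
    qed
  qed
qed

lemma is_line_graph_iff_upath:
  assumes "realizes r A T"
  shows "is_line_graph (rsize T) A \<longleftrightarrow> upath T"
  using assms upath_is_line_graph not_upath_has_fork line_graph_no_fork by blast

section \<open>Connected subsets as rooted sets\<close>

lemma rooted_at_imp_subtree: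
  assumes "rooted_at r A" "A \<subseteq> UHN"
  shows "subtree A"
proof -
  let ?E = "{(x, y). x \<in> A \<and> y \<in> A \<and> uhn_adj x y}"
  have sym: "sym (?E\<^sup>*)"
    by (intro sym_rtrancl symI) (use uhn_adj_sym in auto)
  have "(r, r @ w) \<in> ?E\<^sup>*" if "r @ w \<in> A" for w
    using that
  proof (induction w rule: rev_induct)
    case (snoc x w)
    have "r @ w \<in> A"
      using rooted_at_between[OF assms(1) snoc.prems, of "r @ w"] by auto
    moreover have "(r @ w, r @ w @ [x]) \<in> ?E"
      using calculation snoc.prems uhn_adj_snoc[of "r @ w" x] by simp
    ultimately show ?case
      using rtrancl_into_rtrancl[OF snoc.IH] by blast
  qed simp
  then have "(r, u) \<in> ?E\<^sup>*" if "u \<in> A" for u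
    using that assms(1) by (auto simp: rooted_at_def prefix_def)
  note reach = this
  have "(u, v) \<in> ?E\<^sup>*" if "u \<in> A" "v \<in> A" for u v
    using rtrancl_trans[OF symD[OF sym reach[OF that(1)]] reach[OF that(2)]] .
  moreover have "A \<noteq> {}"
    using assms(1) by (auto simp: rooted_at_def)
  ultimately show ?thesis
    using assms(2) by (simp add: subtree_def)
qed

text \<open>Invariant along a connecting path: all words between \<open>r\<close> and the current
  vertex lie in \<open>A\<close>. A step to a child adds that child; a step to a parent cannot pass
  above \<open>r\<close>, as no word of \<open>A\<close> is shorter.\<close>

lemma shortest_root:
  assumes "subtree A" "finite A" "r \<in> A" "\<And>v. v \<in> A \<Longrightarrow> length r \<le> length v"
  shows "rooted_at r A"
proof -
  let ?E = "{(x, y). x \<in> A \<and> y \<in> A \<and> uhn_adj x y}"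
  have "prefix r u \<and> (\<forall>w. prefix r w \<longrightarrow> prefix w u \<longrightarrow> w \<in> A)" if "(r, u) \<in> ?E\<^sup>*" for u
    using that
  proof (induction rule: rtrancl_induct)
    case base
    then show ?case
      using assms(3) by (auto dest: prefix_order.antisym)
  next
    case (step u v)
    then have uv: "u \<in> A" "v \<in> A" "uhn_adj u v" by auto
    consider "u \<noteq> []" "butlast u = v" | "v \<noteq> []" "butlast v = u"
      using uv(3) by (auto simp: uhn_adj_def)
    then show ?case
    proof cases
      case 1
      then have vu: "prefix v u"
        using prefixeq_butlast by blast
      then have "prefix r v"
        using step.IH assms(4)[OF uv(2)] prefix_length_prefix by blast
      then show ?thesis
        using step.IH vu prefix_order.trans by blast
    next
      case 2
      then obtain x where v: "v = u @ [x]"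
        by (metis append_butlast_last_id)
      then show ?thesis
        using step.IH uv(2) by auto
    qed
  qed
  then have *: "prefix r u \<and> (\<forall>w. prefix r w \<longrightarrow> prefix w u \<longrightarrow> w \<in> A)" if "u \<in> A" for u
    using that assms(1,3) unfolding subtree_def by blast
  have "butlast u \<in> A" if u: "u \<in> A" "u \<noteq> r" for u
  proof -
    obtain w where "u = r @ w" "w \<noteq> []"
      using *[OF u(1)] u(2) by (auto simp: prefix_def)
    then have "prefix r (butlast u)"
      by (simp add: butlast_append)
    then show ?thesis
      using *[OF u(1)] prefixeq_butlast by blast
  qed
  moreover have "prefix r u" if "u \<in> A" for u
    using *[OF that] by blast
  ultimately show ?thesis
    using assms(2,3) unfolding rooted_at_def by blast
qed

lemma subtree_imp_rooted_at:
  assumes "subtree A" "finite A"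
  shows "\<exists>r. rooted_at r A"
proof -
  have "A \<noteq> {}"
    using assms(1) by (simp add: subtree_def)
  then have "arg_min_on length A \<in> A" "\<And>v. v \<in> A \<Longrightarrow> length (arg_min_on length A) \<le> length v"
    using arg_min_if_finite[OF assms(2), of length] by (auto simp: not_less)
  then show ?thesis
    using shortest_root[OF assms] by blast
qed

lemma subtree_realizes:
  assumes "subtree_of_size n A"
  shows "\<exists>r T. realizes r A T \<and> rsize T = n"
proof -
  have A: "subtree A" "finite A" "card A = n"
    using assms by (simp_all add: subtree_of_size_def)
  obtain r T where "realizes r A T"
    using subtree_imp_rooted_at[OF A(1,2)] realizes_exists by blast
  then show ?thesis
    using realizes_card[of r A T] A(3) by auto
qed

section \<open>The path and a competitor with the same colour classes\<close>

definition ray :: "nat \<Rightarrow> nat list set" where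
  "ray n = (\<lambda>k. replicate k 1) ` {..<n}"

lemma inj_replicate: "inj_on (\<lambda>k. replicate k x) A"
  by (auto simp: inj_on_def replicate_eq_replicate)

lemma in_ray: "replicate k (Suc 0) \<in> ray n \<longleftrightarrow> k < n"
  unfolding ray_def using inj_replicate[of "Suc 0" UNIV] by (auto dest: injD)

lemma card_ray: "card (ray n) = n"
  by (simp add: ray_def card_image inj_replicate)

lemma butlast_replicate: "butlast (replicate k x) = replicate (k - 1) x"
  by (cases k) (simp_all flip: replicate_append_same)

lemma rooted_at_ray: "n > 0 \<Longrightarrow> rooted_at [] (ray n)"
  by (auto simp: rooted_at_def ray_def butlast_replicate image_iff intro!: bexI[of _ 0])

lemma ray_UHN: "ray n \<subseteq> UHN"
  by (auto simp: ray_def UHN_def)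

lemma ray_is_line_graph: "is_line_graph n (ray n)"
  unfolding is_line_graph_def graph_isomorphic_def
proof (intro exI conjI ballI)
  show "bij_betw (\<lambda>k. replicate k 1) {..<n} (ray n)"
    by (simp add: ray_def bij_betw_def inj_replicate)
  show "(j = Suc i \<or> i = Suc j) \<longleftrightarrow> uhn_adj (replicate i (1::nat)) (replicate j 1)" for i j
    using inj_replicate[of "1::nat" UNIV]
    by (cases i; cases j) (auto simp: uhn_adj_def butlast_replicate dest: injD)
qed

lemma ray_subtree: "n > 0 \<Longrightarrow> subtree_of_size n (ray n)"
  using rooted_at_imp_subtree[OF rooted_at_ray ray_UHN]
  by (simp add: subtree_of_size_def card_ray) (simp add: ray_def)

text \<open>The last vertex of \<open>ray n\<close> is moved two levels up, which keeps the parity of its depth.  For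
  \<open>n = 4\<close> the result is still a path.\<close>

definition balanced_fork :: "nat \<Rightarrow> nat list set" where
  "balanced_fork n = insert (replicate (n - 4) 1 @ [2]) (ray (n - 1))"

lemma fork_tip_notin_ray: "replicate k (Suc 0) @ [2] \<notin> ray n"
proof
  assume "replicate k (Suc 0) @ [2] \<in> ray n"
  then obtain m where "replicate k (Suc 0) @ [2] = replicate m (Suc 0)"
    by (auto simp: ray_def)
  then have "2 \<in> set (replicate m (Suc 0))"
    by (metis in_set_conv_decomp)
  then show False by simp
qed

lemma balanced_fork_subtree:
  assumes "n \<ge> 5"
  shows "subtree_of_size n (balanced_fork n)"
proof -
  have "rooted_at [] (balanced_fork n)"
    using rooted_at_ray[of "n - 1"] in_ray[of "n - 4" "n - 1"] assms
    by (auto simp: rooted_at_def balanced_fork_def)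
  moreover have "balanced_fork n \<subseteq> UHN"
    using ray_UHN[of "n - 1"] by (auto simp: balanced_fork_def UHN_def)
  moreover have "finite (ray (n - 1))"
    by (simp add: ray_def)
  then have "card (balanced_fork n) = n" "finite (balanced_fork n)"
    using assms by (simp_all add: balanced_fork_def card_ray fork_tip_notin_ray)
  ultimately show ?thesis
    using rooted_at_imp_subtree by (simp add: subtree_of_size_def)
qed

lemma balanced_fork_not_line:
  assumes "n \<ge> 5"
  shows "\<not> is_line_graph n (balanced_fork n)"
proof -
  obtain m where n: "n = m + 5"
    using assms by (metis add.commute le_Suc_ex)
  \<comment> \<open>The parent of the new tip. For \<open>n \<ge> 5\<close> it is not the root, so
    it has three neighbours: its parent, its child in the ray, and the tip.\<close>
  let ?u = "replicate (Suc m) (1::nat)"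
  have u1: "replicate (Suc (Suc m)) 1 = ?u @ [1::nat]" and u2: "?u = replicate m 1 @ [1]"
    by (simp_all add: replicate_append_same)
  have "?u \<in> balanced_fork n" "?u @ [2] \<in> balanced_fork n" "?u @ [1] \<in> balanced_fork n"
    "replicate m 1 \<in> balanced_fork n"
    unfolding u1[symmetric] by (auto simp: balanced_fork_def n in_ray simp del: replicate_Suc)
  moreover have "finite (balanced_fork n)"
    by (simp add: balanced_fork_def ray_def)
  moreover have "uhn_adj ?u (replicate m 1)"
    by (subst u2) (rule uhn_adj_snoc)
  moreover have ne: "replicate m 1 \<noteq> ?u @ [x]" for x
  proof
    assume "replicate m 1 = ?u @ [x]"
    from arg_cong[OF this, of length] show False by simp
  qed
  ultimately have "has_fork (balanced_fork n)"
    using uhn_adj_snoc(1)[of ?u] ne[of 1] ne[of 2]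
    by (intro has_forkI[of _ ?u "replicate m 1" "?u @ [1]" "?u @ [2]"]) (blast | simp)+
  then show ?thesis
    using line_graph_no_fork by blast
qed

lemma balanced_fork_parity:
  assumes "n \<ge> 5"
  shows "(\<Sum>u\<in>balanced_fork n. (-1) ^ length u) = (\<Sum>u\<in>ray n. (-1::real) ^ length u)"
proof -
  have ray: "(\<Sum>u\<in>ray k. (-1) ^ length u) = (\<Sum>i<k. (-1::real) ^ i)" for k
    by (simp add: ray_def sum.reindex inj_replicate)
  obtain m where n: "n = m + 5"
    using assms by (metis add.commute le_Suc_ex)
  have "finite (ray (n - 1))"
    by (simp add: ray_def)
  \<comment> \<open>The tip has depth \<open>n - 3\<close>; the vertex of \<open>ray n\<close> that
    it replaces has depth \<open>n - 1\<close>.\<close>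
  then have "(\<Sum>u\<in>balanced_fork n. (-1) ^ length u)
      = (-1) ^ (n - 3) + (\<Sum>u\<in>ray (n - 1). (-1::real) ^ length u)"
    by (simp add: balanced_fork_def fork_tip_notin_ray n del: replicate_Suc)
  moreover have "(\<Sum>i<n. (-1::real) ^ i) = (\<Sum>i<n - 1. (-1) ^ i) + (-1) ^ (n - 1)"
  proof -
    have "Suc (n - 1) = n" using assms by simp
    then show ?thesis
      using sum.lessThan_Suc[of "\<lambda>i. (-1::real) ^ i" "n - 1"] by (simp only:)
  qed
  ultimately show ?thesis
    unfolding ray by (simp add: n power_add)
qed

section \<open>Square integrable functions\<close>

lemma L2_add:
  assumes "f \<in> L2 \<mu>" "g \<in> L2 \<mu>"
  shows "(\<lambda>x. f x + g x) \<in> L2 \<mu>" and "integrable \<mu> (\<lambda>x. f x * g x)"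
proof -
  have [measurable]: "f \<in> borel_measurable \<mu>" "g \<in> borel_measurable \<mu>"
    using assms by (auto simp: L2_def)
  have int: "integrable \<mu> (\<lambda>x. (f x)\<^sup>2 + (g x)\<^sup>2)"
    using assms by (auto simp: L2_def)
  have bound: "\<bar>a * b\<bar> \<le> a\<^sup>2 + b\<^sup>2" for a b :: real
  proof -
    have "2 * (\<bar>a\<bar> * \<bar>b\<bar>) \<le> a\<^sup>2 + b\<^sup>2"
      using sum_squares_bound[of "\<bar>a\<bar>" "\<bar>b\<bar>"] by (simp add: mult.assoc)
    moreover have "0 \<le> \<bar>a\<bar> * \<bar>b\<bar>"
      by simp
    ultimately show ?thesis
      unfolding abs_mult by linarith
  qed
  show "integrable \<mu> (\<lambda>x. f x * g x)"
    by (rule Bochner_Integration.integrable_bound[OF int]) (auto intro!: AE_I2 bound)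
  then have "integrable \<mu> (\<lambda>x. ((f x)\<^sup>2 + (g x)\<^sup>2) + 2 * (f x * g x))"
    using assms by (simp add: L2_def)
  moreover have "((f x)\<^sup>2 + (g x)\<^sup>2) + 2 * (f x * g x) = (f x + g x)\<^sup>2" for x
    by (simp add: power2_sum)
  ultimately show "(\<lambda>x. f x + g x) \<in> L2 \<mu>"
    by (simp add: L2_def)
qed

lemma L2_cmult: "f \<in> L2 \<mu> \<Longrightarrow> (\<lambda>x. a * f x) \<in> L2 \<mu>"
  by (auto simp: L2_def power_mult_distrib)

lemma L2_diff:
  assumes "f \<in> L2 \<mu>" "g \<in> L2 \<mu>"
  shows "(\<lambda>x. f x - g x) \<in> L2 \<mu>"
  using L2_add(1)[OF assms(1) L2_cmult[OF assms(2), of "-1"]] by simp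

lemma L2_operator_diff:
  assumes "L2_operator \<mu> H" "f \<in> L2 \<mu>" "g \<in> L2 \<mu>"
  shows "AE x in \<mu>. H (\<lambda>y. f y - g y) x = H f x - H g x"
proof -
  have "AE x in \<mu>. H (\<lambda>y. f y + (-1) * g y) x = H f x + H (\<lambda>y. (-1) * g y) x"
    using assms L2_cmult by (metis (no_types) L2_operator_def)
  moreover have "AE x in \<mu>. H (\<lambda>y. (-1) * g y) x = (-1) * H g x"
    using assms by (metis (no_types) L2_operator_def)
  ultimately show ?thesis
    by eventually_elim simp
qed

text \<open>If \<open>H\<^sup>3 f = H f\<close>, the components of \<open>f\<close> for the eigenvalues 0, 1 and -1 are
  \<open>f - H\<^sup>2 f\<close>, \<open>(H\<^sup>2 f + H f) / 2\<close> and \<open>(H\<^sup>2 f - H f) / 2\<close>.\<close>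

lemma eigen_decomposition_iff:
  assumes H: "L2_operator \<mu> H" and f: "f \<in> L2 \<mu>"
  shows "f \<in> L2_sum \<mu> (L2_sum \<mu> (L2_ker \<mu> H) (L2_ker \<mu> (\<lambda>g x. H g x - g x)))
                 (L2_ker \<mu> (\<lambda>g x. H g x + g x))
    \<longleftrightarrow> (AE x in \<mu>. H (H (H f)) x = H f x)"
proof -
  have closed: "H g \<in> L2 \<mu>" if "g \<in> L2 \<mu>" for g
    using H that by (auto simp: L2_operator_def)
  have cong: "AE x in \<mu>. H g x = H h x" if "g \<in> L2 \<mu>" "h \<in> L2 \<mu>" "AE x in \<mu>. g x = h x" for g h
    using H that by (auto simp: L2_operator_def)
  have add: "AE x in \<mu>. H (\<lambda>y. g y + h y) x = H g x + H h x" if "g \<in> L2 \<mu>" "h \<in> L2 \<mu>" for g h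
    using H that by (auto simp: L2_operator_def)
  have diff: "AE x in \<mu>. H (\<lambda>y. g y - h y) x = H g x - H h x" if "g \<in> L2 \<mu>" "h \<in> L2 \<mu>" for g h
    using L2_operator_diff[OF H that] .
  have scale: "AE x in \<mu>. H (\<lambda>y. a * g y) x = a * H g x" if "g \<in> L2 \<mu>" for g a
    using H that by (auto simp: L2_operator_def)
  note L2s = f closed L2_add(1) L2_diff L2_cmult
  show ?thesis
  proof
    assume "f \<in> L2_sum \<mu> (L2_sum \<mu> (L2_ker \<mu> H) (L2_ker \<mu> (\<lambda>g x. H g x - g x)))
                 (L2_ker \<mu> (\<lambda>g x. H g x + g x))"
    then obtain p g1 g2 g3 where L: "p \<in> L2 \<mu>" "g1 \<in> L2 \<mu>" "g2 \<in> L2 \<mu>" "g3 \<in> L2 \<mu>"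
      and ae: "AE x in \<mu>. f x = p x + g3 x" "AE x in \<mu>. p x = g1 x + g2 x"
        "AE x in \<mu>. H g1 x = 0" "AE x in \<mu>. H g2 x - g2 x = 0" "AE x in \<mu>. H g3 x + g3 x = 0"
      by (auto simp: L2_sum_def L2_ker_def)
    \<comment> \<open>\<open>H\<close> kills the first component, fixes the second and negates the
      third, so its first and third powers agree on \<open>f\<close>.\<close>
    have 1: "AE x in \<mu>. H f x = g2 x - g3 x"
      using cong[OF f L2_add(1)[OF L(1,4)] ae(1)] add[OF L(1,4)]
        cong[OF L(1) L2_add(1)[OF L(2,3)] ae(2)] add[OF L(2,3)] ae(3-5)
      by eventually_elim simp
    have 2: "AE x in \<mu>. H (H f) x = g2 x + g3 x"
      using cong[OF closed[OF f] L2_diff[OF L(3,4)] 1] diff[OF L(3,4)] ae(4,5)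
      by eventually_elim simp
    have "AE x in \<mu>. H (H (H f)) x = g2 x - g3 x"
      using cong[OF closed[OF closed[OF f]] L2_add(1)[OF L(3,4)] 2] add[OF L(3,4)] ae(4,5)
      by eventually_elim simp
    then show "AE x in \<mu>. H (H (H f)) x = H f x"
      using 1 by eventually_elim simp
  next
    assume H3: "AE x in \<mu>. H (H (H f)) x = H f x"
    define h1 h2 where "h1 = H f" and "h2 = H h1"
    have h: "h1 \<in> L2 \<mu>" "h2 \<in> L2 \<mu>" "AE x in \<mu>. H h2 x = h1 x"
      using H3 L2s by (auto simp: h1_def h2_def)
    have Hh: "H f = h1" "H h1 = h2"
      by (simp_all add: h1_def h2_def)
    define g1 g2 g3 where "g1 = (\<lambda>x. f x - h2 x)" and "g2 = (\<lambda>x. (1/2) * (h2 x + h1 x))"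
      and "g3 = (\<lambda>x. (1/2) * (h2 x - h1 x))"
    have g: "g1 \<in> L2 \<mu>" "g2 \<in> L2 \<mu>" "g3 \<in> L2 \<mu>"
      using f h by (auto simp only: g1_def g2_def g3_def intro!: L2_add(1) L2_diff L2_cmult)
    have "AE x in \<mu>. H g1 x = 0"
      using diff[OF f h(2)] h(3) unfolding g1_def Hh by eventually_elim simp
    moreover have "AE x in \<mu>. H g2 x - g2 x = 0"
      using scale[OF L2_add(1)[OF h(2,1)], of "1/2"] add[OF h(2,1)] h(3)
      unfolding g2_def Hh by eventually_elim simp
    moreover have "AE x in \<mu>. H g3 x + g3 x = 0"
      using scale[OF L2_diff[OF h(2,1)], of "1/2"] diff[OF h(2,1)] h(3)
      unfolding g3_def Hh by eventually_elim (simp only:, simp add: field_simps)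
    \<comment> \<open>\<open>L2_sum\<close> is binary and nested, so the sum of the first two
      components is a witness of its own.\<close>
    moreover define p where "p = (\<lambda>x. g1 x + g2 x)"
    moreover have "p \<in> L2 \<mu>"
      unfolding p_def using g by (intro L2_add(1))
    moreover have "AE x in \<mu>. p x = g1 x + g2 x" "AE x in \<mu>. f x = p x + g3 x"
      by (simp_all add: p_def g1_def g2_def g3_def field_simps)
    ultimately have "g1 \<in> L2_ker \<mu> H" "g2 \<in> L2_ker \<mu> (\<lambda>g x. H g x - g x)"
      "g3 \<in> L2_ker \<mu> (\<lambda>g x. H g x + g x)" "p \<in> L2 \<mu>"
      "AE x in \<mu>. p x = g1 x + g2 x" "AE x in \<mu>. f x = p x + g3 x"
      using g by (simp_all add: L2_ker_def)
    then show "f \<in> L2_sum \<mu> (L2_sum \<mu> (L2_ker \<mu> H) (L2_ker \<mu> (\<lambda>g x. H g x - g x)))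
                 (L2_ker \<mu> (\<lambda>g x. H g x + g x))"
      using f unfolding L2_sum_def by blast
  qed
qed

section \<open>Percolation\<close>

text \<open>Bernoulli percolation keeps each edge with probability \<open>t\<close>.  \<open>root_exp t T \<phi>\<close> and
  \<open>rest_exp t T \<phi>\<close> are the expectations of \<open>\<phi>\<close> at the imbalance of the cluster of the root, and of
  the sum of \<open>\<phi>\<close> over the imbalances of all other clusters; the imbalance is the number of vertices
  at even distance from the top of the cluster minus the number at odd distance.\<close>

primrec root_exp :: "real \<Rightarrow> rtree \<Rightarrow> (int \<Rightarrow> real) \<Rightarrow> real" where
  "root_exp t Single \<phi> = \<phi> 1"
| "root_exp t (Graft T c) \<phi> =
     (1 - t) * root_exp t T \<phi> + t * root_exp t T (\<lambda>i. root_exp t c (\<lambda>j. \<phi> (i - j)))"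

primrec rest_exp :: "real \<Rightarrow> rtree \<Rightarrow> (int \<Rightarrow> real) \<Rightarrow> real" where
  "rest_exp t Single \<phi> = 0"
| "rest_exp t (Graft T c) \<phi> = rest_exp t T \<phi> + rest_exp t c \<phi> + (1 - t) * root_exp t c \<phi>"

definition cluster_exp :: "real \<Rightarrow> rtree \<Rightarrow> (int \<Rightarrow> real) \<Rightarrow> real" where
  "cluster_exp t T \<phi> = root_exp t T \<phi> + rest_exp t T \<phi>"

lemma root_exp_add: "root_exp t T (\<lambda>i. \<phi> i + \<psi> i) = root_exp t T \<phi> + root_exp t T \<psi>"
  by (induction T arbitrary: \<phi> \<psi>) (simp_all add: algebra_simps)

lemma root_exp_cmult: "root_exp t T (\<lambda>i. a * \<phi> i) = a * root_exp t T \<phi>"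
  by (induction T arbitrary: \<phi>) (simp_all add: algebra_simps)

lemma root_exp_diff: "root_exp t T (\<lambda>i. \<phi> i - \<psi> i) = root_exp t T \<phi> - root_exp t T \<psi>"
  using root_exp_add[of t T \<phi> "\<lambda>i. (-1) * \<psi> i"] unfolding root_exp_cmult by simp

lemma root_exp_const [simp]: "root_exp t T (\<lambda>_. a) = a"
  by (induction T arbitrary: a) (simp_all add: algebra_simps)

lemma root_exp_mult_const: "root_exp t T (\<lambda>i. \<phi> i * a) = root_exp t T \<phi> * a"
  using root_exp_cmult[of t T a \<phi>] by (simp add: mult.commute)

lemma rest_exp_add: "rest_exp t T (\<lambda>i. \<phi> i + \<psi> i) = rest_exp t T \<phi> + rest_exp t T \<psi>"
  by (induction T) (simp_all add: root_exp_add algebra_simps)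

lemma rest_exp_cmult: "rest_exp t T (\<lambda>i. a * \<phi> i) = a * rest_exp t T \<phi>"
  by (induction T) (simp_all add: root_exp_cmult algebra_simps)

lemma rest_exp_diff: "rest_exp t T (\<lambda>i. \<phi> i - \<psi> i) = rest_exp t T \<phi> - rest_exp t T \<psi>"
  using rest_exp_add[of t T \<phi> "\<lambda>i. (-1) * \<psi> i"] unfolding rest_exp_cmult by simp

lemma cluster_exp_diff:
  "cluster_exp t T (\<lambda>i. \<phi> i - \<psi> i) = cluster_exp t T \<phi> - cluster_exp t T \<psi>"
  by (simp add: cluster_exp_def root_exp_diff rest_exp_diff)

lemma root_exp_nonneg:
  assumes "0 \<le> t" "t \<le> 1" "\<And>i. \<phi> i \<ge> 0"
  shows "root_exp t T \<phi> \<ge> 0"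
  using assms(3) by (induction T arbitrary: \<phi>) (use assms(1,2) in simp_all)

lemma rest_exp_nonneg:
  assumes "0 \<le> t" "t \<le> 1" "\<And>i. \<phi> i \<ge> 0"
  shows "rest_exp t T \<phi> \<ge> 0"
  by (induction T) (use assms root_exp_nonneg in simp_all)

lemma root_exp_id: "root_exp t T of_int = root_sum (- t) T"
  by (induction T) (simp_all add: root_exp_diff algebra_simps)

text \<open>The squared imbalance is the sum of \<open>(-1) ^ d\<close> over the ordered pairs of
  the cluster, and a pair at distance \<open>d\<close> lies in one cluster with probability
  \<open>t ^ d\<close>. In the induction only the cross term of the two joined root clusters is
  new.\<close>

lemma cluster_exp_square:
  "cluster_exp t T (\<lambda>i. (of_int i)\<^sup>2) = pair_sum (- t) T"
proof (induction T)
  case (Graft T c)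
  have sq: "(of_int (i - j) :: real)\<^sup>2 = (of_int i)\<^sup>2 + ((of_int j)\<^sup>2 - (2 * of_int i) * of_int j)"
    for i j by (simp add: power2_eq_square algebra_simps)
  have "root_exp t T (\<lambda>i. root_exp t c (\<lambda>j. (of_int (i - j))\<^sup>2))
    = root_exp t T (\<lambda>i. (of_int i)\<^sup>2) + root_exp t c (\<lambda>i. (of_int i)\<^sup>2)
      - 2 * root_sum (- t) T * root_sum (- t) c"
    unfolding sq root_exp_add root_exp_diff root_exp_cmult root_exp_const root_exp_mult_const
    by (simp add: root_exp_id)
  then have "t * root_exp t T (\<lambda>i. root_exp t c (\<lambda>j. (of_int (i - j))\<^sup>2))
    = t * (root_exp t T (\<lambda>i. (of_int i)\<^sup>2) + root_exp t c (\<lambda>i. (of_int i)\<^sup>2)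
      - 2 * root_sum (- t) T * root_sum (- t) c)"
    by (rule arg_cong)
  then show ?case
    using Graft by (simp add: cluster_exp_def algebra_simps)
qed (simp add: cluster_exp_def)

text \<open>The imbalance has the parity of the cluster size, so this is -1 to the power of the
  size. It is multiplicative when clusters merge, which closes the recursions for its
  expectations.\<close>

definition parity_sign :: "int \<Rightarrow> real" where
  "parity_sign i = (if even i then 1 else -1)"

text \<open>The square minus the indicator of odd numbers: zero exactly at -1, 0 and 1, positive
  elsewhere.\<close>

definition excess :: "int \<Rightarrow> real" where
  "excess i = (of_int i)\<^sup>2 - (1 - parity_sign i) / 2"

lemma parity_sign_1 [simp]: "parity_sign 1 = -1"
  by (simp add: parity_sign_def)

lemma parity_sign_diff: "parity_sign (i - j) = parity_sign i * parity_sign j"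
  by (simp add: parity_sign_def)

lemma excess_nonneg: "excess i \<ge> 0"
proof (cases "i = 0")
  case False
  then have "1 \<le> i\<^sup>2"
    by (simp add: int_one_le_iff_zero_less)
  then have "1 \<le> (of_int i :: real)\<^sup>2"
    by (metis of_int_1_le_iff of_int_power)
  then show ?thesis
    by (auto simp: excess_def parity_sign_def)
qed (simp add: excess_def parity_sign_def)

abbreviation rsgn :: "real \<Rightarrow> rtree \<Rightarrow> real" where
  "rsgn t T \<equiv> root_exp t T parity_sign"

text \<open>The expected number of even clusters minus that of odd ones. The expected number of all
  clusters depends on the size of the tree only, so few odd clusters means a large value.\<close>

abbreviation csgn :: "real \<Rightarrow> rtree \<Rightarrow> real" where
  "csgn t T \<equiv> cluster_exp t T parity_sign"

lemma rsgn_Graft: "rsgn t (Graft T c) = rsgn t T * (1 - t + t * rsgn t c)"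
  by (simp add: parity_sign_diff root_exp_cmult root_exp_mult_const algebra_simps)

text \<open>With probability \<open>t\<close> the new edge replaces two root clusters by their
  union, whose sign is the product.\<close>

lemma csgn_Graft: "csgn t (Graft T c) =
    csgn t T + csgn t c - t * (rsgn t T + rsgn t c - rsgn t T * rsgn t c)"
  by (simp add: cluster_exp_def parity_sign_diff root_exp_cmult root_exp_mult_const algebra_simps)

lemma rsgn_Single [simp]: "rsgn t Single = -1"
  by simp

lemma csgn_Single [simp]: "csgn t Single = -1"
  by (simp add: cluster_exp_def)

lemma abs_rsgn_le_1:
  assumes "0 \<le> t" "t \<le> 1"
  shows "\<bar>rsgn t T\<bar> \<le> 1"
proof -
  have "root_exp t T (\<lambda>i. 1 - parity_sign i) \<ge> 0" "root_exp t T (\<lambda>i. 1 + parity_sign i) \<ge> 0"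
    using assms by (auto intro!: root_exp_nonneg simp: parity_sign_def)
  then show ?thesis
    unfolding root_exp_diff root_exp_add root_exp_const by linarith
qed

text \<open>Every removed edge adds one cluster.\<close>

lemma cluster_exp_one: "cluster_exp t T (\<lambda>_. 1) = 1 + (real (rsize T) - 1) * (1 - t)"
proof -
  have "rest_exp t T (\<lambda>_. 1) = (real (rsize T) - 1) * (1 - t)"
    by (induction T) (simp_all add: algebra_simps)
  then show ?thesis
    by (simp add: cluster_exp_def)
qed

text \<open>A squared imbalance is its excess plus 1 for an odd cluster, and the odd clusters number
  half of all clusters minus \<open>csgn\<close>.\<close>

lemma pair_sum_eq_excess:
  "pair_sum (- t) T =
     cluster_exp t T excess + (1 + (real (rsize T) - 1) * (1 - t) - csgn t T) / 2"
proof -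
  have "cluster_exp t T excess = cluster_exp t T (\<lambda>i. (of_int i)\<^sup>2)
      - cluster_exp t T (\<lambda>i. (1 / 2) * (1 - parity_sign i))"
    unfolding cluster_exp_diff[symmetric] by (simp add: excess_def[abs_def])
  moreover have "cluster_exp t T (\<lambda>i. (1 / 2) * (1 - parity_sign i))
      = (1 / 2) * (cluster_exp t T (\<lambda>_. 1) - csgn t T)"
    unfolding cluster_exp_diff[symmetric]
    by (simp only: cluster_exp_def root_exp_cmult rest_exp_cmult distrib_left)
  ultimately show ?thesis
    by (simp add: cluster_exp_square cluster_exp_one)
qed

text \<open>The root cluster of a path rooted at its end has imbalance 0 or 1. Passing to the child
  composes \<open>\<phi>\<close> with \<open>i \<mapsto> 1 - i\<close>, which swaps these values;
  hence the generalization over \<open>\<phi>\<close>.\<close>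

lemma root_exp_end_path_eq_0:
  "n > 0 \<Longrightarrow> \<phi> 0 = 0 \<Longrightarrow> \<phi> 1 = 0 \<Longrightarrow> root_exp t (end_path n) \<phi> = 0"
  by (induction n arbitrary: \<phi> rule: nat_induct_non_zero) (simp_all add: end_path_Suc)

lemma cluster_exp_end_path_excess:
  assumes "n > 0"
  shows "cluster_exp t (end_path n) excess = 0"
proof -
  have e: "excess 0 = 0" "excess 1 = 0"
    by (simp_all add: excess_def parity_sign_def)
  have "rest_exp t (end_path n) excess = 0"
    using assms
    by (induction n rule: nat_induct_non_zero) (simp_all add: end_path_Suc root_exp_end_path_eq_0 e)
  then show ?thesis
    using assms by (simp add: cluster_exp_def root_exp_end_path_eq_0 e)
qed

section \<open>Odd clusters under tree shifts\<close>

lemma rsize_stem_funpow: "rsize ((stem ^^ k) T) = k + rsize T"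
  by (induction k) auto

lemma geometric_alternating:
  fixes t :: real
  shows "(1 + t) * (\<Sum>i<n. (- t) ^ i) = 1 - (- t) ^ n"
  by (induction n) (simp_all add: algebra_simps)

text \<open>A new top vertex acts on the root sign by the affine map
  \<open>r \<mapsto> - (1 - t) - t * r\<close>, here iterated.\<close>

lemma rsgn_stem_funpow:
  "rsgn t ((stem ^^ n) T) = - (1 - t) * (\<Sum>i<n. (- t) ^ i) + (- t) ^ n * rsgn t T"
proof (induction n)
  case (Suc n)
  have s: "(\<Sum>i<Suc n. (- t) ^ i) = 1 - t * (\<Sum>i<n. (- t) ^ i)"
    by (simp add: sum.lessThan_Suc_shift sum_distrib_left sum_negf del: sum.lessThan_Suc)
  have "rsgn t ((stem ^^ Suc n) T) = - (1 - t) - t * rsgn t ((stem ^^ n) T)"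
    by (simp add: rsgn_Graft algebra_simps del: root_exp.simps(2))
  then show ?case
    unfolding s Suc by (simp add: algebra_simps)
qed simp

lemma rsgn_end_path:
  "rsgn t (end_path (Suc n)) = - (1 - t) * (\<Sum>i<n. (- t) ^ i) - (- t) ^ n"
  using rsgn_stem_funpow[of t n Single] by (simp add: end_path_def)

text \<open>A generalized tree shift: the branches \<open>T\<close> move from the top of a pendant path to its free
  end.\<close>

lemma csgn_tree_shift:
  "csgn t ((stem ^^ Suc n) T) = csgn t (Graft T (end_path (Suc n)))"
proof (induction n)
  case 0
  then show ?case
    by (simp add: csgn_Graft)
next
  case (Suc n)
  define s where "s = (\<Sum>i<n. (- t) ^ i)"
  define x where "x = (- t) ^ n"
  \<comment> \<open>The only fact about the geometric sum that enters; modulo it the induction step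
    is a polynomial identity.\<close>
  have s: "s + t * s = 1 - x"
    using geometric_alternating[of t n] by (simp add: s_def x_def algebra_simps)
  define U where "U = (stem ^^ Suc n) T"
  define E where "E = end_path (Suc n)"
  have s': "(\<Sum>i<Suc n. (- t) ^ i) = 1 - t * s"
    by (simp add: s_def sum.lessThan_Suc_shift sum_distrib_left sum_negf del: sum.lessThan_Suc)
  have rU: "rsgn t U = - (1 - t) * (1 - t * s) - t * x * rsgn t T"
    unfolding U_def rsgn_stem_funpow s' by (simp add: x_def)
  have rE: "rsgn t E = - (1 - t) * s - x"
    by (simp add: E_def rsgn_end_path s_def x_def)
  have IH: "csgn t U = csgn t T + csgn t E - t * (rsgn t T + rsgn t E - rsgn t T * rsgn t E)"
    using Suc by (simp add: U_def E_def csgn_Graft)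
  have "csgn t ((stem ^^ Suc (Suc n)) T) = csgn t U - 1 + t - 2 * t * rsgn t U"
    by (simp add: U_def csgn_Graft algebra_simps del: root_exp.simps(2))
  also have "\<dots> = csgn t T + (csgn t E - 1 + t - 2 * t * rsgn t E)
     - t * (rsgn t T + (- (1 - t) - t * rsgn t E) - rsgn t T * (- (1 - t) - t * rsgn t E))"
    unfolding IH rU rE using s by algebra
  also have "\<dots> = csgn t (Graft T (stem E))"
    by (simp add: csgn_Graft rsgn_Graft algebra_simps del: root_exp.simps(2))
  finally show ?case
    by (simp add: E_def end_path_Suc)
qed

text \<open>Strengthened for induction: a tree joined by an edge to another one of root sign
  \<open>r\<close> enters through \<open>csgn t T - k * rsgn t T\<close> with
  \<open>k = t * (1 - r)\<close>. As \<open>r\<close> lies in \<open>[-1, 1]\<close>, this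
  \<open>k\<close> lies in \<open>[0, 2 * t]\<close>. The case \<open>k = 0\<close> is the
  comparison that is wanted.\<close>

definition sgn_dominated :: "real \<Rightarrow> rtree \<Rightarrow> bool" where
  "sgn_dominated t T \<longleftrightarrow> (\<forall>k\<in>{0..2 * t}.
     csgn t T - k * rsgn t T
       \<le> csgn t (end_path (rsize T)) - k * rsgn t (end_path (rsize T)))"

lemma sgn_dominated_stem:
  assumes "0 \<le> t" "t \<le> 1" "sgn_dominated t T"
  shows "sgn_dominated t (stem T)"
  unfolding sgn_dominated_def
proof
  fix k assume k: "k \<in> {0..2 * t}"
  \<comment> \<open>The weight that \<open>T\<close> receives below a new top vertex of weight
    \<open>k\<close>; it stays in the admissible range.\<close>
  have "t * (2 - k) \<in> {0..2 * t}"
    using assms(1,2) k mult_nonneg_nonneg[of t k] mult_nonneg_nonneg[of t "2 - k"]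
    by (auto simp: algebra_simps)
  moreover have "csgn t (stem U) - k * rsgn t (stem U)
      = csgn t U - t * (2 - k) * rsgn t U - (1 - t) * (1 - k)" for U
    by (simp add: csgn_Graft rsgn_Graft algebra_simps del: root_exp.simps(2))
  ultimately show "csgn t (stem T) - k * rsgn t (stem T)
       \<le> csgn t (end_path (rsize (stem T))) - k * rsgn t (end_path (rsize (stem T)))"
    using assms(3) by (simp add: sgn_dominated_def end_path_Suc rsize_pos del: root_exp.simps(2))
qed

text \<open>Three moves, none of which lowers the weighted quantity: \<open>c\<close> becomes a
  path, \<open>T\<close> is shifted to the free end of that path, and the resulting chain ending in
  \<open>T\<close> is compared with a path by repeated use of
  \<open>sgn_dominated_stem\<close>.\<close>

lemma sgn_dominated_Graft:
  assumes t: "0 \<le> t" "t \<le> 1" and T: "sgn_dominated t T" and c: "sgn_dominated t c"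
  shows "sgn_dominated t (Graft T c)"
  unfolding sgn_dominated_def
proof
  fix k assume k: "k \<in> {0..2 * t}"
  let ?F = "\<lambda>U. csgn t U - k * rsgn t U"
  define n where "n = rsize c - 1"
  have n: "rsize c = Suc n"
    using rsize_pos[of c] by (simp add: n_def)
  let ?P = "end_path (Suc n)" and ?V = "(stem ^^ Suc n) T"
  \<comment> \<open>Up to sign, the coefficient of the root sign of the grafted branch in
    \<open>?F\<close>.\<close>
  define q where "q = t * (1 - (1 - k) * rsgn t T)"
  have "\<bar>(1 - k) * rsgn t T\<bar> \<le> 1 * 1"
    unfolding abs_mult using k t abs_rsgn_le_1[OF t] by (intro mult_mono) auto
  then have "0 \<le> 1 - (1 - k) * rsgn t T" "1 - (1 - k) * rsgn t T \<le> 2"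
    by linarith+
  then have "q \<in> {0..2 * t}"
    using t mult_left_mono[of "1 - (1 - k) * rsgn t T" 2 t] by (simp add: q_def mult.commute)
  then have "csgn t c - q * rsgn t c \<le> csgn t ?P - q * rsgn t ?P"
    using c n by (simp add: sgn_dominated_def)
  moreover have F: "?F (Graft T U) =
      csgn t U - q * rsgn t U + csgn t T - (t + k * (1 - t)) * rsgn t T" for U
    unfolding csgn_Graft rsgn_Graft q_def by (simp add: algebra_simps)
  ultimately have "?F (Graft T c) \<le> ?F (Graft T ?P)"
    by simp
  also have "\<dots> \<le> ?F ?V"
  proof -
    \<comment> \<open>The shift leaves \<open>csgn\<close> unchanged, since both trees agree up to
      the choice of the root; it lowers the root sign by the nonnegative amount
      \<open>?a * (1 + rsgn t T)\<close>.\<close>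
    let ?a = "(1 - t) * (\<Sum>i<Suc n. (- t) ^ i)"
    have "\<bar>(- t) ^ Suc n\<bar> \<le> 1"
      unfolding power_abs using t by (intro power_le_one) auto
    then have "0 \<le> (1 + t) * (\<Sum>i<Suc n. (- t) ^ i)"
      unfolding geometric_alternating by linarith
    then have "0 \<le> (\<Sum>i<Suc n. (- t) ^ i)"
      using t by (simp add: zero_le_mult_iff del: sum.lessThan_Suc)
    then have "0 \<le> ?a"
      using t by (intro mult_nonneg_nonneg) auto
    moreover have "rsgn t ?V = - ?a + (- t) ^ Suc n * rsgn t T"
      using rsgn_stem_funpow[of t "Suc n" T] by (simp only: mult_minus_left)
    moreover have "rsgn t (Graft T ?P) = - rsgn t T * rsgn t (stem ?P)"
      by (simp add: rsgn_Graft algebra_simps del: root_exp.simps(2))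
    moreover have "rsgn t (stem ?P) = - ?a - (- t) ^ Suc n"
      using rsgn_end_path[of t "Suc n"] by (simp only: end_path_Suc zero_less_Suc mult_minus_left)
    ultimately have "rsgn t (Graft T ?P) - rsgn t ?V = ?a * (1 + rsgn t T)" "0 \<le> ?a"
      by (simp_all only: algebra_simps mult_minus_left mult_minus_right)
    moreover have "0 \<le> 1 + rsgn t T"
      using abs_rsgn_le_1[OF t, of T] by linarith
    ultimately have "0 \<le> k * (rsgn t (Graft T ?P) - rsgn t ?V)"
      using k by simp
    then show ?thesis
      unfolding csgn_tree_shift by (simp add: algebra_simps del: root_exp.simps(2) funpow.simps)
  qed
  also have "\<dots> \<le> ?F (end_path (rsize ?V))"
  proof -
    have "sgn_dominated t ((stem ^^ m) T)" for m
      by (induction m) (use T sgn_dominated_stem[OF t] in auto)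
    then show ?thesis
      using k unfolding sgn_dominated_def by blast
  qed
  also have "rsize ?V = rsize (Graft T c)"
    unfolding rsize_stem_funpow by (simp add: n)
  finally show "?F (Graft T c) \<le> ?F (end_path (rsize (Graft T c)))" .
qed

lemma sgn_dominated: "0 \<le> t \<Longrightarrow> t \<le> 1 \<Longrightarrow> sgn_dominated t T"
  by (induction T) (auto simp: sgn_dominated_Graft, simp add: sgn_dominated_def)

text \<open>The path has no excess and the same expected number of clusters, so only
  \<open>csgn\<close> remains to be compared.\<close>

lemma pair_sum_excess:
  assumes "0 \<le> t" "t \<le> 1"
  shows "pair_sum (- t) (end_path (rsize T)) + cluster_exp t T excess \<le> pair_sum (- t) T"
proof -
  have "csgn t T \<le> csgn t (end_path (rsize T))"
    using sgn_dominated[OF assms, of T] assms by (auto simp: sgn_dominated_def dest: bspec[of _ _ 0])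
  then show ?thesis
    unfolding pair_sum_eq_excess
    by (simp add: cluster_exp_end_path_excess rsize_end_path rsize_pos divide_right_mono)
qed

section \<open>Positive excess at forks\<close>

lemma cluster_exp_excess_nonneg: "0 \<le> t \<Longrightarrow> t \<le> 1 \<Longrightarrow> 0 \<le> cluster_exp t T excess"
  by (simp add: cluster_exp_def root_exp_nonneg rest_exp_nonneg excess_nonneg)

text \<open>With positive probability all edges at the root are removed, and its cluster then has
  imbalance 1.\<close>

lemma root_exp_pos:
  assumes "0 < t" "t < 1" "\<And>i. \<phi> i \<ge> 0" "\<phi> 1 > 0"
  shows "root_exp t T \<phi> > 0"
  using assms(3,4)
  by (induction T arbitrary: \<phi>)
    (use assms(1,2) in \<open>auto intro!: add_pos_nonneg mult_nonneg_nonneg root_exp_nonneg\<close>)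

text \<open>If the root of \<open>c\<close> is isolated within \<open>c\<close> and the new edge is
  kept, an attainable imbalance \<open>m\<close> becomes \<open>m - 1\<close>. Attainability is
  phrased through test functions that are positive at \<open>m\<close>.\<close>

lemma root_exp_pos_minus:
  assumes "0 < t" "t < 1" "\<And>i. \<phi> i \<ge> 0"
    and "\<And>\<psi>. (\<And>i. \<psi> i \<ge> 0) \<Longrightarrow> \<psi> m > 0 \<Longrightarrow> root_exp t T \<psi> > 0" "\<phi> (m - 1) > 0"
  shows "root_exp t (Graft T c) \<phi> > 0"
proof -
  have "root_exp t T (\<lambda>i. root_exp t c (\<lambda>j. \<phi> (i - j))) > 0"
    using assms by (intro assms(4) root_exp_nonneg root_exp_pos) auto
  then show ?thesis
    using assms by (auto intro!: add_nonneg_pos mult_nonneg_nonneg root_exp_nonneg)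
qed

lemma root_exp_pos_0:
  assumes "0 < t" "t < 1" "\<And>i. \<phi> i \<ge> 0" "\<phi> 0 > 0" "T \<noteq> Single"
  shows "root_exp t T \<phi> > 0"
proof -
  obtain U c where "T = Graft U c"
    using assms(5) by (cases T) auto
  then show ?thesis
    using assms(1-4) root_exp_pos[OF assms(1,2)] root_exp_pos_minus[of t \<phi> 1 U c] by simp
qed

text \<open>The root has at least two children here; keeping two of them as leaves gives
  \<open>1 - 1 - 1\<close>.\<close>

lemma root_exp_pos_minus_1:
  assumes "0 < t" "t < 1" "\<And>i. \<phi> i \<ge> 0" "\<phi> (-1) > 0" "T \<noteq> Single"
  shows "root_exp t (Graft T c) \<phi> > 0"
  using assms by (intro root_exp_pos_minus[of t \<phi> 0] root_exp_pos_0) auto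

lemma excess_pos: "excess 2 > 0" "excess (-2) > 0"
  by (simp_all add: excess_def parity_sign_def)

lemma cluster_exp_pos_not_rpath:
  assumes t: "0 < t" "t < 1" and "\<not> rpath c"
  shows "cluster_exp t (Graft T c) excess > 0"
  using assms(3)
proof (induction c arbitrary: T)
  case (Graft U d)
  show ?case
  proof (cases "U = Single")
    case False
    \<comment> \<open>With two children the root of \<open>Graft U d\<close> attains -1; joined to a
      root of \<open>T\<close> isolated within \<open>T\<close>, this gives
      \<open>1 - (-1) = 2\<close>.\<close>
    have "root_exp t T (\<lambda>i. root_exp t (Graft U d) (\<lambda>j. excess (i - j))) > 0"
      using t False
      by (intro root_exp_pos root_exp_nonneg root_exp_pos_minus_1 excess_nonneg)
        (auto simp: excess_pos)
    then have "root_exp t (Graft T (Graft U d)) excess > 0"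
      using t by (subst root_exp.simps) (auto intro!: add_nonneg_pos mult_nonneg_nonneg root_exp_nonneg excess_nonneg
          simp del: root_exp.simps)
    moreover have "rest_exp t (Graft T (Graft U d)) excess \<ge> 0"
      using t by (intro rest_exp_nonneg excess_nonneg) auto
    ultimately show ?thesis
      by (simp add: cluster_exp_def)
  next
    case True
    then have "cluster_exp t (Graft U d) excess > 0"
      using Graft by simp
    moreover have nn: "root_exp t V excess \<ge> 0" "rest_exp t V excess \<ge> 0" for V
      using t by (auto intro: root_exp_nonneg rest_exp_nonneg excess_nonneg)
    \<comment> \<open>The excess already occurs inside \<open>Graft U d\<close>, whose clusters are
      unchanged when the edge to \<open>T\<close> is removed.\<close>
    ultimately have "rest_exp t (Graft U d) excess + (1 - t) * root_exp t (Graft U d) excess > 0"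
      using t nn[of "Graft U d"] unfolding cluster_exp_def
      by (smt (verit) mult_nonneg_nonneg mult_pos_pos)
    then show ?thesis
      using nn[of T] nn(1)[of "Graft T (Graft U d)"] unfolding cluster_exp_def
      by (subst rest_exp.simps) linarith
  qed
qed simp

lemma cluster_exp_pos_not_upath:
  assumes t: "0 < t" "t < 1" and "\<not> upath T"
  shows "cluster_exp t T excess > 0"
proof -
  obtain U c where T: "T = Graft U c"
    using assms by (cases T) auto
  have nn: "root_exp t V excess \<ge> 0" "rest_exp t V excess \<ge> 0" for V
    using t by (auto intro: root_exp_nonneg rest_exp_nonneg excess_nonneg)
  show ?thesis
  proof (cases "rpath c")
    case False
    then show ?thesis
      using cluster_exp_pos_not_rpath[OF t] T by simp
  next
    case True
    then have "\<not> rpath U"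
      using assms T by simp
    then obtain V d where U: "U = Graft V d"
      by (cases U) auto
    show ?thesis
    proof (cases "V = Single")
      case False
      \<comment> \<open>Three children of the root kept as leaves:
        \<open>1 - 3 = -2\<close>.\<close>
      have "root_exp t T excess > 0"
        unfolding T U using t False
        by (intro root_exp_pos_minus[of t excess "-1"] root_exp_pos_minus_1)
          (auto simp: excess_nonneg excess_pos simp del: root_exp.simps)
      then show ?thesis
        using nn[of T] by (simp add: cluster_exp_def)
    next
      case True
      then have "cluster_exp t U excess > 0"
        using \<open>\<not> rpath U\<close> U cluster_exp_pos_not_rpath[OF t, of d] by simp
      moreover have "root_exp t T excess \<ge> (1 - t) * root_exp t U excess"
      proof -
        have "0 \<le> root_exp t U (\<lambda>i. root_exp t c (\<lambda>j. excess (i - j)))"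
          using t by (intro root_exp_nonneg excess_nonneg) auto
        then show ?thesis
          using t by (simp add: T)
      qed
      moreover have "rest_exp t T excess \<ge> rest_exp t U excess"
        using nn[of c] t by (simp add: T)
      ultimately show ?thesis
        using t nn[of U] unfolding cluster_exp_def
        by (smt (verit) mult_nonneg_nonneg mult_pos_pos)
    qed
  qed
qed

lemma pair_sum_ge:
  assumes "\<bar>l\<bar> \<le> 1"
  shows "pair_sum l (end_path (rsize T)) \<le> pair_sum l T"
proof (cases "0 \<le> l")
  case False
  then show ?thesis
    using pair_sum_excess[of "- l" T] cluster_exp_excess_nonneg[of "- l" T] assms by simp
qed (use pair_sum_ge_nonneg assms in auto)

lemma pair_sum_gt:
  assumes "\<bar>l\<bar> < 1" "l \<noteq> 0" "\<not> upath T"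
  shows "pair_sum l (end_path (rsize T)) < pair_sum l T"
proof (cases "0 \<le> l")
  case False
  then show ?thesis
    using pair_sum_excess[of "- l" T] cluster_exp_pos_not_upath[of "- l" T] assms by simp
qed (use pair_sum_gt_pos assms in auto)

section \<open>Moment functionals on an interval\<close>

definition moment :: "(nat \<Rightarrow> real) \<Rightarrow> real poly \<Rightarrow> real" where
  "moment c p = (\<Sum>i\<le>degree p. coeff p i * c i)"

lemma moment_eq: "degree p \<le> n \<Longrightarrow> moment c p = (\<Sum>i\<le>n. coeff p i * c i)"
  unfolding moment_def by (rule sum.mono_neutral_left) (auto simp: coeff_eq_0)

lemma moment_0 [simp]: "moment c 0 = 0"
  by (simp add: moment_def)

lemma moment_add: "moment c (p + q) = moment c p + moment c q"
proof -
  let ?n = "max (degree p) (degree q)"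
  have "degree (p + q) \<le> ?n" by (rule degree_add_le_max)
  then show ?thesis
    by (simp add: moment_eq[of _ ?n] algebra_simps sum.distrib)
qed

lemma moment_smult: "moment c (smult a p) = a * moment c p"
  by (simp add: moment_eq[OF degree_smult_le] moment_def sum_distrib_left mult.assoc)

lemma moment_diff: "moment c (p - q) = moment c p - moment c q"
  using moment_add[of c p "- q"] moment_smult[of c "-1" q] by simp

lemma moment_sum: "moment c (\<Sum>i\<in>A. p i) = (\<Sum>i\<in>A. moment c (p i))"
  by (induction A rule: infinite_finite_induct) (simp_all add: moment_add)

lemma moment_monom: "moment c (monom a n) = a * c n"
proof -
  have "moment c (monom a n) = (\<Sum>i\<le>n. coeff (monom a n) i * c i)"
    by (rule moment_eq) (rule degree_monom_le)
  also have "\<dots> = (\<Sum>i\<le>n. if i = n then a * c i else 0)"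
    by (intro sum.cong) auto
  finally show ?thesis by simp
qed

lemma moment_1: "moment c 1 = c 0"
  using moment_monom[of c 1 0] by (simp add: monom_0 one_pCons)

text \<open>Positivity on squares and on squares times \<open>1 + x\<close> or \<open>1 - x\<close>:
  a generating part of positivity on \<open>[-1, 1]\<close> that can be verified directly for the
  covariances.\<close>

definition interval_moments :: "(nat \<Rightarrow> real) \<Rightarrow> bool" where
  "interval_moments c \<longleftrightarrow> (\<forall>q. 0 \<le> moment c (q * q) \<and>
     0 \<le> moment c ([:1, 1:] * (q * q)) \<and> 0 \<le> moment c ([:1, -1:] * (q * q)))"

text \<open>Even powers are squares, so only the parities of the exponents matter. Two odd exponents
  leave the factor \<open>1 - x\<^sup>2\<close>, whose double is
  \<open>(1 - x) * (1 + x)\<^sup>2 + (1 + x) * (1 - x)\<^sup>2\<close>.\<close>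

lemma moment_Bernstein_nonneg:
  assumes "interval_moments c"
  shows "0 \<le> moment c ([:1, 1:] ^ i * [:1, -1:] ^ j)"
proof -
  let ?x = "[:1, 1:] :: real poly" and ?y = "[:1, -1:] :: real poly"
  note pos = assms[unfolded interval_moments_def, rule_format]
  have xy: "0 \<le> moment c (?x * ?y * (q * q))" for q
  proof -
    have "smult 2 (?x * ?y * (q * q)) = ?y * ((?x * q) * (?x * q)) + ?x * ((?y * q) * (?y * q))"
      (is "_ = ?r")
    proof -
      have "?r = (?x + ?y) * (?x * ?y * (q * q))" by (simp only: algebra_simps)
      also have "?x + ?y = [:2:]" by simp
      finally show ?thesis by simp
    qed
    then have "2 * moment c (?x * ?y * (q * q)) =
        moment c (?y * ((?x * q) * (?x * q))) + moment c (?x * ((?y * q) * (?y * q)))"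
      by (metis moment_add moment_smult)
    then show ?thesis
      using pos[of "?x * q"] pos[of "?y * q"] by linarith
  qed
  let ?q = "?x ^ (i div 2) * ?y ^ (j div 2)"
  have half: "z ^ k = (if even k then 1 else z) * (z ^ (k div 2) * z ^ (k div 2))" for z :: "real poly" and k
    by (auto simp: power_add[symmetric] mult_2[symmetric] elim!: evenE oddE)
  have "?x ^ i * ?y ^ j = (if even i then 1 else ?x) * (if even j then 1 else ?y) * (?q * ?q)"
    by (subst half[of ?x i], subst half[of ?y j]) (simp only: algebra_simps)
  moreover have "0 \<le> moment c ((if even i then 1 else ?x) * (if even j then 1 else ?y) * (?q * ?q))"
    using pos[of ?q] xy[of ?q] by (simp only: mult_1_left mult_1_right split: if_splits) blast
  ultimately show ?thesis
    by (simp only:)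
qed

text \<open>The quotient is a product of \<open>m\<close> factors \<open>(k - i) / (N - i)\<close>,
  each within \<open>m / (N - m)\<close> of \<open>k / N\<close>.\<close>

lemma binomial_ratio_bound:
  assumes "m < N" "k \<le> N"
  shows "\<bar>real (k choose m) / real (N choose m) - (real k / real N) ^ m\<bar> \<le> real (m\<^sup>2) / real (N - m)"
  using assms(1)
proof (induction m)
  case (Suc m)
  show ?case
  proof (cases "k \<le> m")
    case True
    have "(real k / real N) ^ Suc m \<le> real k / real N"
      using assms Suc.prems power_decreasing[of 1 "Suc m" "real k / real N"] by simp
    also have "\<dots> \<le> real ((Suc m)\<^sup>2) / real (N - Suc m)"
    proof (rule frac_le)
      have "k \<le> (Suc m)\<^sup>2"
        using True by (simp add: power2_eq_square)
      then show "real k \<le> real ((Suc m)\<^sup>2)"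
        by (rule of_nat_mono)
    qed (use Suc.prems in auto)
    finally show ?thesis
      using True by (simp add: binomial_eq_0)
  next
    case False
    \<comment> \<open>\<open>r\<close> is the new factor of the quotient \<open>a\<close>,
      \<open>s\<close> that of the power \<open>b\<close>; the errors just add up because
      \<open>r\<close> and \<open>b\<close> are at most 1.\<close>
    define a b r s where "a = real (k choose m) / real (N choose m)" and "b = (real k / real N) ^ m"
      and "r = (real k - real m) / (real N - real m)" and "s = real k / real N"
    have ch: "real (n choose Suc m) = real (n choose m) * (real n - real m) / (real m + 1)" if "m \<le> n" for n
    proof -
      have "Suc m * (n choose Suc m) = (n - m) * (n choose m)"
        by (simp only: binomial_absorb_comp binomial_absorption)
      then have "real (Suc m) * real (n choose Suc m) = real (n - m) * real (n choose m)"
        by (metis of_nat_mult)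
      then show ?thesis
        using that by (simp add: of_nat_diff field_simps)
    qed
    have a': "real (k choose Suc m) / real (N choose Suc m) = a * r"
      using False Suc.prems assms by (simp add: ch a_def r_def)
    have "0 \<le> r" "r \<le> 1" "0 \<le> b" "b \<le> 1"
      using False Suc.prems assms by (auto simp: r_def b_def intro!: power_le_one)
    have "s - r = real m * (real N - real k) / (real N * (real N - real m))"
      using Suc.prems by (simp add: r_def s_def field_simps)
    also have "\<dots> \<le> real m * real N / (real N * (real N - real m))"
      using Suc.prems assms by (intro divide_right_mono mult_left_mono) auto
    also have "\<dots> = real m / real (N - m)"
      using Suc.prems by (simp add: of_nat_diff)
    finally have "s - r \<le> real m / real (N - m)" .
    moreover have "0 \<le> s - r"
      using \<open>s - r = _\<close> Suc.prems assms by simp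
    moreover have "\<bar>a * r - b * s\<bar> \<le> \<bar>a - b\<bar> + (s - r)"
    proof -
      have "a * r - b * s = (a - b) * r + b * (r - s)" by (simp add: algebra_simps)
      then have "\<bar>a * r - b * s\<bar> \<le> \<bar>a - b\<bar> * r + b * (s - r)"
        using \<open>0 \<le> r\<close> \<open>0 \<le> b\<close> \<open>0 \<le> s - r\<close> by (simp add: abs_mult order_trans[OF abs_triangle_ineq])
      also have "\<dots> \<le> \<bar>a - b\<bar> * 1 + 1 * (s - r)"
        using \<open>r \<le> 1\<close> \<open>b \<le> 1\<close> \<open>0 \<le> s - r\<close> by (intro add_mono mult_left_mono mult_right_mono) auto
      finally show ?thesis by simp
    qed
    moreover have "\<bar>a - b\<bar> \<le> real (m\<^sup>2) / real (N - m)"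
      using Suc by (simp add: a_def b_def)
    ultimately have "\<bar>a * r - b * s\<bar> \<le> real (m\<^sup>2) / real (N - m) + real m / real (N - m)"
      by (meson add_mono order_trans)
    also have "\<dots> = real (m\<^sup>2 + m) / real (N - m)"
      by (simp add: add_divide_distrib)
    also have "\<dots> \<le> real ((Suc m)\<^sup>2) / real (N - Suc m)"
      using Suc.prems by (intro frac_le) (auto simp: power2_eq_square)
    finally show ?thesis
      by (simp add: a' b_def s_def mult.commute)
  qed
qed simp

text \<open>Hausdorff's argument: in the Bernstein basis of high degree, the coefficients of a polynomial
  are close to its values.\<close>

lemma moment_nonneg:
  assumes c: "interval_moments c" and D: "\<And>x. -1 \<le> x \<Longrightarrow> x \<le> 1 \<Longrightarrow> 0 \<le> poly D x"
  shows "0 \<le> moment c D"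
proof -
  define X Y where "X = [:1/2, 1/2 :: real:]" and "Y = [:1/2, -1/2 :: real:]"
  have XY: "X + Y = 1"
    by (simp add: X_def Y_def one_pCons)
  \<comment> \<open>\<open>D\<close> transported to \<open>[0, 1]\<close>, where \<open>X\<close> is
    the coordinate and \<open>Y\<close> its complement.\<close>
  define E where "E = pcompose D [:-1, 2:]"
  have DE: "D = pcompose E X"
  proof -
    have "pcompose [:-1, 2:] X = [:0, 1:]"
      by (simp add: X_def pcompose_pCons)
    then show ?thesis
      by (simp add: E_def pcompose_assoc[symmetric])
  qed
  define d where "d = degree E"
  \<comment> \<open>The functional on the Bernstein basis of degree \<open>N\<close>: nonnegative
    weights of total mass \<open>c 0\<close>, to be thought of as a measure on the points
    \<open>k / N\<close>.\<close>
  define b where "b N k = real (N choose k) * moment c (X ^ k * Y ^ (N - k))" for N k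
  have b_nonneg: "0 \<le> b N k" for N k
  proof -
    have "X = smult (1/2) [:1, 1:]" "Y = smult (1/2) [:1, -1:]"
      by (simp_all add: X_def Y_def)
    then have "X ^ k * Y ^ (N - k)
        = smult ((1/2) ^ k * (1/2) ^ (N - k)) ([:1, 1:] ^ k * [:1, -1:] ^ (N - k))"
      by (simp only: smult_power mult_smult_left mult_smult_right smult_smult mult.commute)
    then show ?thesis
      unfolding b_def using moment_Bernstein_nonneg[OF c, of k "N - k"]
      by (simp only: moment_smult) (intro mult_nonneg_nonneg, auto)
  qed
  have X_pow: "moment c (X ^ m) = (\<Sum>k\<le>N. b N k * (real (k choose m) / real (N choose m)))"
    if "m \<le> N" for m N
  proof -
    \<comment> \<open>The factor \<open>(X + Y) ^ (N - m) = 1\<close> raises the degree to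
      \<open>N\<close> and so yields the Bernstein coefficients.\<close>
    have "X ^ m = X ^ m * (X + Y) ^ (N - m)"
      by (simp add: XY)
    also have "\<dots> = (\<Sum>j\<le>N - m. smult (real (N - m choose j)) (X ^ (m + j) * Y ^ (N - m - j)))"
      by (simp add: binomial_ring sum_distrib_left power_add algebra_simps of_nat_poly)
    finally have "moment c (X ^ m) = (\<Sum>j\<le>N - m. real (N - m choose j) * moment c (X ^ (m + j) * Y ^ (N - m - j)))"
      by (simp add: moment_sum moment_smult)
    also have "\<dots> = (\<Sum>k\<in>{m..N}. real (N - m choose (k - m)) * moment c (X ^ k * Y ^ (N - k)))"
      using that by (intro sum.reindex_bij_witness[of _ "\<lambda>k. k - m" "\<lambda>j. m + j"]) auto
    also have "\<dots> = (\<Sum>k\<in>{m..N}. b N k * (real (k choose m) / real (N choose m)))"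
    proof (intro sum.cong refl)
      fix k assume "k \<in> {m..N}"
      then have "(N choose k) * (k choose m) = (N choose m) * (N - m choose (k - m))"
        by (intro choose_mult) auto
      then have "real (N choose k) * real (k choose m) = real (N choose m) * real (N - m choose (k - m))"
        by (metis of_nat_mult)
      then show "real (N - m choose (k - m)) * moment c (X ^ k * Y ^ (N - k))
          = b N k * (real (k choose m) / real (N choose m))"
        using that by (simp add: b_def field_simps)
    qed
    also have "\<dots> = (\<Sum>k\<le>N. b N k * (real (k choose m) / real (N choose m)))"
      by (intro sum.mono_neutral_left) (auto simp: binomial_eq_0)
    finally show ?thesis .
  qed
  have b_sum: "(\<Sum>k\<le>N. b N k) = c 0" for N
    using X_pow[of 0 N] by (simp add: moment_1)
  have c0: "0 \<le> c 0"
    using b_sum[of 0] b_nonneg[of 0 0] by simp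
  have momD: "moment c D = (\<Sum>m\<le>d. coeff E m * moment c (X ^ m))"
    unfolding DE pcompose_altdef poly_altdef
    by (simp add: moment_sum moment_smult degree_map_poly coeff_map_poly d_def)
  \<comment> \<open>Constant of the error estimate, independent of \<open>N\<close>, which is taken
    arbitrarily large in the end.\<close>
  define K where "K = (\<Sum>m\<le>d. \<bar>coeff E m\<bar>) * real (d\<^sup>2) * c 0"
  have lower: "- (K / real (N - d)) \<le> moment c D" if "d < N" for N
  proof -
    have near: "- ((\<Sum>m\<le>d. \<bar>coeff E m\<bar>) * (real (d\<^sup>2) / real (N - d)))
        \<le> (\<Sum>m\<le>d. coeff E m * (real (k choose m) / real (N choose m)))" if "k \<le> N" for k
    proof -
      let ?r = "\<lambda>m. real (k choose m) / real (N choose m)" and ?x = "real k / real N"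
      have "poly E ?x = poly D (2 * ?x - 1)"
        by (simp add: E_def poly_pcompose mult.commute)
      moreover have "0 \<le> ?x" "?x \<le> 1"
        using that \<open>d < N\<close> by auto
      then have "0 \<le> poly D (2 * ?x - 1)"
        by (intro D) linarith+
      ultimately have "0 \<le> poly E ?x"
        by simp
      then have *: "0 \<le> (\<Sum>m\<le>d. coeff E m * ?x ^ m)"
        by (simp add: poly_altdef d_def)
      have "(\<Sum>m\<le>d. coeff E m * ?x ^ m) - (\<Sum>m\<le>d. coeff E m * ?r m)
          \<le> (\<Sum>m\<le>d. \<bar>coeff E m\<bar> * (real (d\<^sup>2) / real (N - d)))"
        unfolding sum_subtractf[symmetric]
      proof (intro sum_mono)
        fix m assume m: "m \<in> {..d}"
        have "coeff E m * ?x ^ m - coeff E m * ?r m \<le> \<bar>coeff E m\<bar> * \<bar>?r m - ?x ^ m\<bar>"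
          by (metis abs_ge_self abs_minus_commute abs_mult right_diff_distrib)
        also have "\<dots> \<le> \<bar>coeff E m\<bar> * (real (m\<^sup>2) / real (N - m))"
          using m that \<open>d < N\<close> by (intro mult_left_mono binomial_ratio_bound) auto
        also have "\<dots> \<le> \<bar>coeff E m\<bar> * (real (d\<^sup>2) / real (N - d))"
          using m \<open>d < N\<close> by (intro mult_left_mono frac_le) (auto intro!: power_mono)
        finally show "coeff E m * ?x ^ m - coeff E m * ?r m
            \<le> \<bar>coeff E m\<bar> * (real (d\<^sup>2) / real (N - d))" .
      qed
      then show ?thesis
        using * unfolding sum_distrib_right by linarith
    qed
    have "- (K / real (N - d))
        = (\<Sum>k\<le>N. b N k * (- ((\<Sum>m\<le>d. \<bar>coeff E m\<bar>) * (real (d\<^sup>2) / real (N - d)))))"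
      unfolding sum_distrib_right[symmetric] b_sum by (simp add: K_def)
    also have "\<dots> \<le> (\<Sum>k\<le>N. b N k * (\<Sum>m\<le>d. coeff E m * (real (k choose m) / real (N choose m))))"
      using b_nonneg near by (intro sum_mono mult_left_mono) auto
    also have "\<dots> = (\<Sum>m\<le>d. coeff E m * (\<Sum>k\<le>N. b N k * (real (k choose m) / real (N choose m))))"
      unfolding sum_distrib_left by (subst sum.swap) (simp add: mult_ac)
    also have "\<dots> = moment c D"
      unfolding momD using that by (intro sum.cong) (auto simp: X_pow[of _ N])
    finally show ?thesis .
  qed
  have K: "0 \<le> K"
    using c0 by (auto simp: K_def intro!: mult_nonneg_nonneg sum_nonneg)
  show ?thesis
  proof (rule ccontr)
    assume "\<not> 0 \<le> moment c D"
    then have neg: "moment c D < 0" by simp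
    obtain n where n: "K / - moment c D < real n" "0 < n"
      using reals_Archimedean2[of "max (K / - moment c D) 1"] by auto
    then have "K < real n * - moment c D"
      using neg pos_divide_less_eq[of "- moment c D" K "real n"] by linarith
    moreover have "- (K / real n) \<le> moment c D"
      using lower[of "n + d"] n by simp
    then have "- moment c D * real n \<le> K"
      using n by (simp add: field_simps)
    ultimately show False by (simp add: mult.commute)
  qed
qed

text \<open>Zeros in \<open>[-1, 1]\<close> can only be -1, 0 and 1. Dividing them out with
  multiplicity leaves a factor bounded away from 0 by compactness, and a sufficiently high power of
  \<open>x - x ^ 3\<close> is smaller than the product of the removed factors up to a
  constant.\<close>

lemma poly_lower_bound:
  fixes D :: "real poly"
  assumes pos: "\<And>x. -1 < x \<Longrightarrow> x < 1 \<Longrightarrow> x \<noteq> 0 \<Longrightarrow> 0 < poly D x"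
    and nonneg: "\<And>x. -1 \<le> x \<Longrightarrow> x \<le> 1 \<Longrightarrow> 0 \<le> poly D x"
  shows "\<exists>e>0. \<exists>k>0. \<forall>x. -1 \<le> x \<longrightarrow> x \<le> 1 \<longrightarrow> e * (x - x ^ 3) ^ (2 * k) \<le> poly D x"
proof -
  have "D \<noteq> 0"
    using pos[of "1/2"] by auto
  obtain A where A: "D = [:- 0, 1:] ^ order 0 D * A" "\<not> [:- 0, 1:] dvd A"
    using order_decomp[OF \<open>D \<noteq> 0\<close>, of 0] by auto
  then have "A \<noteq> 0" by auto
  obtain B where B: "A = [:- 1, 1:] ^ order 1 A * B" "\<not> [:- 1, 1:] dvd B"
    using order_decomp[OF \<open>A \<noteq> 0\<close>, of 1] by auto
  then have "B \<noteq> 0" by auto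
  obtain F where F: "B = [:- (- 1), 1:] ^ order (- 1) B * F" "\<not> [:- (- 1), 1:] dvd F"
    using order_decomp[OF \<open>B \<noteq> 0\<close>, of "- 1"] by auto
  define i j l where "i = order 0 D" and "j = order 1 A" and "l = order (- 1) B"
  have D_eq: "poly D x = x ^ i * (x - 1) ^ j * (x + 1) ^ l * poly F x" for x
    by (subst A(1), subst B(1), subst F(1)) (simp add: i_def j_def l_def poly_power mult_ac add.commute)
  have A_eq: "poly A x = (x - 1) ^ j * poly B x" for x
    by (subst B(1)) (simp add: j_def poly_power mult_ac)
  have B_eq: "poly B x = (x + 1) ^ l * poly F x" for x
    by (subst F(1)) (simp add: l_def poly_power mult_ac add.commute)
  have F_nz: "poly F x \<noteq> 0" if x: "-1 \<le> x" "x \<le> 1" for x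
  proof -
    consider "x = 0" | "x = 1" | "x = -1" | "-1 < x" "x < 1" "x \<noteq> 0"
      using x by linarith
    then show ?thesis
    proof cases
      case 1
      then show ?thesis
        using A(2) A_eq[of 0] B_eq[of 0] by (auto simp: poly_eq_0_iff_dvd[of A 0])
    next
      case 2
      then show ?thesis
        using B(2) B_eq[of 1] by (auto simp: poly_eq_0_iff_dvd[of B 1])
    next
      case 3
      then show ?thesis
        using F(2) by (auto simp: poly_eq_0_iff_dvd[of F "-1"])
    next
      case 4
      then show ?thesis
        using pos[of x] D_eq[of x] by auto
    qed
  qed
  have "continuous_on {-1..1::real} (\<lambda>x. \<bar>poly F x\<bar>)"
    by (intro continuous_intros)
  then obtain y where y: "y \<in> {-1..1}" "\<And>x. x \<in> {-1..1} \<Longrightarrow> \<bar>poly F y\<bar> \<le> \<bar>poly F x\<bar>"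
    using continuous_attains_inf[of "{-1..1::real}" "\<lambda>x. \<bar>poly F x\<bar>"] by force
  define m where "m = \<bar>poly F y\<bar>"
  have m: "0 < m"
    using F_nz y(1) by (auto simp: m_def)
  \<comment> \<open>Exceeds every multiplicity, and is positive even without zeros.\<close>
  define k where "k = i + j + l + 1"
  \<comment> \<open>The two factors \<open>2 ^ (2 * k)\<close> pay for
    \<open>\<bar>x - 1\<bar>\<close> and \<open>\<bar>x + 1\<bar>\<close>, which can be as large as
    2.\<close>
  define e where "e = m / (2 ^ (2 * k) * 2 ^ (2 * k))"
  have "e * (x - x ^ 3) ^ (2 * k) \<le> poly D x" if x: "-1 \<le> x" "x \<le> 1" for x
  proof -
    have 1: "\<bar>x\<bar> ^ (2 * k) \<le> \<bar>x\<bar> ^ i"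
      using x by (intro power_decreasing) (auto simp: k_def)
    have shrink: "z ^ (2 * k) \<le> 2 ^ (2 * k) * z ^ n" if "0 \<le> z" "z \<le> 2" "n \<le> k" for z :: real and n
    proof -
      have "z ^ (2 * k) = z ^ (2 * k - n) * z ^ n"
        using that by (simp add: power_add[symmetric])
      also have "\<dots> \<le> 2 ^ (2 * k - n) * z ^ n"
        using that by (intro mult_right_mono power_mono) auto
      also have "\<dots> \<le> 2 ^ (2 * k) * z ^ n"
        using that by (intro mult_right_mono power_increasing) auto
      finally show ?thesis .
    qed
    have 2: "\<bar>x - 1\<bar> ^ (2 * k) \<le> 2 ^ (2 * k) * \<bar>x - 1\<bar> ^ j"
      using x by (intro shrink) (auto simp: k_def)
    have 3: "\<bar>x + 1\<bar> ^ (2 * k) \<le> 2 ^ (2 * k) * \<bar>x + 1\<bar> ^ l"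
      using x by (intro shrink) (auto simp: k_def)
    have "x - x ^ 3 = - (x * (x - 1) * (x + 1))"
      by (simp add: power3_eq_cube algebra_simps)
    then have "(x - x ^ 3) ^ (2 * k) = (x * (x - 1) * (x + 1)) ^ (2 * k)"
      by simp
    also have "\<dots> = \<bar>x\<bar> ^ (2 * k) * \<bar>x - 1\<bar> ^ (2 * k) * \<bar>x + 1\<bar> ^ (2 * k)"
      by (simp add: power_mult_distrib power_even_abs)
    also have "\<dots> \<le> \<bar>x\<bar> ^ i * (2 ^ (2 * k) * \<bar>x - 1\<bar> ^ j) * (2 ^ (2 * k) * \<bar>x + 1\<bar> ^ l)"
      using 1 2 3 by (intro mult_mono) auto
    finally have "e * (x - x ^ 3) ^ (2 * k)
        \<le> e * (\<bar>x\<bar> ^ i * (2 ^ (2 * k) * \<bar>x - 1\<bar> ^ j) * (2 ^ (2 * k) * \<bar>x + 1\<bar> ^ l))"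
      using m by (intro mult_left_mono) (auto simp: e_def)
    also have "\<dots> = \<bar>x\<bar> ^ i * \<bar>x - 1\<bar> ^ j * \<bar>x + 1\<bar> ^ l * m"
      by (simp add: e_def field_simps)
    also have "\<dots> \<le> \<bar>x\<bar> ^ i * \<bar>x - 1\<bar> ^ j * \<bar>x + 1\<bar> ^ l * \<bar>poly F x\<bar>"
      using y(2)[of x] x by (intro mult_left_mono) (auto simp: m_def)
    also have "\<dots> = \<bar>poly D x\<bar>"
      by (simp add: D_eq abs_mult power_abs)
    finally show ?thesis
      using nonneg[OF x] by simp
  qed
  moreover have "0 < e" "0 < k"
    using m by (auto simp: e_def k_def)
  ultimately show ?thesis by blast
qed

text \<open>A Cauchy-Schwarz argument for \<open>h ^ (k + 1)\<close> and \<open>h ^ (k - 1)\<close>: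
  if the square of the former has no positive moment, neither has their product
  \<open>h ^ (2 * k)\<close>, and the exponent descends to 2.\<close>

lemma moment_square_descent:
  assumes "interval_moments c" "0 < k" "moment c (h ^ (2 * k)) \<le> 0"
  shows "moment c (h * h) = 0"
  using assms(2,3)
proof (induction k rule: nat_induct_non_zero)
  case 1
  then show ?case
    using assms(1) by (auto simp: interval_moments_def power2_eq_square intro: antisym)
next
  case (Suc k)
  obtain k' where k: "k = Suc k'"
    using Suc.hyps by (cases k) auto
  let ?p = "h ^ Suc k" and ?q = "h ^ k'"
  have pp: "moment c (?p * ?p) \<le> 0"
    using Suc.prems by (simp add: power_add[symmetric] mult_2[symmetric] del: power_Suc)
  have "0 \<le> moment c (?q * ?q) + 2 * s * moment c (?p * ?q)" for s
  proof -
    have "0 \<le> moment c ((?q + smult s ?p) * (?q + smult s ?p))"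
      using assms(1) by (auto simp: interval_moments_def)
    also have "(?q + smult s ?p) * (?q + smult s ?p)
        = ?q * ?q + (smult s (?p * ?q) + smult s (?p * ?q)) + smult (s * s) (?p * ?p)"
      by (simp add: algebra_simps del: power_Suc)
    finally have "0 \<le> moment c (?q * ?q) + (s * moment c (?p * ?q) + s * moment c (?p * ?q))
        + s * s * moment c (?p * ?p)"
      by (simp only: moment_add moment_smult)
    moreover have "s * s * moment c (?p * ?p) \<le> 0"
      using pp by (intro mult_nonneg_nonpos) auto
    ultimately show ?thesis by linarith
  qed
  note key = this
  have "moment c (?p * ?q) \<le> 0"
  proof (rule ccontr)
    assume "\<not> moment c (?p * ?q) \<le> 0"
    define Q m where "Q = moment c (?q * ?q)" and "m = moment c (?p * ?q)"
    have "0 < m" "0 \<le> Q"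
      using \<open>\<not> _\<close> assms(1) by (auto simp: m_def Q_def interval_moments_def)
    \<comment> \<open>The multiplier is chosen to make the right-hand side -1.\<close>
    have "0 \<le> Q + 2 * (- (Q + 1) / (2 * m)) * m"
      unfolding Q_def m_def by (rule key)
    then show False
      using \<open>0 < m\<close> by (simp add: field_simps)
  qed
  moreover have "?p * ?q = h ^ (2 * k)"
    unfolding power_add[symmetric] by (simp add: k mult_2)
  ultimately show ?case
    using Suc.IH by simp
qed

text \<open>\<open>D\<close> dominates a multiple of an even power of \<open>x - x ^ 3\<close>; by
  descent, a nonpositive moment of that power would make the moment in \<open>h\<close>
  vanish.\<close>

lemma moment_pos:
  assumes c: "interval_moments c"
    and pos: "\<And>x. -1 < x \<Longrightarrow> x < 1 \<Longrightarrow> x \<noteq> 0 \<Longrightarrow> 0 < poly D x"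
    and nonneg: "\<And>x. -1 \<le> x \<Longrightarrow> x \<le> 1 \<Longrightarrow> 0 \<le> poly D x"
    and h: "moment c ([:0, 1, 0, -1:] * [:0, 1, 0, -1:]) \<noteq> 0"
  shows "0 < moment c D"
proof -
  let ?h = "[:0, 1, 0, -1:] :: real poly"
  obtain e k where e: "0 < e" "0 < k" "\<And>x. -1 \<le> x \<Longrightarrow> x \<le> 1 \<Longrightarrow> e * (x - x ^ 3) ^ (2 * k) \<le> poly D x"
    using poly_lower_bound[OF pos nonneg] by blast
  have "poly ?h x = x - x ^ 3" for x
    by (simp add: power3_eq_cube algebra_simps)
  then have "0 \<le> moment c (D - smult e (?h ^ (2 * k)))"
    using e by (intro moment_nonneg[OF c]) (simp add: poly_power)
  then have "e * moment c (?h ^ (2 * k)) \<le> moment c D"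
    by (simp only: moment_diff moment_smult)
  moreover have "0 < moment c (?h ^ (2 * k))"
    using moment_square_descent[OF c e(2), of ?h] h by linarith
  ultimately show ?thesis
    using e(1) by (meson less_le_trans mult_pos_pos)
qed

section \<open>Branching Markov processes\<close>

text \<open>Reduced to the nonnegative integrals of the positive and negative parts. These are
  finite for almost every inner measure only, so the two outer integrands are compared up to a null
  set.\<close>

lemma integral_bind_integrable:
  fixes f :: "'b \<Rightarrow> real"
  assumes K: "K \<in> M \<rightarrow>\<^sub>M subprob_algebra N" and ne: "space M \<noteq> {}"
    and int: "integrable (M \<bind> K) f"
  shows "(\<integral>x. f x \<partial>(M \<bind> K)) = (\<integral>x. \<integral>y. f y \<partial>K x \<partial>M)"
proof -
  have sets: "sets (M \<bind> K) = sets N"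
    by (rule sets_bind_measurable[OF K ne])
  have f[measurable]: "f \<in> borel_measurable N"
    using int sets by (metis borel_measurable_integrable measurable_cong_sets)
  have setsK: "sets (K x) = sets N" if "x \<in> space M" for x
    using K that by (rule sets_kernel)
  define P where "P x = (\<integral>\<^sup>+y. ennreal (f y) \<partial>K x)" for x
  define R where "R x = (\<integral>\<^sup>+y. ennreal (- f y) \<partial>K x)" for x
  have meas: "P \<in> borel_measurable M" "R \<in> borel_measurable M"
    unfolding P_def R_def
    by (rule measurable_compose[OF K nn_integral_measurable_subprob_algebra]; simp)+
  have P: "(\<integral>\<^sup>+x. ennreal (f x) \<partial>(M \<bind> K)) = (\<integral>\<^sup>+x. P x \<partial>M)"
    unfolding P_def by (rule nn_integral_bind[OF _ K]) simp
  have R: "(\<integral>\<^sup>+x. ennreal (- f x) \<partial>(M \<bind> K)) = (\<integral>\<^sup>+x. R x \<partial>M)"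
    unfolding R_def by (rule nn_integral_bind[OF _ K]) simp
  have fin: "(\<integral>\<^sup>+x. P x \<partial>M) \<noteq> \<infinity>" "(\<integral>\<^sup>+x. R x \<partial>M) \<noteq> \<infinity>"
    using int unfolding P[symmetric] R[symmetric] real_integrable_def by auto
  then have ae: "AE x in M. P x \<noteq> \<infinity>" "AE x in M. R x \<noteq> \<infinity>"
    using nn_integral_noteq_infinite meas by auto
  have inner: "AE x in M. (\<integral>y. f y \<partial>K x) = enn2real (P x) - enn2real (R x)"
    using ae AE_space
  proof eventually_elim
    case (elim x)
    then have "integrable (K x) f"
      using f setsK[of x] by (auto simp: real_integrable_def P_def R_def cong: measurable_cong_sets)
    then show ?case
      by (simp add: real_lebesgue_integral_def P_def R_def)
  qed
  have lift: "integrable M (\<lambda>x. enn2real (F x))" "(\<integral>x. enn2real (F x) \<partial>M) = enn2real (\<integral>\<^sup>+x. F x \<partial>M)"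
    if F: "F \<in> borel_measurable M" "(\<integral>\<^sup>+x. F x \<partial>M) \<noteq> \<infinity>" for F
  proof -
    have eq: "(\<integral>\<^sup>+x. ennreal (enn2real (F x)) \<partial>M) = (\<integral>\<^sup>+x. F x \<partial>M)"
      using nn_integral_noteq_infinite[OF F]
      by (intro nn_integral_cong_AE) (auto simp: top.not_eq_extremum elim: eventually_mono)
    show "integrable M (\<lambda>x. enn2real (F x))"
      using F eq by (intro integrableI_nonneg) (auto simp: top.not_eq_extremum)
    show "(\<integral>x. enn2real (F x) \<partial>M) = enn2real (\<integral>\<^sup>+x. F x \<partial>M)"
      using F(1) by (subst integral_eq_nn_integral) (auto simp: eq)
  qed
  have "(\<integral>x. \<integral>y. f y \<partial>K x \<partial>M) = (\<integral>x. enn2real (P x) - enn2real (R x) \<partial>M)"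
  proof (rule integral_cong_AE[OF _ _ inner])
    show "(\<lambda>x. \<integral>y. f y \<partial>K x) \<in> borel_measurable M"
      by (rule measurable_compose[OF K integral_measurable_subprob_algebra]) simp
  qed (use meas in measurable)
  also have "\<dots> = (\<integral>x. f x \<partial>(M \<bind> K))"
    using lift[OF meas(1) fin(1)] lift[OF meas(2) fin(2)] int
    by (simp add: real_lebesgue_integral_def P R)
  finally show ?thesis ..
qed

section \<open>Laws of the process along ancestors\<close>

lemma length_butlast_less: "u \<noteq> [] \<Longrightarrow> length (butlast u) < length u"
  by simp

lemma rooted_at_prefixes: "rooted_at [] (set (prefixes u))"
  unfolding rooted_at_def using prefix_order.trans[OF prefixeq_butlast] by auto

lemma rooted_at_Un: "rooted_at r A \<Longrightarrow> rooted_at r B \<Longrightarrow> rooted_at r (A \<union> B)"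
  by (auto simp: rooted_at_def)

lemma prefixes_UHN: "u \<in> UHN \<Longrightarrow> set (prefixes u) \<subseteq> UHN"
  using set_mono_prefix by (fastforce simp: UHN_def)

locale branching_process =
  fixes Q :: "'a::metric_space \<Rightarrow> 'a measure" and \<mu> :: "'a measure"
    and M :: "'w measure" and X :: "nat list \<Rightarrow> 'w \<Rightarrow> 'a"
  assumes kernel: "markov_kernel Q"
    and invariant: "invariant_measure Q \<mu>"
    and process: "branching_markov_process M X Q \<mu>"
begin

abbreviation states :: "nat list set \<Rightarrow> (nat list \<Rightarrow> 'a) measure" where
  "states T \<equiv> Pi\<^sub>M T (\<lambda>_. borel)"

lemma Q_measurable [measurable]: "Q \<in> borel \<rightarrow>\<^sub>M prob_algebra borel"
  using kernel by (simp add: markov_kernel_def)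

lemma prob_space_Q: "prob_space (Q x)" and sets_Q [simp, measurable_cong]: "sets (Q x) = sets borel"
  using measurable_space[OF Q_measurable, of x] by (simp_all add: space_prob_algebra)

lemma space_Q [simp]: "space (Q x) = UNIV"
  using sets_eq_imp_space_eq[OF sets_Q] by simp

lemma sets_mu [simp, measurable_cong]: "sets \<mu> = sets borel"
  and prob_space_mu: "prob_space \<mu>"
  and bind_mu: "\<mu> \<bind> Q = \<mu>"
  using invariant by (auto simp: invariant_measure_def borel_prob_def)

lemma space_mu [simp]: "space \<mu> = UNIV"
  using sets_eq_imp_space_eq[OF sets_mu] by simp

lemma prob_space_M: "prob_space M"
  and X_measurable [measurable]: "u \<in> UHN \<Longrightarrow> X u \<in> M \<rightarrow>\<^sub>M borel"
  using process by (auto simp: branching_markov_process_def)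

text \<open>One drawing of \<open>draw_vertices\<close> as a kernel on whole configurations over a
  fixed \<open>T\<close>: the index \<open>v\<close> is already there and only its value is
  replaced.\<close>

definition step :: "nat list set \<Rightarrow> nat list \<Rightarrow> (nat list \<Rightarrow> 'a) \<Rightarrow> (nat list \<Rightarrow> 'a) measure" where
  "step T v x = distr (Q (x (butlast v))) (states T) (\<lambda>z. x(v := z))"

lemma upd_measurable: "v \<in> T \<Longrightarrow> (\<lambda>(x, z). x(v := z)) \<in> states T \<Otimes>\<^sub>M borel \<rightarrow>\<^sub>M states T"
  using measurable_add_dim[of v T "\<lambda>_. borel :: 'a measure"] by (simp add: insert_absorb)

lemma upd_measurable_at:
  assumes "v \<in> T" "x \<in> space (states T)"
  shows "(\<lambda>z. x(v := z)) \<in> borel \<rightarrow>\<^sub>M states T"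
  using measurable_compose[OF measurable_Pair1'[OF assms(2)] upd_measurable[OF assms(1)]] by simp

lemma upd_space: "v \<in> T \<Longrightarrow> x \<in> space (states T) \<Longrightarrow> x(v := z) \<in> space (states T)"
  using measurable_space[OF upd_measurable_at] by simp

lemma Q_component_measurable:
  "butlast v \<in> T \<Longrightarrow> (\<lambda>x. Q (x (butlast v))) \<in> states T \<rightarrow>\<^sub>M prob_algebra borel"
  using measurable_compose[OF measurable_component_singleton[of "butlast v" T "\<lambda>_. borel"] Q_measurable] .

lemma step_measurable:
  assumes "v \<in> T" "butlast v \<in> T"
  shows "step T v \<in> states T \<rightarrow>\<^sub>M prob_algebra (states T)"
  unfolding step_def[abs_def]
  by (rule measurable_distr_prob_space2[OF Q_component_measurable[OF assms(2)] upd_measurable[OF assms(1)]])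

lemma draw_measurable:
  assumes "\<forall>u\<in>set us. u \<in> T \<and> butlast u \<in> T"
  shows "draw_vertices Q T us \<in> states T \<rightarrow>\<^sub>M prob_algebra (states T)"
  using assms
proof (induction us)
  case Nil
  have "draw_vertices Q T [] = return (states T)"
    by (simp add: fun_eq_iff)
  then show ?case
    using measurable_return_prob_space by metis
next
  case (Cons u us)
  have "(\<lambda>(x, z). draw_vertices Q T us (x(u := z))) \<in> states T \<Otimes>\<^sub>M borel \<rightarrow>\<^sub>M prob_algebra (states T)"
  proof -
    have "(\<lambda>p. draw_vertices Q T us ((\<lambda>(x, z). x(u := z)) p))
        \<in> states T \<Otimes>\<^sub>M borel \<rightarrow>\<^sub>M prob_algebra (states T)"
      by (rule measurable_compose[OF upd_measurable Cons.IH]) (use Cons.prems in auto)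
    moreover have "(\<lambda>p. draw_vertices Q T us ((\<lambda>(x, z). x(u := z)) p))
        = (\<lambda>(x, z). draw_vertices Q T us (x(u := z)))"
      by (rule ext) (simp only: split_paired_all prod.case split: prod.split)
    ultimately show ?thesis by (simp only:)
  qed
  then have "(\<lambda>x. Q (x (butlast u)) \<bind> (\<lambda>z. draw_vertices Q T us (x(u := z))))
      \<in> states T \<rightarrow>\<^sub>M prob_algebra (states T)"
    using Cons.prems by (intro measurable_bind_prob_space2[OF Q_component_measurable]) auto
  moreover have "draw_vertices Q T (u # us) = (\<lambda>x. Q (x (butlast u)) \<bind> (\<lambda>z. draw_vertices Q T us (x(u := z))))"
    by (simp add: fun_eq_iff)
  ultimately show ?case by metis
qed

text \<open>The recursion of \<open>draw_vertices\<close> peels off the first vertex, whereas the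
  Markov property needs the last one.\<close>

lemma draw_snoc:
  assumes "\<forall>u\<in>set us. u \<in> T \<and> butlast u \<in> T" "v \<in> T" "butlast v \<in> T" "x \<in> space (states T)"
  shows "draw_vertices Q T (us @ [v]) x = draw_vertices Q T us x \<bind> step T v"
  using assms(1,4)
proof (induction us arbitrary: x)
  case Nil
  have "(\<lambda>z. x(v := z)) \<in> Q (x (butlast v)) \<rightarrow>\<^sub>M states T"
    using upd_measurable_at[OF assms(2) Nil(2)] by (simp cong: measurable_cong_sets)
  then have "draw_vertices Q T [v] x = step T v x"
    by (simp add: step_def bind_return_distr')
  also have "\<dots> = return (states T) x \<bind> step T v"
    by (rule bind_return[OF measurable_prob_algebraD[OF step_measurable], symmetric]) (use assms Nil in auto)
  finally show ?case by simp
next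
  case (Cons u us)
  have "(\<lambda>z. x(u := z)) \<in> Q (x (butlast u)) \<rightarrow>\<^sub>M states T"
    using upd_measurable_at[of u T x] Cons.prems by (simp cong: measurable_cong_sets)
  then have *: "(\<lambda>z. draw_vertices Q T us (x(u := z))) \<in> Q (x (butlast u)) \<rightarrow>\<^sub>M subprob_algebra (states T)"
    using measurable_compose[OF _ measurable_prob_algebraD[OF draw_measurable]] Cons.prems by auto
  have "draw_vertices Q T ((u # us) @ [v]) x
      = Q (x (butlast u)) \<bind> (\<lambda>z. draw_vertices Q T us (x(u := z)) \<bind> step T v)"
    using Cons upd_space by (auto intro!: bind_cong)
  also have "\<dots> = draw_vertices Q T (u # us) x \<bind> step T v"
    using bind_assoc[OF * measurable_prob_algebraD[OF step_measurable]] assms by simp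
  finally show ?case .
qed

lemma init_measurable:
  assumes "[] \<in> T"
  shows "(\<lambda>y. (\<lambda>_. undefined)([] := y)) \<in> \<mu> \<rightarrow>\<^sub>M states T"
proof -
  have "(\<lambda>y :: 'a. (\<lambda>_. undefined)([] :: nat list := y)) = (\<lambda>y i. if i = [] then y else undefined)"
    by (auto simp: fun_eq_iff)
  moreover have "(\<lambda>y i. if i = [] then y else undefined) \<in> \<mu> \<rightarrow>\<^sub>M states T"
  proof (rule measurable_PiM_single')
    show "(\<lambda>y. if i = [] then y else undefined) \<in> \<mu> \<rightarrow>\<^sub>M borel" for i :: "nat list"
      by (cases "i = []") (auto cong: measurable_cong_sets)
  qed (use assms in auto)
  ultimately show ?thesis by (simp only:)
qed

lemma tree_law_snoc:
  assumes "\<forall>u\<in>set us. u \<in> T \<and> butlast u \<in> T" "v \<in> T" "butlast v \<in> T" "[] \<in> T"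
  shows "tree_law Q \<mu> T (us @ [v]) = tree_law Q \<mu> T us \<bind> step T v"
    and "tree_law Q \<mu> T us \<in> space (prob_algebra (states T))"
proof -
  have sub: "(\<lambda>y. draw_vertices Q T us ((\<lambda>_. undefined)([] := y))) \<in> \<mu> \<rightarrow>\<^sub>M prob_algebra (states T)"
    by (rule measurable_compose[OF init_measurable draw_measurable]) (use assms in auto)
  have "tree_law Q \<mu> T (us @ [v]) = \<mu> \<bind> (\<lambda>y. draw_vertices Q T us ((\<lambda>_. undefined)([] := y)) \<bind> step T v)"
    unfolding tree_law_def
    by (intro bind_cong refl draw_snoc) (use assms measurable_space[OF init_measurable] in auto)
  also have "\<dots> = tree_law Q \<mu> T us \<bind> step T v"
    unfolding tree_law_def
    using bind_assoc[OF measurable_prob_algebraD[OF sub] measurable_prob_algebraD[OF step_measurable]] assms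
    by simp
  finally show "tree_law Q \<mu> T (us @ [v]) = tree_law Q \<mu> T us \<bind> step T v" .
  have "\<mu> \<in> space (prob_algebra \<mu>)"
    using prob_space_mu by (simp add: space_prob_algebra)
  then show "tree_law Q \<mu> T us \<in> space (prob_algebra (states T))"
    unfolding tree_law_def using prob_space_bind'[OF _ sub] sets_bind'[OF _ sub]
    by (simp add: space_prob_algebra)
qed

abbreviation joint :: "nat list set \<Rightarrow> 'w \<Rightarrow> nat list \<Rightarrow> 'a" where
  "joint T \<omega> \<equiv> (\<lambda>u\<in>T. X u \<omega>)"

lemma joint_measurable: "T \<subseteq> UHN \<Longrightarrow> joint T \<in> M \<rightarrow>\<^sub>M states T"
  by (intro measurable_restrict) auto

text \<open>A vertex without children in \<open>T\<close> can be drawn last; sorting the others by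
  length puts parents first. This isolates the transition into \<open>v\<close>.\<close>

lemma joint_law_last:
  assumes T: "rooted_at [] T" "T \<subseteq> UHN" and v: "v \<in> T" "v \<noteq> []"
    and last: "\<And>w. w \<in> T \<Longrightarrow> w \<noteq> [] \<Longrightarrow> butlast w \<noteq> v"
  obtains \<nu> where "\<nu> \<in> space (prob_algebra (states T))"
    "distr M (states T) (joint T) = \<nu> \<bind> step T v"
proof -
  have T': "finite T" "[] \<in> T" "\<And>u. u \<in> T \<Longrightarrow> u \<noteq> [] \<Longrightarrow> butlast u \<in> T"
    using T(1) by (auto simp: rooted_at_def)
  obtain xs where xs: "set xs = T - {[], v}" "distinct xs"
    using finite_distinct_list[of "T - {[], v}"] T'(1) by auto
  define us where "us = sort_key length xs"
  have us: "set us = T - {[], v}" "distinct us" "sorted (map length us)"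
    using xs by (auto simp: us_def)
  have "parent_first_enum T (us @ [v])"
    unfolding parent_first_enum_def
  proof (intro conjI allI impI)
    show "distinct (us @ [v])" "set (us @ [v]) = T - {[]}"
      using us(1,2) v by auto
    fix i assume i: "i < length (us @ [v])"
    let ?u = "(us @ [v]) ! i"
    have u: "?u \<in> T" "?u \<noteq> []"
    proof -
      have "?u \<in> set (us @ [v])"
        using i by (rule nth_mem)
      also have "set (us @ [v]) = T - {[]}"
        using us(1) v by auto
      finally show "?u \<in> T" "?u \<noteq> []"
        by blast+
    qed
    show "butlast ?u \<in> insert [] (set (take i (us @ [v])))"
    proof (cases "butlast ?u = []")
      case False
      then have "butlast ?u \<in> set us"
        unfolding us(1) using T'(3)[OF u] last[OF u] by blast
      then obtain j where j: "j < length us" "us ! j = butlast ?u"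
        by (auto simp: in_set_conv_nth)
      have "j < i"
      proof (rule ccontr)
        assume "\<not> j < i"
        then have "i \<le> j" "i < length us"
          using j by auto
        then have "length (us ! i) \<le> length (us ! j)"
          using sorted_nth_mono[OF us(3), of i j] j(1) by simp
        moreover have "?u = us ! i"
          using \<open>i < length us\<close> by (simp add: nth_append)
        ultimately show False
          using j(2) length_butlast_less[OF u(2)] by (simp del: length_butlast)
      qed
      then have "butlast ?u = take i (us @ [v]) ! j" "j < length (take i (us @ [v]))"
        using j i by (simp_all add: nth_append)
      then show ?thesis
        by (metis insertI2 nth_mem)
    qed simp
  qed
  moreover have "subtree T"
    using rooted_at_imp_subtree[OF T] .
  ultimately have "distr M (states T) (joint T) = tree_law Q \<mu> T (us @ [v])"
    using process T' by (auto simp: branching_markov_process_def)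
  also have "\<dots> = tree_law Q \<mu> T us \<bind> step T v"
    using us T' v by (intro tree_law_snoc(1)) auto
  finally show ?thesis
    using that tree_law_snoc(2)[of us T v] us T' v by auto
qed

lemma law_step:
  assumes "v \<in> UHN" "v \<noteq> []" and h[measurable]: "h \<in> borel_measurable borel"
  shows "(\<integral>\<^sup>+\<omega>. h (X v \<omega>) \<partial>M) = (\<integral>\<^sup>+\<omega>. (\<integral>\<^sup>+z. h z \<partial>Q (X (butlast v) \<omega>)) \<partial>M)"
proof -
  let ?T = "set (prefixes v)" and ?p = "butlast v"
  have T: "rooted_at [] ?T" "?T \<subseteq> UHN" "v \<in> ?T" "?p \<in> ?T"
    using rooted_at_prefixes prefixes_UHN[OF assms(1)] by (auto simp: prefixeq_butlast)
  have last: "butlast w \<noteq> v" if "w \<in> ?T" "w \<noteq> []" for w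
    using that length_butlast_less[OF that(2)] by (auto dest!: prefix_length_le simp del: length_butlast)
  obtain \<nu> where \<nu>: "\<nu> \<in> space (prob_algebra (states ?T))"
    and joint: "distr M (states ?T) (joint ?T) = \<nu> \<bind> step ?T v"
    using joint_law_last[OF T(1-3) assms(2) last] by blast
  have sets_\<nu>: "sets \<nu> = sets (states ?T)"
    using \<nu> by (simp add: space_prob_algebra)
  have formula: "(\<integral>\<^sup>+\<omega>. G (joint ?T \<omega>) \<partial>M) = (\<integral>\<^sup>+y. (\<integral>\<^sup>+z. G (y(v := z)) \<partial>Q (y ?p)) \<partial>\<nu>)"
    if G: "G \<in> borel_measurable (states ?T)" for G
  proof -
    have "(\<integral>\<^sup>+\<omega>. G (joint ?T \<omega>) \<partial>M) = (\<integral>\<^sup>+x. G x \<partial>(\<nu> \<bind> step ?T v))"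
      unfolding joint[symmetric] using G by (intro nn_integral_distr[symmetric] joint_measurable[OF T(2)]) simp
    also have "\<dots> = (\<integral>\<^sup>+y. (\<integral>\<^sup>+x. G x \<partial>step ?T v y) \<partial>\<nu>)"
      using measurable_prob_algebraD[OF step_measurable[OF T(3,4)]] sets_\<nu>
      by (intro nn_integral_bind[OF G]) (simp cong: measurable_cong_sets)
    also have "\<dots> = (\<integral>\<^sup>+y. (\<integral>\<^sup>+z. G (y(v := z)) \<partial>Q (y ?p)) \<partial>\<nu>)"
    proof (intro nn_integral_cong)
      fix y assume "y \<in> space \<nu>"
      then have "y \<in> space (states ?T)"
        using sets_eq_imp_space_eq[OF sets_\<nu>] by simp
      then have "(\<lambda>z. y(v := z)) \<in> Q (y ?p) \<rightarrow>\<^sub>M states ?T"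
        using upd_measurable_at[OF T(3)] by (simp cong: measurable_cong_sets)
      then show "(\<integral>\<^sup>+x. G x \<partial>step ?T v y) = (\<integral>\<^sup>+z. G (y(v := z)) \<partial>Q (y ?p))"
        unfolding step_def using G by (intro nn_integral_distr) auto
    qed
    finally show ?thesis .
  qed
  have coord: "(\<lambda>x. x w) \<in> states ?T \<rightarrow>\<^sub>M borel" if "w \<in> ?T" for w
    using measurable_component_singleton[OF that, of "\<lambda>_. borel"] .
  have k: "(\<lambda>x. \<integral>\<^sup>+z. h z \<partial>Q x) \<in> borel_measurable borel"
    by (rule measurable_compose[OF measurable_prob_algebraD[OF Q_measurable]
          nn_integral_measurable_subprob_algebra[OF h]])
  have ne: "?p \<noteq> v"
    using last[of v] T(3) assms(2) by blast
  have "(\<integral>\<^sup>+\<omega>. h (X v \<omega>) \<partial>M) = (\<integral>\<^sup>+y. (\<integral>\<^sup>+z. h z \<partial>Q (y ?p)) \<partial>\<nu>)"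
    using formula[OF measurable_compose[OF coord[OF T(3)] h]] T(3) by simp
  \<comment> \<open>As \<open>Q (y ?p)\<close> has mass 1, a dummy integral over \<open>z\<close>
    can be inserted; in this form \<open>formula\<close> applies backwards to a function of the
    parent's value.\<close>
  also have "\<dots> = (\<integral>\<^sup>+y. (\<integral>\<^sup>+z. (\<integral>\<^sup>+z'. h z' \<partial>Q (y ?p)) \<partial>Q (y ?p)) \<partial>\<nu>)"
    using prob_space.emeasure_space_1[OF prob_space_Q] by simp
  also have "\<dots> = (\<integral>\<^sup>+\<omega>. (\<integral>\<^sup>+z. h z \<partial>Q (X ?p \<omega>)) \<partial>M)"
    using formula[OF measurable_compose[OF coord[OF T(4)] k]] T(4) ne by simp
  finally show ?thesis .
qed

lemma law_root: "distr M borel (X []) = \<mu>"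
proof -
  let ?T = "{[]} :: nat list set" and ?init = "\<lambda>y. (\<lambda>_. undefined)([] :: nat list := y)"
  have "rooted_at [] ?T" "?T \<subseteq> UHN"
    by (auto simp: rooted_at_def UHN_def)
  then have "subtree ?T"
    by (rule rooted_at_imp_subtree)
  moreover have "parent_first_enum ?T []"
    by (simp add: parent_first_enum_def)
  ultimately have law: "distr M (states ?T) (joint ?T) = tree_law Q \<mu> ?T []"
    using process unfolding branching_markov_process_def by blast
  have "tree_law Q \<mu> ?T [] = distr \<mu> (states ?T) ?init"
    unfolding tree_law_def using init_measurable[of ?T] by (simp add: bind_return_distr')
  then have eq: "distr M (states ?T) (joint ?T) = distr \<mu> (states ?T) ?init"
    using law by simp
  have coord: "(\<lambda>x. x []) \<in> states ?T \<rightarrow>\<^sub>M borel"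
    using measurable_component_singleton[of "[]" ?T "\<lambda>_. borel"] by simp
  have "distr M borel (X []) = distr (distr M (states ?T) (joint ?T)) borel (\<lambda>x. x [])"
    using joint_measurable[OF \<open>?T \<subseteq> UHN\<close>] by (subst distr_distr[OF coord]) (auto simp: comp_def)
  also have "\<dots> = distr \<mu> borel (\<lambda>y. y)"
    unfolding eq using init_measurable[of ?T] by (subst distr_distr[OF coord]) (auto simp: comp_def)
  also have "\<dots> = \<mu>"
    by (rule distr_id2) simp
  finally show ?thesis .
qed

lemma law: "u \<in> UHN \<Longrightarrow> distr M borel (X u) = \<mu>"
proof (induction u rule: rev_induct)
  case Nil
  then show ?case by (simp add: law_root)
next
  case (snoc x u)
  then have u: "u \<in> UHN"
    by (simp add: UHN_def)
  note [measurable] = X_measurable[OF snoc.prems] X_measurable[OF u]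
  show ?case
  proof (rule measure_eqI)
    fix A assume "A \<in> sets (distr M borel (X (u @ [x])))"
    then have A[measurable]: "A \<in> sets borel" by simp
    have Qm: "Q \<in> \<mu> \<rightarrow>\<^sub>M subprob_algebra borel"
      using measurable_prob_algebraD[OF Q_measurable] by (simp cong: measurable_cong_sets)
    have QA: "(\<lambda>x. emeasure (Q x) A) \<in> borel_measurable borel"
      using measurable_emeasure_kernel[OF measurable_prob_algebraD[OF Q_measurable] A] .
    have "emeasure (distr M borel (X (u @ [x]))) A = (\<integral>\<^sup>+\<omega>. indicator A (X (u @ [x]) \<omega>) \<partial>M)"
    proof -
      have "emeasure (distr M borel (X (u @ [x]))) A = (\<integral>\<^sup>+y. indicator A y \<partial>distr M borel (X (u @ [x])))"
        by (rule nn_integral_indicator[symmetric]) simp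
      also have "\<dots> = (\<integral>\<^sup>+\<omega>. indicator A (X (u @ [x]) \<omega>) \<partial>M)"
        by (rule nn_integral_distr) simp_all
      finally show ?thesis .
    qed
    also have "\<dots> = (\<integral>\<^sup>+\<omega>. emeasure (Q (X u \<omega>)) A \<partial>M)"
      using snoc.prems by (subst law_step) simp_all
    also have "\<dots> = (\<integral>\<^sup>+y. emeasure (Q y) A \<partial>\<mu>)"
      unfolding snoc.IH[OF u, symmetric] using QA by (simp add: nn_integral_distr)
    also have "\<dots> = emeasure (\<mu> \<bind> Q) A"
      using emeasure_bind[OF _ Qm A] by simp
    finally show "emeasure (distr M borel (X (u @ [x]))) A = emeasure \<mu> A"
      by (simp add: bind_mu)
  qed simp
qed

lemma law_integral:
  fixes h :: "'a \<Rightarrow> real"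
  assumes "u \<in> UHN" "h \<in> borel_measurable borel"
  shows "(\<integral>\<omega>. h (X u \<omega>) \<partial>M) = (\<integral>x. h x \<partial>\<mu>)" and "integrable M (\<lambda>\<omega>. h (X u \<omega>)) \<longleftrightarrow> integrable \<mu> h"
  using assms unfolding law[OF assms(1), symmetric]
  by (simp_all add: integral_distr integrable_distr_eq)

lemma L2_borel: "h \<in> L2 \<mu> \<Longrightarrow> h \<in> borel_measurable borel"
  by (auto simp: L2_def cong: measurable_cong_sets)

lemma L2_process:
  assumes "u \<in> UHN" "h \<in> L2 \<mu>"
  shows "(\<lambda>\<omega>. h (X u \<omega>)) \<in> L2 M"
proof -
  note [measurable] = L2_borel[OF assms(2)] X_measurable[OF assms(1)]
  have "(\<lambda>\<omega>. h (X u \<omega>)) \<in> borel_measurable M"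
    by measurable
  moreover have "integrable M (\<lambda>\<omega>. (h (X u \<omega>))\<^sup>2)"
    using law_integral(2)[OF assms(1), of "\<lambda>x. (h x)\<^sup>2"] assms(2) by (auto simp: L2_def)
  ultimately show ?thesis
    by (simp add: L2_def)
qed

text \<open>Among the ancestors of \<open>u\<close> and \<open>v\<close> nothing lies below
  \<open>v\<close>, because \<open>v\<close> is not an ancestor of \<open>u\<close>; so
  \<open>v\<close> can be drawn last and its value integrated out.\<close>

lemma markov_property:
  assumes u: "u \<in> UHN" and v: "v \<in> UHN" "v \<noteq> []" "\<not> prefix v u"
    and F: "F \<in> L2 \<mu>" and g: "g \<in> L2 \<mu>" and Qg: "kernel_op Q g \<in> L2 \<mu>"
  shows "(\<integral>\<omega>. F (X u \<omega>) * g (X v \<omega>) \<partial>M) = (\<integral>\<omega>. F (X u \<omega>) * kernel_op Q g (X (butlast v) \<omega>) \<partial>M)"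
proof -
  let ?T = "set (prefixes u) \<union> set (prefixes v)" and ?p = "butlast v"
  have T: "rooted_at [] ?T" "?T \<subseteq> UHN" "v \<in> ?T" "?p \<in> ?T" "u \<in> ?T"
    using rooted_at_Un[OF rooted_at_prefixes rooted_at_prefixes] prefixes_UHN[OF u] prefixes_UHN[OF v(1)]
    by (simp_all add: prefixeq_butlast)
  have last: "butlast w \<noteq> v" if w: "w \<in> ?T" "w \<noteq> []" for w
  proof
    assume bw: "butlast w = v"
    then have "prefix v w"
      using prefixeq_butlast by blast
    moreover have "length v < length w"
      using bw w(2) by auto
    ultimately show False
      using w(1) v(3) prefix_order.trans prefix_length_le by fastforce
  qed
  obtain \<nu> where \<nu>: "\<nu> \<in> space (prob_algebra (states ?T))"
    and joint: "distr M (states ?T) (joint ?T) = \<nu> \<bind> step ?T v"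
    using joint_law_last[OF T(1-3) v(2) last] by blast
  have sets_\<nu>: "sets \<nu> = sets (states ?T)"
    using \<nu> by (simp add: space_prob_algebra)
  have ne_\<nu>: "space \<nu> \<noteq> {}"
    using \<nu> prob_space.not_empty by (auto simp: space_prob_algebra)
  have formula: "(\<integral>\<omega>. G (joint ?T \<omega>) \<partial>M) = (\<integral>y. (\<integral>z. G (y(v := z)) \<partial>Q (y ?p)) \<partial>\<nu>)"
    if G: "G \<in> borel_measurable (states ?T)" "integrable M (\<lambda>\<omega>. G (joint ?T \<omega>))"
    for G :: "(nat list \<Rightarrow> 'a) \<Rightarrow> real"
  proof -
    have "(\<integral>\<omega>. G (joint ?T \<omega>) \<partial>M) = (\<integral>x. G x \<partial>(\<nu> \<bind> step ?T v))"
      unfolding joint[symmetric] by (rule integral_distr[symmetric, OF joint_measurable[OF T(2)] G(1)])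
    also have "\<dots> = (\<integral>y. (\<integral>x. G x \<partial>step ?T v y) \<partial>\<nu>)"
    proof (rule integral_bind_integrable)
      show "step ?T v \<in> \<nu> \<rightarrow>\<^sub>M subprob_algebra (states ?T)"
        using measurable_prob_algebraD[OF step_measurable[OF T(3,4)]] sets_\<nu>
        by (simp cong: measurable_cong_sets)
      show "integrable (\<nu> \<bind> step ?T v) G"
        unfolding joint[symmetric] using integrable_distr_eq[OF joint_measurable[OF T(2)] G(1)] G(2) by simp
    qed (rule ne_\<nu>)
    also have "\<dots> = (\<integral>y. (\<integral>z. G (y(v := z)) \<partial>Q (y ?p)) \<partial>\<nu>)"
    proof (intro Bochner_Integration.integral_cong refl)
      fix y assume "y \<in> space \<nu>"
      then have "y \<in> space (states ?T)"
        using sets_eq_imp_space_eq[OF sets_\<nu>] by simp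
      then have "(\<lambda>z. y(v := z)) \<in> Q (y ?p) \<rightarrow>\<^sub>M states ?T"
        using upd_measurable_at[OF T(3)] by (simp cong: measurable_cong_sets)
      then show "(\<integral>x. G x \<partial>step ?T v y) = (\<integral>z. G (y(v := z)) \<partial>Q (y ?p))"
        unfolding step_def using G(1) by (rule integral_distr)
    qed
    finally show ?thesis .
  qed
  have coord: "(\<lambda>x. k (x w)) \<in> borel_measurable (states ?T)"
    if "w \<in> ?T" "k \<in> borel_measurable borel" for w and k :: "'a \<Rightarrow> real"
    using measurable_compose[OF measurable_component_singleton[OF that(1), of "\<lambda>_. borel"] that(2)] .
  have p: "?p \<in> UHN"
    using T(2,4) by blast
  have ne: "?p \<noteq> v" "u \<noteq> v"
    using last[OF T(3) v(2)] v(3) by auto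
  have "(\<integral>\<omega>. F (X u \<omega>) * g (X v \<omega>) \<partial>M) = (\<integral>y. (\<integral>z. F (y u) * g z \<partial>Q (y ?p)) \<partial>\<nu>)"
    using formula[of "\<lambda>x. F (x u) * g (x v)"] T(3,5) ne
      coord[OF T(5) L2_borel[OF F]] coord[OF T(3) L2_borel[OF g]]
      L2_add(2)[OF L2_process[OF u F] L2_process[OF v(1) g]]
    by simp
  also have "\<dots> = (\<integral>y. (\<integral>z. F (y u) * kernel_op Q g (y ?p) \<partial>Q (y ?p)) \<partial>\<nu>)"
    using prob_space.prob_space[OF prob_space_Q] by (simp add: kernel_op_def)
  also have "\<dots> = (\<integral>\<omega>. F (X u \<omega>) * kernel_op Q g (X ?p \<omega>) \<partial>M)"
    using formula[of "\<lambda>x. F (x u) * kernel_op Q g (x ?p)"] T(3-5) ne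
      coord[OF T(5) L2_borel[OF F]] coord[OF T(4) L2_borel[OF Qg]]
      L2_add(2)[OF L2_process[OF u F] L2_process[OF p Qg]]
    by simp
  finally show ?thesis .
qed

end

section \<open>Variance of empirical means\<close>

lemma moment_mult_monom:
  "moment c (p * q * monom 1 d) = (\<Sum>i\<le>degree p. \<Sum>j\<le>degree q. coeff p i * coeff q j * c (i + j + d))"
proof -
  have "p * q * monom 1 d = (\<Sum>i\<le>degree p. \<Sum>j\<le>degree q. monom (coeff p i * coeff q j) (i + j + d))"
  proof -
    have "p * q = (\<Sum>i\<le>degree p. monom (coeff p i) i) * (\<Sum>j\<le>degree q. monom (coeff q j) j)"
      by (simp only: poly_as_sum_of_monoms)
    also have "\<dots> = (\<Sum>i\<le>degree p. \<Sum>j\<le>degree q. monom (coeff p i) i * monom (coeff q j) j)"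
      by (rule sum_product)
    finally show ?thesis
      by (simp add: sum_distrib_right mult_monom)
  qed
  then show ?thesis
    by (simp add: moment_sum moment_monom)
qed

text \<open>The distance enumerator: its coefficients count ordered pairs by distance.\<close>

definition dist_poly :: "nat list set \<Rightarrow> real poly" where
  "dist_poly A = (\<Sum>u\<in>A. \<Sum>v\<in>A. monom 1 (tree_dist u v))"

lemma moment_dist_poly: "moment c (dist_poly A) = (\<Sum>u\<in>A. \<Sum>v\<in>A. c (tree_dist u v))"
  by (simp add: dist_poly_def moment_sum moment_monom)

lemma poly_dist_poly: "realizes r A T \<Longrightarrow> poly (dist_poly A) l = pair_sum l T"
  by (simp add: dist_poly_def poly_sum poly_monom realizes_pair_sum)

context
  fixes c :: "nat \<Rightarrow> real" and n :: nat and A L :: "nat list set"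
  assumes c: "interval_moments c"
    and A: "subtree_of_size n A" and L: "subtree_of_size n L" "is_line_graph n L"
begin

lemma dist_poly_line:
  obtains r T where "realizes r A T" "rsize T = n"
    "\<And>l. poly (dist_poly A - dist_poly L) l = pair_sum l T - pair_sum l (end_path n)"
proof -
  obtain r T where T: "realizes r A T" "rsize T = n"
    using subtree_realizes[OF A] by blast
  obtain s U where U: "realizes s L U" "rsize U = n"
    using subtree_realizes[OF L(1)] by blast
  have "upath U"
    using is_line_graph_iff_upath[OF U(1)] L(2) U(2) by simp
  then have "pair_sum l U = pair_sum l (end_path n)" for l
    using pair_sum_upath U(2) by blast
  then show ?thesis
    using that[OF T] T U by (simp add: poly_dist_poly)
qed

lemma line_moment_le: "moment c (dist_poly L) \<le> moment c (dist_poly A)"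
proof -
  obtain r T where T: "rsize T = n"
    "\<And>l. poly (dist_poly A - dist_poly L) l = pair_sum l T - pair_sum l (end_path n)"
    using dist_poly_line by metis
  have "0 \<le> moment c (dist_poly A - dist_poly L)"
    by (rule moment_nonneg[OF c]) (use pair_sum_ge[of _ T] T in auto)
  then show ?thesis
    by (simp add: moment_diff)
qed

lemma line_moment_less:
  assumes h: "moment c ([:0, 1, 0, -1:] * [:0, 1, 0, -1:]) \<noteq> 0" and "\<not> is_line_graph n A"
  shows "moment c (dist_poly L) < moment c (dist_poly A)"
proof -
  obtain r T where T: "realizes r A T" "rsize T = n"
    "\<And>l. poly (dist_poly A - dist_poly L) l = pair_sum l T - pair_sum l (end_path n)"
    using dist_poly_line by metis
  have "\<not> upath T"
    using is_line_graph_iff_upath[OF T(1)] assms(2) T(2) by simp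
  then have "0 < moment c (dist_poly A - dist_poly L)"
    using pair_sum_gt[of _ T] pair_sum_ge[of _ T] T by (intro moment_pos[OF c _ _ h]) auto
  then show ?thesis
    by (simp add: moment_diff)
qed

end

text \<open>From index 1 on \<open>c\<close> depends on parity only. So the covariance of a pair is
  a constant plus a multiple of the product of its two colours, with a correction on the diagonal,
  and the double sum sees only the size and the colour imbalance of \<open>A\<close>.\<close>

lemma moment_dist_poly_periodic:
  assumes per: "\<And>k. k \<ge> 1 \<Longrightarrow> c (k + 2) = c k" and A: "finite A"
  shows "moment c (dist_poly A) = real (card A) * (c 0 - c 2) + (real (card A))\<^sup>2 * ((c 1 + c 2) / 2)
    + (c 2 - c 1) / 2 * (\<Sum>u\<in>A. (-1) ^ length u)\<^sup>2"
proof -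
  have c: "c k = (if even k then c 2 else c 1)" if "k \<ge> 1" for k
    using that
  proof (induction k rule: less_induct)
    case (less k)
    show ?case
    proof (cases "k \<le> 2")
      case True
      then have "k = 1 \<or> k = 2"
        using less.prems by linarith
      then show ?thesis by auto
    next
      case False
      then have "k - 2 + 2 = k" "1 \<le> k - 2"
        by linarith+
      then have "c k = c (k - 2)"
        using per[of "k - 2"] by (simp only:)
      then show ?thesis
        using less.IH[of "k - 2"] False by simp
    qed
  qed
  have eq: "c (tree_dist u v) = (if u = v then c 0 - c 2 else 0) + ((c 1 + c 2) / 2
      + (c 2 - c 1) / 2 * ((-1) ^ length u * (-1) ^ length v))" for u v :: "nat list"
  proof (cases "u = v")
    case True
    then show ?thesis by (simp add: field_simps flip: power_add)
  next
    case False
    have "tree_dist u v \<ge> 1"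
    proof (rule ccontr)
      assume "\<not> tree_dist u v \<ge> 1"
      then have "tree_dist u v = 0" by simp
      then show False
        using False by (induction u v rule: tree_dist.induct) (auto split: if_splits)
    qed
    then show ?thesis
      using False c[of "tree_dist u v"] even_tree_dist[of u v]
      by (cases "even (length u)"; cases "even (length v)") (auto simp: field_simps)
  qed
  have "moment c (dist_poly A) = (\<Sum>u\<in>A. \<Sum>v\<in>A. if u = v then c 0 - c 2 else 0)
    + (\<Sum>u\<in>A. \<Sum>v\<in>A. (c 1 + c 2) / 2)
    + (c 2 - c 1) / 2 * (\<Sum>u\<in>A. \<Sum>v\<in>A. (-1) ^ length u * (-1) ^ length v)"
    unfolding moment_dist_poly eq by (simp only: sum.distrib sum_distrib_left add.assoc)
  also have "(\<Sum>u\<in>A. \<Sum>v\<in>A. if u = v then c 0 - c 2 else 0) = real (card A) * (c 0 - c 2)"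
    using A by simp
  also have "(\<Sum>u\<in>A. \<Sum>v\<in>A. (c 1 + c 2) / 2) = (real (card A))\<^sup>2 * ((c 1 + c 2) / 2)"
    by (simp add: power2_eq_square)
  also have "(\<Sum>u\<in>A. \<Sum>v\<in>A. (-1) ^ length u * (-1) ^ length v) = (\<Sum>u\<in>A. (-1::real) ^ length u)\<^sup>2"
    by (simp only: power2_eq_square sum_product)
  finally show ?thesis .
qed

lemma balanced_fork_moment:
  assumes "n \<ge> 5" "\<And>k. k \<ge> 1 \<Longrightarrow> c (k + 2) = c k"
  shows "moment c (dist_poly (balanced_fork n)) = moment c (dist_poly (ray n))"
proof -
  have "card (balanced_fork n) = n" "finite (balanced_fork n)" "card (ray n) = n" "finite (ray n)"
    using balanced_fork_subtree[OF assms(1)] ray_subtree[of n] assms(1)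
    by (auto simp: subtree_of_size_def)
  then show ?thesis
    using balanced_fork_parity[OF assms(1)] moment_dist_poly_periodic[of c, OF assms(2)] by simp
qed

section \<open>Covariances as moments of the operator\<close>

locale reversible_branching_process = branching_process +
  assumes operator: "L2_operator \<mu> (kernel_op Q)"
    and self_adjoint: "L2_self_adjoint \<mu> (kernel_op Q)"
begin

sublocale M: prob_space M
  by (rule prob_space_M)

sublocale \<mu>: prob_space \<mu>
  by (rule prob_space_mu)

abbreviation iter :: "('a \<Rightarrow> real) \<Rightarrow> nat \<Rightarrow> 'a \<Rightarrow> real" where
  "iter f k \<equiv> (kernel_op Q ^^ k) f"

definition autocov :: "('a \<Rightarrow> real) \<Rightarrow> nat \<Rightarrow> real" where
  "autocov f k = L2_inner \<mu> f (iter f k)"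

lemma iter_L2: "f \<in> L2 \<mu> \<Longrightarrow> iter f k \<in> L2 \<mu>"
  using operator by (induction k) (auto simp: L2_operator_def)

lemma inner_iter:
  assumes "f \<in> L2 \<mu>"
  shows "L2_inner \<mu> (iter f i) (iter f j) = autocov f (i + j)"
proof (induction i arbitrary: j)
  case (Suc i)
  have "L2_inner \<mu> (iter f (Suc i)) (iter f j) = L2_inner \<mu> (iter f i) (iter f (Suc j))"
    using self_adjoint iter_L2[OF assms] by (simp add: L2_self_adjoint_def)
  then show ?case
    using Suc[of "Suc j"] by simp
qed (simp add: autocov_def)

text \<open>Of two different vertices one is not an ancestor of the other. The Markov property there
  removes its last letter and applies the kernel once more, while the distance drops by 1;
  \<open>i\<close> and \<open>j\<close> are general to record the applications on both
  sides.\<close>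

lemma expectation_iter:
  assumes "f \<in> L2 \<mu>" "u \<in> UHN" "v \<in> UHN"
  shows "(\<integral>\<omega>. iter f i (X u \<omega>) * iter f j (X v \<omega>) \<partial>M) = autocov f (i + j + tree_dist u v)"
  using assms(2,3)
proof (induction "length u + length v" arbitrary: u v i j rule: less_induct)
  case less
  have shift: "(\<integral>\<omega>. iter f i (X u \<omega>) * iter f j (X v \<omega>) \<partial>M) = autocov f (i + j + tree_dist u v)"
    if np: "\<not> prefix v u" and uv: "u \<in> UHN" "v \<in> UHN"
      and IH: "\<And>i j. (\<integral>\<omega>. iter f i (X u \<omega>) * iter f j (X (butlast v) \<omega>) \<partial>M)
          = autocov f (i + j + tree_dist u (butlast v))"
    for u v i j
  proof -
    have v: "v \<noteq> []"
      using np by auto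
    have "(\<integral>\<omega>. iter f i (X u \<omega>) * iter f j (X v \<omega>) \<partial>M)
        = (\<integral>\<omega>. iter f i (X u \<omega>) * iter f (Suc j) (X (butlast v) \<omega>) \<partial>M)"
      using markov_property[OF uv v np iter_L2[OF assms(1)] iter_L2[OF assms(1)]]
        iter_L2[OF assms(1), of "Suc j"] by simp
    also have "\<dots> = autocov f (i + j + tree_dist u v)"
      using tree_dist_butlast[OF v np] by (simp add: IH del: funpow.simps)
    finally show ?thesis .
  qed
  have butlast_UHN: "butlast w \<in> UHN" if "w \<in> UHN" for w
    using prefixes_UHN[OF that] prefixeq_butlast[of w] by auto
  consider "u = v" | "\<not> prefix v u" | "\<not> prefix u v"
    using prefix_order.antisym by blast
  then show ?case
  proof cases
    case 1
    note [measurable] = L2_borel[OF iter_L2[OF assms(1)]]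
    have "(\<integral>\<omega>. iter f i (X u \<omega>) * iter f j (X u \<omega>) \<partial>M) = L2_inner \<mu> (iter f i) (iter f j)"
      unfolding L2_inner_def using less.prems(1)
      by (rule law_integral(1)) measurable
    then show ?thesis
      using 1 inner_iter[OF assms(1)] by simp
  next
    case 2
    show ?thesis
    proof (rule shift[OF 2 less.prems])
      show "(\<integral>\<omega>. iter f i (X u \<omega>) * iter f j (X (butlast v) \<omega>) \<partial>M)
          = autocov f (i + j + tree_dist u (butlast v))" for i j
      proof (rule less.hyps)
        show "length u + length (butlast v) < length u + length v"
          using 2 by (cases v rule: rev_cases) auto
      qed (use less.prems butlast_UHN in blast)+
    qed
  next
    case 3
    have "(\<integral>\<omega>. iter f j (X v \<omega>) * iter f i (X u \<omega>) \<partial>M) = autocov f (j + i + tree_dist v u)"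
    proof (rule shift[OF 3 less.prems(2,1)])
      show "(\<integral>\<omega>. iter f i (X v \<omega>) * iter f j (X (butlast u) \<omega>) \<partial>M)
          = autocov f (i + j + tree_dist v (butlast u))" for i j
      proof (rule less.hyps)
        show "length v + length (butlast u) < length u + length v"
          using 3 by (cases u rule: rev_cases) auto
      qed (use less.prems butlast_UHN in blast)+
    qed
    then show ?thesis
      by (simp add: mult.commute add.commute tree_dist_sym)
  qed
qed

text \<open>The function \<open>p(Q) f\<close> of polynomial functional calculus.\<close>

definition poly_op :: "real poly \<Rightarrow> ('a \<Rightarrow> real) \<Rightarrow> 'a \<Rightarrow> real" where
  "poly_op p f x = (\<Sum>i\<le>degree p. coeff p i * iter f i x)"

lemma expectation_poly_op:
  assumes f: "f \<in> L2 \<mu>" and uv: "u \<in> UHN" "v \<in> UHN"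
  shows "(\<integral>\<omega>. poly_op p f (X u \<omega>) * poly_op q f (X v \<omega>) \<partial>M)
      = moment (autocov f) (p * q * monom 1 (tree_dist u v))"
    and "integrable M (\<lambda>\<omega>. poly_op p f (X u \<omega>) * poly_op q f (X v \<omega>))"
proof -
  have int: "integrable M (\<lambda>\<omega>. iter f i (X u \<omega>) * iter f j (X v \<omega>))" for i j
    using L2_add(2)[OF L2_process[OF uv(1) iter_L2[OF f]] L2_process[OF uv(2) iter_L2[OF f]]] .
  have eq: "poly_op p f (X u \<omega>) * poly_op q f (X v \<omega>) = (\<Sum>i\<le>degree p. \<Sum>j\<le>degree q.
      (coeff p i * coeff q j) * (iter f i (X u \<omega>) * iter f j (X v \<omega>)))" for \<omega>
    unfolding poly_op_def sum_product by (simp add: mult_ac)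
  show "integrable M (\<lambda>\<omega>. poly_op p f (X u \<omega>) * poly_op q f (X v \<omega>))"
    unfolding eq by (intro Bochner_Integration.integrable_sum integrable_mult_right int)
  show "(\<integral>\<omega>. poly_op p f (X u \<omega>) * poly_op q f (X v \<omega>) \<partial>M)
      = moment (autocov f) (p * q * monom 1 (tree_dist u v))"
    unfolding eq moment_mult_monom
    using int by (simp add: Bochner_Integration.integral_sum expectation_iter[OF f uv])
qed

text \<open>Positivity is read off the process. For \<open>Y = poly_op q f\<close> at the root and
  at a child, the second moments of one value, of the sum and of the difference are nonnegative;
  expanding them produces the factors \<open>1 + x\<close> and \<open>1 - x\<close>.\<close>

lemma interval_moments_autocov:
  assumes f: "f \<in> L2 \<mu>"
  shows "interval_moments (autocov f)"
  unfolding interval_moments_def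
proof (intro allI conjI)
  fix q
  let ?Y = "\<lambda>u \<omega>. poly_op q f (X u \<omega>)"
  have uhn: "[] \<in> UHN" "[1] \<in> UHN"
    by (auto simp: UHN_def)
  have diag: "(\<integral>\<omega>. ?Y u \<omega> * ?Y u \<omega> \<partial>M) = moment (autocov f) (q * q)" if "u \<in> UHN" for u
    using expectation_poly_op(1)[OF f that that, of q q] by (simp add: monom_0)
  have off: "(\<integral>\<omega>. ?Y [] \<omega> * ?Y [1] \<omega> \<partial>M) = moment (autocov f) (q * q * [:0, 1:])"
    using expectation_poly_op(1)[OF f uhn, of q q] by (simp add: monom_altdef)
  note int = expectation_poly_op(2)[OF f, of _ _ q q]
  show "0 \<le> moment (autocov f) (q * q)"
    unfolding diag[OF uhn(1), symmetric] by (rule integral_nonneg_AE) simp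
  have "0 \<le> (\<integral>\<omega>. (?Y [] \<omega> + s * ?Y [1] \<omega>)\<^sup>2 \<partial>M)" for s
    by simp
  also have "(\<integral>\<omega>. (?Y [] \<omega> + s * ?Y [1] \<omega>)\<^sup>2 \<partial>M)
      = (1 + s * s) * moment (autocov f) (q * q) + 2 * s * moment (autocov f) (q * q * [:0, 1:])" for s
  proof -
    have "(\<integral>\<omega>. (?Y [] \<omega> + s * ?Y [1] \<omega>)\<^sup>2 \<partial>M) = (\<integral>\<omega>. ?Y [] \<omega> * ?Y [] \<omega>
        + (s * s) * (?Y [1] \<omega> * ?Y [1] \<omega>) + (2 * s) * (?Y [] \<omega> * ?Y [1] \<omega>) \<partial>M)"
      by (simp add: power2_eq_square algebra_simps)
    also have "\<dots> = (\<integral>\<omega>. ?Y [] \<omega> * ?Y [] \<omega> \<partial>M) + (s * s) * (\<integral>\<omega>. ?Y [1] \<omega> * ?Y [1] \<omega> \<partial>M)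
        + (2 * s) * (\<integral>\<omega>. ?Y [] \<omega> * ?Y [1] \<omega> \<partial>M)"
      using int uhn by simp
    finally show ?thesis
      unfolding diag[OF uhn(1)] diag[OF uhn(2)] off by (simp add: algebra_simps)
  qed
  finally have key: "0 \<le> (1 + s * s) * moment (autocov f) (q * q)
      + 2 * s * moment (autocov f) (q * q * [:0, 1:])" for s .
  have "0 \<le> moment (autocov f) (q * q) + moment (autocov f) (q * q * [:0, 1:])"
    "0 \<le> moment (autocov f) (q * q) - moment (autocov f) (q * q * [:0, 1:])"
    using key[of 1] key[of "-1"] by simp_all
  moreover have "[:1, 1:] * (q * q) = q * q + q * q * [:0, 1:]"
    "[:1, -1:] * (q * q) = q * q - q * q * [:0, 1:]"
    by (simp_all add: algebra_simps)
  ultimately show "0 \<le> moment (autocov f) ([:1, 1:] * (q * q))"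
    "0 \<le> moment (autocov f) ([:1, -1:] * (q * q))"
    by (simp_all only: moment_add moment_diff)
qed

lemma kernel_const: "kernel_op Q (\<lambda>_. a) = (\<lambda>_. a)"
  using prob_space.prob_space[OF prob_space_Q] by (simp add: kernel_op_def fun_eq_iff)

lemma const_L2: "(\<lambda>_. a) \<in> L2 \<mu>"
  by (simp add: L2_def)

lemma L2_integrable: "f \<in> L2 \<mu> \<Longrightarrow> integrable \<mu> f"
  using L2_add(2)[of f \<mu> "\<lambda>_. 1"] const_L2 by simp

lemma expectation_empirical_mean:
  assumes "f \<in> L2 \<mu>" "A \<subseteq> UHN" "finite A" "A \<noteq> {}"
  shows "M.expectation (empirical_mean X f A) = (\<integral>x. f x \<partial>\<mu>)"
proof -
  have int: "integrable M (\<lambda>\<omega>. f (X u \<omega>))" "(\<integral>\<omega>. f (X u \<omega>) \<partial>M) = (\<integral>x. f x \<partial>\<mu>)" if "u \<in> A" for u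
    using law_integral[OF _ L2_borel[OF assms(1)], of u] L2_integrable[OF assms(1)] that assms(2) by auto
  have "M.expectation (empirical_mean X f A) = (\<integral>\<omega>. (\<Sum>u\<in>A. f (X u \<omega>)) \<partial>M) / real (card A)"
    by (simp add: empirical_mean_def[abs_def])
  also have "(\<integral>\<omega>. (\<Sum>u\<in>A. f (X u \<omega>)) \<partial>M) = (\<Sum>u\<in>A. \<integral>x. f x \<partial>\<mu>)"
    using int by (subst Bochner_Integration.integral_sum) auto
  finally show ?thesis
    using assms by simp
qed

abbreviation centered :: "('a \<Rightarrow> real) \<Rightarrow> 'a \<Rightarrow> real" where
  "centered f \<equiv> (\<lambda>x. f x - (\<integral>y. f y \<partial>\<mu>))"

lemma centered_L2: "f \<in> L2 \<mu> \<Longrightarrow> centered f \<in> L2 \<mu>"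
  by (rule L2_diff[OF _ const_L2])

lemma variance_empirical_mean:
  assumes "f \<in> L2 \<mu>" "A \<subseteq> UHN" "finite A" "A \<noteq> {}"
  shows "variance_of_mean M X f A
    = moment (autocov (centered f)) (dist_poly A) / (real (card A))\<^sup>2"
proof -
  let ?g = "centered f"
  note g = centered_L2[OF assms(1)]
  have dev: "(empirical_mean X f A \<omega> - (\<integral>x. f x \<partial>\<mu>))\<^sup>2
      = (\<Sum>u\<in>A. \<Sum>v\<in>A. ?g (X u \<omega>) * ?g (X v \<omega>)) / (real (card A))\<^sup>2" for \<omega>
  proof -
    have "empirical_mean X f A \<omega> - (\<integral>x. f x \<partial>\<mu>) = (\<Sum>u\<in>A. ?g (X u \<omega>)) / real (card A)"
      using assms by (simp add: empirical_mean_def sum_subtractf field_simps)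
    then show ?thesis
      by (simp add: power_divide power2_eq_square sum_product)
  qed
  have int: "integrable M (\<lambda>\<omega>. ?g (X u \<omega>) * ?g (X v \<omega>))" if "u \<in> A" "v \<in> A" for u v
    using that assms(2) L2_process[OF _ g] by (intro L2_add(2)) auto
  have "variance_of_mean M X f A = (\<integral>\<omega>. (\<Sum>u\<in>A. \<Sum>v\<in>A. ?g (X u \<omega>) * ?g (X v \<omega>)) \<partial>M) / (real (card A))\<^sup>2"
    by (simp add: variance_of_mean_def expectation_empirical_mean[OF assms] dev)
  also have "(\<integral>\<omega>. (\<Sum>u\<in>A. \<Sum>v\<in>A. ?g (X u \<omega>) * ?g (X v \<omega>)) \<partial>M)
      = (\<Sum>u\<in>A. \<Sum>v\<in>A. \<integral>\<omega>. ?g (X u \<omega>) * ?g (X v \<omega>) \<partial>M)"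
    using int by (simp add: Bochner_Integration.integral_sum)
  also have "\<dots> = (\<Sum>u\<in>A. \<Sum>v\<in>A. autocov ?g (tree_dist u v))"
    using expectation_iter[OF g, of _ _ 0 0] assms(2) by (intro sum.cong refl) (simp add: subset_iff)
  finally show ?thesis
    by (simp add: moment_dist_poly)
qed

text \<open>The kernel fixes constants, so centering subtracts the same number on both
  sides.\<close>

lemma centered_kernel_iff:
  assumes f: "f \<in> L2 \<mu>"
  shows "(AE x in \<mu>. iter (centered f) 3 x = iter (centered f) 1 x)
     \<longleftrightarrow> (AE x in \<mu>. kernel_op Q (kernel_op Q (kernel_op Q f)) x = kernel_op Q f x)"
proof -
  let ?a = "\<integral>x. f x \<partial>\<mu>" and ?g = "centered f"
  have "AE x in \<mu>. iter ?g k x = iter f k x - ?a" for k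
  proof (induction k)
    case (Suc k)
    have "AE x in \<mu>. kernel_op Q (iter ?g k) x = kernel_op Q (\<lambda>y. iter f k y - ?a) x"
    proof -
      have "iter ?g k \<in> L2 \<mu>" "(\<lambda>x. iter f k x - ?a) \<in> L2 \<mu>"
        by (rule iter_L2[OF centered_L2[OF f]], rule L2_diff[OF iter_L2[OF f] const_L2])
      then show ?thesis
        using operator Suc by (auto simp: L2_operator_def)
    qed
    moreover have "AE x in \<mu>. kernel_op Q (\<lambda>y. iter f k y - ?a) x = kernel_op Q (iter f k) x - ?a"
      using L2_operator_diff[OF operator iter_L2[OF f] const_L2] by (simp add: kernel_const)
    ultimately show ?case
      by eventually_elim simp
  qed simp
  from this[of 3] this[of 1]
  have "AE x in \<mu>. (iter ?g 3 x = iter ?g 1 x) = (iter f 3 x = iter f 1 x)"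
    by eventually_elim simp
  then have "(AE x in \<mu>. iter ?g 3 x = iter ?g 1 x) \<longleftrightarrow> (AE x in \<mu>. iter f 3 x = iter f 1 x)"
    by (rule eventually_subst)
  moreover have "iter f 3 = kernel_op Q (kernel_op Q (kernel_op Q f))" "iter f 1 = kernel_op Q f"
    by (simp_all add: numeral_3_eq_3)
  ultimately show ?thesis
    by (simp only:)
qed

text \<open>The polynomial \<open>x - x ^ 3\<close> of the operator sends \<open>g\<close> to
  \<open>iter g 1 - iter g 3\<close>, and the moment of its square is the squared norm of this
  function.\<close>

lemma moment_autocov_cubic:
  assumes g: "g \<in> L2 \<mu>"
  shows "moment (autocov g) ([:0, 1, 0, -1:] * [:0, 1, 0, -1:]) = 0
    \<longleftrightarrow> (AE x in \<mu>. iter g 3 x = iter g 1 x)"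
proof -
  let ?h = "[:0, 1, 0, -1:] :: real poly"
  let ?d = "\<lambda>x. iter g 1 x - iter g 3 x"
  have "[] \<in> UHN"
    by (simp add: UHN_def)
  have d: "?d \<in> L2 \<mu>"
    by (intro L2_diff iter_L2 g)
  have "degree ?h = Suc (Suc (Suc 0))"
    by simp
  then have op: "poly_op ?h g x = ?d x" for x
    unfolding poly_op_def by (simp add: numeral_3_eq_3)
  have "moment (autocov g) (?h * ?h) = moment (autocov g) (?h * ?h * monom 1 (tree_dist [] ([] :: nat list)))"
    by (simp only: tree_dist_self monom_0 mult_1_right one_pCons[symmetric])
  also have "\<dots> = (\<integral>\<omega>. ?d (X [] \<omega>) * ?d (X [] \<omega>) \<partial>M)"
    unfolding op[symmetric] by (rule expectation_poly_op(1)[OF g \<open>[] \<in> UHN\<close> \<open>[] \<in> UHN\<close>, symmetric])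
  also have "\<dots> = (\<integral>x. ?d x * ?d x \<partial>\<mu>)"
    using L2_borel[OF d] by (intro law_integral(1)[OF \<open>[] \<in> UHN\<close>] borel_measurable_times)
  finally have eq: "moment (autocov g) (?h * ?h) = (\<integral>x. ?d x * ?d x \<partial>\<mu>)" .
  have "(\<integral>x. ?d x * ?d x \<partial>\<mu>) = 0 \<longleftrightarrow> (AE x in \<mu>. ?d x * ?d x = 0)"
    using L2_add(2)[OF d d] by (intro integral_nonneg_eq_0_iff_AE) simp_all
  moreover have "?d x * ?d x = 0 \<longleftrightarrow> iter g 3 x = iter g 1 x" for x
    by auto
  ultimately show ?thesis
    unfolding eq by (simp only:)
qed

text \<open>By self-adjointness \<open>k - 1\<close> applications move to the left factor, leaving
  \<open>iter g 3\<close> against \<open>iter g 1\<close> on the right; this is where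
  \<open>k \<ge> 1\<close> enters.\<close>

lemma autocov_periodic:
  assumes g: "g \<in> L2 \<mu>" and ae: "AE x in \<mu>. iter g 3 x = iter g 1 x" and "k \<ge> 1"
  shows "autocov g (k + 2) = autocov g k"
proof -
  have "autocov g (k + 2) = L2_inner \<mu> (iter g (k - 1)) (iter g 3)"
    using inner_iter[OF g, of "k - 1" 3] assms(3) by simp
  also have "\<dots> = L2_inner \<mu> (iter g (k - 1)) (iter g 1)"
    unfolding L2_inner_def
  proof (rule integral_cong_AE)
    show "AE x in \<mu>. iter g (k - 1) x * iter g 3 x = iter g (k - 1) x * iter g 1 x"
      using ae by eventually_elim simp
    show "(\<lambda>x. iter g (k - 1) x * iter g i x) \<in> borel_measurable \<mu>" for i
      using L2_add(2)[OF iter_L2[OF g] iter_L2[OF g]] by (rule borel_measurable_integrable)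
    then show "(\<lambda>x. iter g (k - 1) x * iter g 1 x) \<in> borel_measurable \<mu>"
      by blast
  qed
  also have "\<dots> = autocov g k"
    using inner_iter[OF g, of "k - 1" 1] assms(3) by simp
  finally show ?thesis .
qed

end

theorem proposition1p4:
  fixes Q :: "'a::metric_space \<Rightarrow> 'a measure"
    and \<mu> :: "'a measure"
    and M :: "'w measure"
    and X :: "nat list \<Rightarrow> 'w \<Rightarrow> 'a"
    and f :: "'a \<Rightarrow> real"
  assumes "markov_kernel Q"
    and "invariant_measure Q \<mu>"
    and "L2_operator \<mu> (kernel_op Q)"
    and "L2_self_adjoint \<mu> (kernel_op Q)"
    and "L2_compact \<mu> (kernel_op Q)"
    and "branching_markov_process M X Q \<mu>"
    and "f \<in> L2 \<mu>"
    and "\<not> (\<exists>c. AE x in \<mu>. f x = c)"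
  shows "(\<forall>A. A \<subseteq> UHN \<and> finite A \<and> A \<noteq> {} \<longrightarrow>
            prob_space.expectation M (empirical_mean X f A) = (\<integral>x. f x \<partial>\<mu>)) \<and>
         (\<forall>n\<ge>1.
            (\<exists>L. subtree_of_size n L \<and> is_line_graph n L) \<and>
            (\<forall>L. subtree_of_size n L \<and> is_line_graph n L \<longrightarrow>
               is_arg_min (variance_of_mean M X f) (subtree_of_size n) L)) \<and>
         (\<forall>n\<ge>5.
            (\<forall>A. subtree_of_size n A \<longrightarrow>
               (is_arg_min (variance_of_mean M X f) (subtree_of_size n) A \<longleftrightarrow>
                is_line_graph n A)) \<longleftrightarrow>
            f \<notin> L2_sum \<mu> (L2_sum \<mu> (L2_ker \<mu> (kernel_op Q))
                                   (L2_ker \<mu> (\<lambda>g x. kernel_op Q g x - g x)))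
                         (L2_ker \<mu> (\<lambda>g x. kernel_op Q g x + g x)))"
proof -
  interpret reversible_branching_process Q \<mu> M X
    using assms by unfold_locales
  note f = \<open>f \<in> L2 \<mu>\<close>
  let ?g = "centered f"
  let ?V = "variance_of_mean M X f" and ?S = "\<lambda>A. moment (autocov ?g) (dist_poly A)"
  note g = centered_L2[OF f]
  note c = interval_moments_autocov[OF g]
  have V: "?V A = ?S A / (real n)\<^sup>2" if "subtree_of_size n A" for A n
    using variance_empirical_mean[OF f, of A] that by (auto simp: subtree_of_size_def subtree_def)
  have le: "?V L \<le> ?V A" if "subtree_of_size n A" "subtree_of_size n L" "is_line_graph n L" for A L n
    using line_moment_le[OF c that] by (simp add: V[OF that(1)] V[OF that(2)] divide_right_mono)
  have line_min: "is_arg_min ?V (subtree_of_size n) L" if "subtree_of_size n L" "is_line_graph n L" for L n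
    using le that by (auto simp: is_arg_min_def not_less)
  have kernels: "f \<in> L2_sum \<mu> (L2_sum \<mu> (L2_ker \<mu> (kernel_op Q)) (L2_ker \<mu> (\<lambda>g x. kernel_op Q g x - g x)))
                         (L2_ker \<mu> (\<lambda>g x. kernel_op Q g x + g x))
      \<longleftrightarrow> (AE x in \<mu>. iter ?g 3 x = iter ?g 1 x)" (is "?K \<longleftrightarrow> _")
    using eigen_decomposition_iff[OF operator f] centered_kernel_iff[OF f] by simp
  have unique: "(\<forall>A. subtree_of_size n A \<longrightarrow>
      (is_arg_min ?V (subtree_of_size n) A \<longleftrightarrow> is_line_graph n A)) \<longleftrightarrow> \<not> ?K" if n: "n \<ge> 5" for n
  proof
    assume line: "\<forall>A. subtree_of_size n A \<longrightarrow>
      (is_arg_min ?V (subtree_of_size n) A \<longleftrightarrow> is_line_graph n A)"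
    show "\<not> ?K"
    proof
      assume ?K
      \<comment> \<open>In the eigenspace case the covariances have period 2 from distance 1 on, so
        a tree with a fork but the path's colour classes ties with it.\<close>
      then have "?S (balanced_fork n) = ?S (ray n)"
        using balanced_fork_moment[OF n] autocov_periodic[OF g] kernels by blast
      moreover have ray: "subtree_of_size n (ray n)"
        using ray_subtree n by simp
      ultimately have "?V (balanced_fork n) = ?V (ray n)"
        using V balanced_fork_subtree[OF n] by simp
      then have "is_arg_min ?V (subtree_of_size n) (balanced_fork n)"
        using line_min[OF ray ray_is_line_graph] balanced_fork_subtree[OF n] by (simp add: is_arg_min_def)
      then show False
        using line balanced_fork_subtree[OF n] balanced_fork_not_line[OF n] by blast
    qed
  next
    assume "\<not> ?K"
    then have h: "moment (autocov ?g) ([:0, 1, 0, -1:] * [:0, 1, 0, -1:]) \<noteq> 0"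
      using kernels moment_autocov_cubic[OF g] by simp
    have ray: "subtree_of_size n (ray n)"
      using ray_subtree n by simp
    have "?V (ray n) < ?V A" if "subtree_of_size n A" "\<not> is_line_graph n A" for A
      using line_moment_less[OF c that(1) ray ray_is_line_graph h that(2)] n
      by (simp add: V[OF that(1)] V[OF ray] divide_strict_right_mono)
    then show "\<forall>A. subtree_of_size n A \<longrightarrow>
      (is_arg_min ?V (subtree_of_size n) A \<longleftrightarrow> is_line_graph n A)"
      using ray line_min by (auto simp: is_arg_min_def)
  qed
  have "\<exists>L. subtree_of_size n L \<and> is_line_graph n L" if "n \<ge> 1" for n
    using ray_subtree[of n] ray_is_line_graph[of n] that by auto
  then show ?thesis
    using expectation_empirical_mean[OF f] line_min unique by blast
qed

end
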